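(* (i) There exists a unique complex unital associative algebra $H_k=H_k(\Sigma)$ satisfying: (a) $H_k=S(V)_{\mathbb{C}}\otimes\mathbb{C}[W]$ as vector spaces, with $\mathbb{C}[W]$ the group algebra of $W$. (b) The maps $p\mapsto p\otimes e$ and $w\mapsto 1\otimes w$, with $e\in W$ the unit element of $W$, are algebra embeddings of $S(V)_{\mathbb{C}}$ and $\mathbb{C}[W]$ into $H_k$. (c) The cross relations $$s_a\cdot v-(s_{Da}v)\cdot s_a=k_aDa(v)$$ hold in $H_k$ for $a\in I$ and $v\in V\subset S(V)_{\mathbb{C}}$, where $S(V)_{\mathbb{C}}$ and $\mathbb{C}[W]$ are identified with their images in $H_k$ through the algebra embeddings of (b). (ii) The assignment $p\mapsto p(\mathcal{D}^k)$ ($p\in S(V)_{\mathbb{C}}$), together with the $W$-action $(wf)(v)=f(w^{-1}v)$, defines a faithful representation $\pi_k:H_k\to\mathrm{End}(C^\infty(V_{reg}))$.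
   Context: Root systems. Let $V$ be a Euclidean space of dimension $n$ and $V^*$ the dual Euclidean space, with norm $\|\cdot\|$ and inner product $\langle\cdot,\cdot\rangle$ on $V^*$. Let $\Sigma_0\subset V^*$ be a finite, irreducible, reduced crystallographic root system. The co-root $\alpha^\vee\in V$ of $\alpha\in\Sigma_0$ is determined by $\xi(\alpha^\vee)=2\langle\xi,\alpha\rangle/\|\alpha\|^2$ for all $\xi\in V^*$. Fix a basis $I_0=\{a_1,\ldots,a_n\}$ of $\Sigma_0$, with highest root $\varphi$. For $\alpha\in\Sigma_0$, $s_\alpha v=v-\alpha(v)\alpha^\vee$ on $V$. $S(V)_{\mathbb{C}}$ is the complexified symmetric algebra of $V$. Affine root system. Affine linear functionals on $V$ are written as elements of $V^*\oplus\mathbb{R}$, and $D$ denotes the projection onto $V^*$ (the gradient). The affine root system is $\Sigma=\Sigma_0+\mathbb{Z}$, with basis $I=\{a_0=-\varphi+1,a_1,\ldots,a_n\}$ and corresponding positive roots $\Sigma^+$. For $a\in\Sigma$ write $Da^\vee=(Da)^\vee$, $V_a=a^{-1}(0)$, and $s_a(v)=v-a(v)Da^\vee$. The affine Weyl group $W$ is generated by all $s_a$ ($a\in\Sigma$). $W$ acts on functions on $V$ (including affine functionals) and on functions on $V_{reg}=V\setminus\bigcup_{a\in\Sigma^+}V_a$ by $(wf)(v)=f(w^{-1}v)$. Multiplicity function. $k:\Sigma\to\mathbb{R}_{>0}$ is a fixed $W$-invariant function with $k(a)=k(Da)$ for all $a\in\Sigma$; write $k_a=k(a)$. Dunkl-type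 operators. For $a\in\Sigma$ let $\chi_a$ be the function on $V_{reg}$ with $\chi_a(v)=1$ if $a(v)<0$ and $\chi_a(v)=0$ if $a(v)>0$. On a given connected component of $V_{reg}$, $\chi_a$ is nonzero for only finitely many $a\in\Sigma^+$. For $v\in V$ define the linear operator on the space $C^\infty(V_{reg})$ of complex-valued smooth functions on $V_{reg}$ $$\mathcal{D}_v^k=\partial_v+\sum_{a\in\Sigma^+}k_aDa(v)\chi_a(\cdot)s_a,$$ where $\partial_v$ is the derivative in direction $v$. These operators are linear in $v$ and pairwise commute, so $v\mapsto\mathcal{D}_v^k$ extends uniquely to an algebra morphism $S(V)_{\mathbb{C}}\to\mathrm{End}(C^\infty(V_{reg}))$, denoted $p\mapsto p(\mathcal{D}^k)$.
   Formalization: In (a) the identification of H_k with S(V)_C ⊗ C[W] is taken to be given by multiplication, i.e. (p⊗e)·(1⊗w) = p⊗w; without this convention conditions (a)–(c) do not determine the algebra uniquely. *)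

theory Defs
  imports
    "HOL-Analysis.Analysis"
    "HOL-Library.Poly_Mapping"
    "HOL-Algebra.Module"
    "HOL-Algebra.Bij"
    "HOL-Algebra.Generated_Groups"
    "HOL-Algebra.Algebraic_Closure_Type"
begin

section \<open>Root systems in the dual of a Euclidean space\<close>

text \<open>
  \<open>V\<close> is a type \<open>'v\<close> of class \<open>euclidean_space\<close> and \<open>V\<^sup>*\<close> is \<open>'v \<Rightarrow>\<^sub>L real\<close>, whose library norm
  (the operator norm) is the dual Euclidean norm. The library has no inner product on this type.
\<close>

definition dual_inner :: "('v::euclidean_space \<Rightarrow>\<^sub>L real) \<Rightarrow> ('v \<Rightarrow>\<^sub>L real) \<Rightarrow> real" where
  "dual_inner \<xi> \<eta> = (\<Sum>b\<in>Basis. blinfun_apply \<xi> b * blinfun_apply \<eta> b)"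

definition coroot :: "('v::euclidean_space \<Rightarrow>\<^sub>L real) \<Rightarrow> 'v" where
  "coroot \<alpha> = (THE u. \<forall>\<xi>. blinfun_apply \<xi> u = 2 * dual_inner \<xi> \<alpha> / (norm \<alpha>)\<^sup>2)"

lemma blinfun_eq_inner_sum:
  fixes \<xi> :: "'v::euclidean_space \<Rightarrow>\<^sub>L real"
  shows "blinfun_apply \<xi> x = (\<Sum>b\<in>Basis. blinfun_apply \<xi> b *\<^sub>R b) \<bullet> x"
proof -
  have "blinfun_apply \<xi> x = blinfun_apply \<xi> (\<Sum>b\<in>Basis. (x \<bullet> b) *\<^sub>R b)"
    by (simp add: euclidean_representation)
  also have "\<dots> = (\<Sum>b\<in>Basis. (x \<bullet> b) * blinfun_apply \<xi> b)"
    by (simp add: blinfun.sum_right blinfun.scaleR_right)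
  finally show ?thesis
    by (simp add: inner_sum_left mult.commute inner_commute[of x])
qed

lemma norm_eq_dual_inner:
  fixes \<xi> :: "'v::euclidean_space \<Rightarrow>\<^sub>L real"
  shows "(norm \<xi>)\<^sup>2 = dual_inner \<xi> \<xi>"
proof -
  define u where "u = (\<Sum>b\<in>Basis. blinfun_apply \<xi> b *\<^sub>R b)"
  have u: "blinfun_apply \<xi> x = u \<bullet> x" for x
    unfolding u_def by (rule blinfun_eq_inner_sum)
  have "norm \<xi> = norm u"
  proof (rule antisym)
    show "norm \<xi> \<le> norm u"
      by (rule norm_blinfun_bound) (auto simp: u Cauchy_Schwarz_ineq2)
    have "(norm u)\<^sup>2 \<le> norm \<xi> * norm u"
      using norm_blinfun[of \<xi> u] by (simp add: u power2_norm_eq_inner)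
    then show "norm u \<le> norm \<xi>"
      by (cases "u = 0") (auto simp: power2_eq_square)
  qed
  also have "(norm u)\<^sup>2 = (\<Sum>b\<in>Basis. (u \<bullet> b) * (u \<bullet> b))"
    unfolding power2_norm_eq_inner by (rule euclidean_inner)
  also have "\<dots> = dual_inner \<xi> \<xi>"
    by (simp add: dual_inner_def u)
  finally show ?thesis .
qed

lemma coroot_apply:
  fixes \<alpha> :: "'v::euclidean_space \<Rightarrow>\<^sub>L real"
  shows "blinfun_apply \<xi> (coroot \<alpha>) = 2 * dual_inner \<xi> \<alpha> / (norm \<alpha>)\<^sup>2"
proof -
  define u where "u = (2 / (norm \<alpha>)\<^sup>2) *\<^sub>R (\<Sum>b\<in>Basis. blinfun_apply \<alpha> b *\<^sub>R b)"
  have u: "\<forall>\<xi>. blinfun_apply \<xi> u = 2 * dual_inner \<xi> \<alpha> / (norm \<alpha>)\<^sup>2"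
    by (simp add: u_def dual_inner_def blinfun.sum_right blinfun.scaleR_right mult.commute)
  have "u' = u" if u': "\<forall>\<xi>. blinfun_apply \<xi> u' = 2 * dual_inner \<xi> \<alpha> / (norm \<alpha>)\<^sup>2" for u'
  proof (rule euclidean_eqI)
    fix b :: 'v
    have "blinfun_apply (blinfun_inner_left b) u' = blinfun_apply (blinfun_inner_left b) u"
      using u u' by metis
    then show "u' \<bullet> b = u \<bullet> b"
      by (simp add: inner_commute)
  qed
  with u have "\<forall>\<xi>. blinfun_apply \<xi> (coroot \<alpha>) = 2 * dual_inner \<xi> \<alpha> / (norm \<alpha>)\<^sup>2"
    unfolding coroot_def by (rule theI)
  then show ?thesis
    by blast
qed

definition root_system :: "('v::euclidean_space \<Rightarrow>\<^sub>L real) set \<Rightarrow> bool" where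
  "root_system \<Sigma>0 \<longleftrightarrow>
     finite \<Sigma>0 \<and> 0 \<notin> \<Sigma>0 \<and> span \<Sigma>0 = UNIV \<and>
     (\<forall>\<alpha>\<in>\<Sigma>0. \<forall>\<beta>\<in>\<Sigma>0. \<beta> - (2 * dual_inner \<beta> \<alpha> / (norm \<alpha>)\<^sup>2) *\<^sub>R \<alpha> \<in> \<Sigma>0)"

definition crystallographic :: "('v::euclidean_space \<Rightarrow>\<^sub>L real) set \<Rightarrow> bool" where
  "crystallographic \<Sigma>0 \<longleftrightarrow> (\<forall>\<alpha>\<in>\<Sigma>0. \<forall>\<beta>\<in>\<Sigma>0. 2 * dual_inner \<beta> \<alpha> / (norm \<alpha>)\<^sup>2 \<in> \<int>)"

definition reduced_roots :: "('v::euclidean_space \<Rightarrow>\<^sub>L real) set \<Rightarrow> bool" where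
  "reduced_roots \<Sigma>0 \<longleftrightarrow> (\<forall>\<alpha>\<in>\<Sigma>0. \<forall>c. c *\<^sub>R \<alpha> \<in> \<Sigma>0 \<longrightarrow> c = 1 \<or> c = -1)"

definition irreducible_roots :: "('v::euclidean_space \<Rightarrow>\<^sub>L real) set \<Rightarrow> bool" where
  "irreducible_roots \<Sigma>0 \<longleftrightarrow>
     \<Sigma>0 \<noteq> {} \<and>
     \<not> (\<exists>A B. A \<noteq> {} \<and> B \<noteq> {} \<and> A \<union> B = \<Sigma>0 \<and> A \<inter> B = {} \<and>
            (\<forall>\<alpha>\<in>A. \<forall>\<beta>\<in>B. dual_inner \<alpha> \<beta> = 0))"

definition nonneg_comb :: "'a::real_vector set \<Rightarrow> 'a set" where
  "nonneg_comb B = {x. \<exists>c :: 'a \<Rightarrow> nat. x = (\<Sum>b\<in>B. of_nat (c b) *\<^sub>R b)}"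

definition root_basis ::
  "('v::euclidean_space \<Rightarrow>\<^sub>L real) set \<Rightarrow> ('v \<Rightarrow>\<^sub>L real) set \<Rightarrow> bool" where
  "root_basis \<Sigma>0 I0 \<longleftrightarrow>
     I0 \<subseteq> \<Sigma>0 \<and> independent I0 \<and> (\<forall>\<alpha>\<in>\<Sigma>0. \<alpha> \<in> nonneg_comb I0 \<or> - \<alpha> \<in> nonneg_comb I0)"

definition highest_root ::
  "('v::euclidean_space \<Rightarrow>\<^sub>L real) set \<Rightarrow> ('v \<Rightarrow>\<^sub>L real) set \<Rightarrow> ('v \<Rightarrow>\<^sub>L real) \<Rightarrow> bool" where
  "highest_root \<Sigma>0 I0 \<phi> \<longleftrightarrow> \<phi> \<in> \<Sigma>0 \<and> (\<forall>\<alpha>\<in>\<Sigma>0. \<phi> - \<alpha> \<in> nonneg_comb I0)"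

section \<open>The affine root system and the affine Weyl group\<close>

text \<open>
  Elements of \<open>V\<^sup>* \<oplus> \<real>\<close> are pairs; \<open>(\<xi>, c)\<close> stands for the affine functional \<open>v \<mapsto> \<xi>(v) + c\<close>, and the
  gradient \<open>D\<close> is \<open>fst\<close>.
\<close>

type_synonym 'v affine_functional = "('v \<Rightarrow>\<^sub>L real) \<times> real"

definition aff_apply :: "'v::euclidean_space affine_functional \<Rightarrow> 'v \<Rightarrow> real" where
  "aff_apply a x = blinfun_apply (fst a) x + snd a"

definition lin_reflection :: "('v::euclidean_space \<Rightarrow>\<^sub>L real) \<Rightarrow> 'v \<Rightarrow> 'v" where
  "lin_reflection \<alpha> x = x - blinfun_apply \<alpha> x *\<^sub>R coroot \<alpha>"

definition aff_reflection :: "'v::euclidean_space affine_functional \<Rightarrow> 'v \<Rightarrow> 'v" where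
  "aff_reflection a x = x - aff_apply a x *\<^sub>R coroot (fst a)"

definition affine_roots ::
  "('v::euclidean_space \<Rightarrow>\<^sub>L real) set \<Rightarrow> 'v affine_functional set" where
  "affine_roots \<Sigma>0 = {(\<alpha>, of_int m) | \<alpha> m. \<alpha> \<in> \<Sigma>0}"

definition affine_basis ::
  "('v::euclidean_space \<Rightarrow>\<^sub>L real) set \<Rightarrow> ('v \<Rightarrow>\<^sub>L real) \<Rightarrow> 'v affine_functional set" where
  "affine_basis I0 \<phi> = insert (- \<phi>, 1) ((\<lambda>\<alpha>. (\<alpha>, 0)) ` I0)"

definition positive_affine_roots ::
  "('v::euclidean_space \<Rightarrow>\<^sub>L real) set \<Rightarrow> ('v \<Rightarrow>\<^sub>L real) set \<Rightarrow> ('v \<Rightarrow>\<^sub>L real) \<Rightarrow>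
   'v affine_functional set" where
  "positive_affine_roots \<Sigma>0 I0 \<phi> = affine_roots \<Sigma>0 \<inter> nonneg_comb (affine_basis I0 \<phi>)"

definition affine_Weyl_group :: "('v::euclidean_space \<Rightarrow>\<^sub>L real) set \<Rightarrow> ('v \<Rightarrow> 'v) monoid" where
  "affine_Weyl_group \<Sigma>0 =
     (BijGroup UNIV)\<lparr>carrier := generate (BijGroup UNIV) (aff_reflection ` affine_roots \<Sigma>0)\<rparr>"

definition fun_action :: "('v \<Rightarrow> 'v) \<Rightarrow> ('v \<Rightarrow> 'b) \<Rightarrow> 'v \<Rightarrow> 'b" where
  "fun_action w f = (\<lambda>x. f (inv_into UNIV w x))"

definition multiplicity_function ::
  "('v::euclidean_space \<Rightarrow>\<^sub>L real) set \<Rightarrow> ('v affine_functional \<Rightarrow> real) \<Rightarrow> bool" where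
  "multiplicity_function \<Sigma>0 k \<longleftrightarrow>
     (\<forall>a\<in>affine_roots \<Sigma>0. k a > 0) \<and>
     (\<forall>a\<in>affine_roots \<Sigma>0. \<forall>b\<in>affine_roots \<Sigma>0. \<forall>w\<in>carrier (affine_Weyl_group \<Sigma>0).
        aff_apply b = fun_action w (aff_apply a) \<longrightarrow> k b = k a) \<and>
     (\<forall>a\<in>affine_roots \<Sigma>0. k a = k (fst a, 0))"

definition regular_set ::
  "('v::euclidean_space \<Rightarrow>\<^sub>L real) set \<Rightarrow> ('v \<Rightarrow>\<^sub>L real) set \<Rightarrow> ('v \<Rightarrow>\<^sub>L real) \<Rightarrow> 'v set" where
  "regular_set \<Sigma>0 I0 \<phi> = UNIV - (\<Union>a\<in>positive_affine_roots \<Sigma>0 I0 \<phi>. {x. aff_apply a x = 0})"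

section \<open>Complex algebras\<close>

abbreviation complex_ring :: "complex ring" where
  "complex_ring \<equiv> ring_of_type_algebra"

text \<open>The library locale \<open>algebra\<close> is restricted to commutative algebras.\<close>

definition complex_algebra :: "(complex, 'a) module \<Rightarrow> bool" where
  "complex_algebra A \<longleftrightarrow>
     Ring.ring A \<and> Module.module complex_ring A \<and>
     (\<forall>c. \<forall>x\<in>carrier A. \<forall>y\<in>carrier A.
        (c \<odot>\<^bsub>A\<^esub> x) \<otimes>\<^bsub>A\<^esub> y = c \<odot>\<^bsub>A\<^esub> (x \<otimes>\<^bsub>A\<^esub> y) \<and> x \<otimes>\<^bsub>A\<^esub> (c \<odot>\<^bsub>A\<^esub> y) = c \<odot>\<^bsub>A\<^esub> (x \<otimes>\<^bsub>A\<^esub> y))"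

definition algebra_hom ::
  "(complex, 'a) module \<Rightarrow> (complex, 'b) module \<Rightarrow> ('a \<Rightarrow> 'b) set" where
  "algebra_hom A B = {h \<in> ring_hom A B. \<forall>c. \<forall>x\<in>carrier A. h (c \<odot>\<^bsub>A\<^esub> x) = c \<odot>\<^bsub>B\<^esub> h x}"

definition End_algebra :: "(complex, 'm) module \<Rightarrow> (complex, 'm \<Rightarrow> 'm) module" where
  "End_algebra M = \<lparr>
     carrier = {T \<in> carrier M \<rightarrow>\<^sub>E carrier M.
       (\<forall>x\<in>carrier M. \<forall>y\<in>carrier M. T (x \<oplus>\<^bsub>M\<^esub> y) = T x \<oplus>\<^bsub>M\<^esub> T y) \<and>
       (\<forall>c. \<forall>x\<in>carrier M. T (c \<odot>\<^bsub>M\<^esub> x) = c \<odot>\<^bsub>M\<^esub> T x)},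
     mult = compose (carrier M),
     one = (\<lambda>x\<in>carrier M. x),
     zero = (\<lambda>x\<in>carrier M. \<zero>\<^bsub>M\<^esub>),
     add = (\<lambda>S T. \<lambda>x\<in>carrier M. S x \<oplus>\<^bsub>M\<^esub> T x),
     smult = (\<lambda>c T. \<lambda>x\<in>carrier M. c \<odot>\<^bsub>M\<^esub> T x)\<rparr>"

section \<open>The complexified symmetric algebra of a real vector space\<close>

text \<open>
  \<open>S(V)\<^sub>\<complex>\<close> is the free commutative complex algebra on symbols \<open>X\<^sub>v\<close>, \<open>v \<in> V\<close> (polynomials over \<open>\<complex>\<close> with
  variables indexed by \<open>V\<close>), modulo the ideal expressing that \<open>v \<mapsto> X\<^sub>v\<close> is real-linear.
\<close>

definition sym_var :: "'v \<Rightarrow> ('v \<Rightarrow>\<^sub>0 nat) \<Rightarrow>\<^sub>0 complex" where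
  "sym_var v = Poly_Mapping.single (Poly_Mapping.single v 1) 1"

definition sym_const :: "complex \<Rightarrow> ('v \<Rightarrow>\<^sub>0 nat) \<Rightarrow>\<^sub>0 complex" where
  "sym_const c = Poly_Mapping.single 0 c"

inductive_set sym_ideal :: "(('v::real_vector \<Rightarrow>\<^sub>0 nat) \<Rightarrow>\<^sub>0 complex) set" where
  zero: "0 \<in> sym_ideal"
| additive: "sym_var (u + v) - (sym_var u + sym_var v) \<in> sym_ideal"
| homogeneous: "sym_var (r *\<^sub>R v) - sym_const (of_real r) * sym_var v \<in> sym_ideal"
| add: "p \<in> sym_ideal \<Longrightarrow> q \<in> sym_ideal \<Longrightarrow> p + q \<in> sym_ideal"
| mult: "p \<in> sym_ideal \<Longrightarrow> q * p \<in> sym_ideal"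

definition sym_eq ::
  "(('v::real_vector \<Rightarrow>\<^sub>0 nat) \<Rightarrow>\<^sub>0 complex) \<Rightarrow> (('v \<Rightarrow>\<^sub>0 nat) \<Rightarrow>\<^sub>0 complex) \<Rightarrow> bool" where
  "sym_eq p q \<longleftrightarrow> p - q \<in> sym_ideal"

lemma sym_ideal_uminus: "p \<in> sym_ideal \<Longrightarrow> - p \<in> sym_ideal"
  using sym_ideal.mult[of p "- 1"] by simp

lemma equivp_sym_eq: "equivp sym_eq"
proof (rule equivpI)
  show "reflp sym_eq"
    by (rule reflpI) (simp add: sym_eq_def sym_ideal.zero)
  show "symp sym_eq"
    by (rule sympI) (metis minus_diff_eq sym_eq_def sym_ideal_uminus)
  show "transp sym_eq"
    by (rule transpI) (use sym_ideal.add in \<open>fastforce simp: sym_eq_def\<close>)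
qed

lemma lookup_mult_0:
  fixes p q :: "('v \<Rightarrow>\<^sub>0 nat) \<Rightarrow>\<^sub>0 complex"
  shows "Poly_Mapping.lookup (p * q) 0 = Poly_Mapping.lookup p 0 * Poly_Mapping.lookup q 0"
proof -
  have *: "0 = l + m \<longleftrightarrow> l = 0 \<and> m = 0" for l m :: "'v \<Rightarrow>\<^sub>0 nat"
    by (auto simp: poly_mapping_eq_iff fun_eq_iff lookup_add)
  have "Poly_Mapping.lookup (p * q) 0 = Sum_any (\<lambda>l. Poly_Mapping.lookup p l *
      Sum_any (\<lambda>m. (Poly_Mapping.lookup q m when l = 0) when m = 0))"
    by (simp add: lookup_mult * when_when conj_commute)
  also have "\<dots> = Sum_any (\<lambda>l. (Poly_Mapping.lookup p l * Poly_Mapping.lookup q 0) when l = 0)"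
    by (simp add: mult_when)
  finally show ?thesis
    by simp
qed

lemma lookup_0_sym_var: "Poly_Mapping.lookup (sym_var v) 0 = 0"
proof -
  have "Poly_Mapping.single v (1::nat) \<noteq> 0"
    by (metis lookup_single_eq lookup_zero zero_neq_one)
  then show ?thesis
    unfolding sym_var_def by (rule lookup_single_not_eq)
qed

lemma lookup_0_sym_ideal: "p \<in> sym_ideal \<Longrightarrow> Poly_Mapping.lookup p 0 = 0"
proof (induction rule: sym_ideal.induct)
  case (homogeneous r v)
  then show ?case
    by (simp add: lookup_minus lookup_mult_0 lookup_0_sym_var)
next
  case (additive u v)
  then show ?case
    by (simp add: lookup_minus lookup_add lookup_0_sym_var)
qed (simp_all add: lookup_add lookup_mult_0)

quotient_type (overloaded) 'v sym_algebra =
  "('v::real_vector \<Rightarrow>\<^sub>0 nat) \<Rightarrow>\<^sub>0 complex" / sym_eq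
  by (rule equivp_sym_eq)

instantiation sym_algebra :: (real_vector) comm_ring_1
begin

lift_definition zero_sym_algebra :: "'a sym_algebra" is 0 .

lift_definition one_sym_algebra :: "'a sym_algebra" is 1 .

lift_definition plus_sym_algebra :: "'a sym_algebra \<Rightarrow> 'a sym_algebra \<Rightarrow> 'a sym_algebra"
  is "(+)"
proof -
  fix p p' q q' :: "('a \<Rightarrow>\<^sub>0 nat) \<Rightarrow>\<^sub>0 complex"
  assume "sym_eq p p'" "sym_eq q q'"
  then have "(p - p') + (q - q') \<in> sym_ideal"
    unfolding sym_eq_def by (rule sym_ideal.add)
  then show "sym_eq (p + q) (p' + q')"
    by (simp add: sym_eq_def algebra_simps)
qed

lift_definition uminus_sym_algebra :: "'a sym_algebra \<Rightarrow> 'a sym_algebra" is uminus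
proof -
  fix p p' :: "('a \<Rightarrow>\<^sub>0 nat) \<Rightarrow>\<^sub>0 complex"
  assume "sym_eq p p'"
  then have "- (p - p') \<in> sym_ideal"
    unfolding sym_eq_def by (rule sym_ideal_uminus)
  then show "sym_eq (- p) (- p')"
    by (simp add: sym_eq_def algebra_simps)
qed

lift_definition minus_sym_algebra :: "'a sym_algebra \<Rightarrow> 'a sym_algebra \<Rightarrow> 'a sym_algebra"
  is "(-)"
proof -
  fix p p' q q' :: "('a \<Rightarrow>\<^sub>0 nat) \<Rightarrow>\<^sub>0 complex"
  assume "sym_eq p p'" "sym_eq q q'"
  then have "(p - p') + - (q - q') \<in> sym_ideal"
    unfolding sym_eq_def by (intro sym_ideal.add sym_ideal_uminus)
  then show "sym_eq (p - q) (p' - q')"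
    by (simp add: sym_eq_def algebra_simps)
qed

lift_definition times_sym_algebra :: "'a sym_algebra \<Rightarrow> 'a sym_algebra \<Rightarrow> 'a sym_algebra"
  is "(*)"
proof -
  fix p p' q q' :: "('a \<Rightarrow>\<^sub>0 nat) \<Rightarrow>\<^sub>0 complex"
  assume "sym_eq p p'" "sym_eq q q'"
  then have "q * (p - p') + p' * (q - q') \<in> sym_ideal"
    unfolding sym_eq_def by (intro sym_ideal.add sym_ideal.mult)
  then show "sym_eq (p * q) (p' * q')"
    by (simp add: sym_eq_def algebra_simps)
qed

instance
proof
  fix a b c :: "'a sym_algebra"
  show "a * b * c = a * (b * c)"
    by transfer (simp add: sym_eq_def sym_ideal.zero mult.assoc)
  show "a * b = b * a"
    by transfer (simp add: sym_eq_def sym_ideal.zero mult.commute)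
  show "1 * a = a"
    by transfer (simp add: sym_eq_def sym_ideal.zero)
  show "(a + b) * c = a * c + b * c"
    by transfer (simp add: sym_eq_def sym_ideal.zero distrib_right)
  show "a + b + c = a + (b + c)"
    by transfer (simp add: sym_eq_def sym_ideal.zero add.assoc)
  show "a + b = b + a"
    by transfer (simp add: sym_eq_def sym_ideal.zero add.commute)
  show "0 + a = a"
    by transfer (simp add: sym_eq_def sym_ideal.zero)
  show "- a + a = 0"
    by transfer (simp add: sym_eq_def sym_ideal.zero)
  show "a - b = a + - b"
    by transfer (simp add: sym_eq_def sym_ideal.zero)
  show "(0::'a sym_algebra) \<noteq> 1"
  proof (transfer, rule notI)
    assume "sym_eq (0 :: ('a \<Rightarrow>\<^sub>0 nat) \<Rightarrow>\<^sub>0 complex) 1"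
    then have "Poly_Mapping.lookup (0 - 1 :: ('a \<Rightarrow>\<^sub>0 nat) \<Rightarrow>\<^sub>0 complex) 0 = 0"
      unfolding sym_eq_def by (rule lookup_0_sym_ideal)
    then show False
      unfolding lookup_minus by simp
  qed
qed

end

lift_definition sym_scale :: "complex \<Rightarrow> 'v::real_vector sym_algebra \<Rightarrow> 'v sym_algebra"
  is "\<lambda>c p. sym_const c * p"
  by (metis sym_eq_def right_diff_distrib sym_ideal.mult)

lift_definition sym_embed :: "'v::real_vector \<Rightarrow> 'v sym_algebra" is sym_var .

definition Sym :: "(complex, 'v::real_vector sym_algebra) module" where
  "Sym = \<lparr>carrier = UNIV, mult = (*), one = 1, zero = 0, add = (+), smult = sym_scale\<rparr>"

section \<open>Group algebras and tensor products with them\<close>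

definition group_algebra :: "('g, 'm) monoid_scheme \<Rightarrow> (complex, 'g \<Rightarrow>\<^sub>0 complex) module" where
  "group_algebra G = \<lparr>
     carrier = {c. Poly_Mapping.keys c \<subseteq> carrier G},
     mult = (\<lambda>c d. \<Sum>g\<in>Poly_Mapping.keys c. \<Sum>h\<in>Poly_Mapping.keys d.
        Poly_Mapping.single (g \<otimes>\<^bsub>G\<^esub> h) (Poly_Mapping.lookup c g * Poly_Mapping.lookup d h)),
     one = Poly_Mapping.single \<one>\<^bsub>G\<^esub> 1,
     zero = 0,
     add = (+),
     smult = (\<lambda>r c. Poly_Mapping.map ((*) r) c)\<rparr>"

text \<open>
  Since \<open>G\<close> is a basis of \<open>\<complex>[G]\<close>, the tensor product \<open>S(V)\<^sub>\<complex> \<otimes> \<complex>[G]\<close> is realised as the space of finitely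
  supported functions from \<open>G\<close> to \<open>S(V)\<^sub>\<complex>\<close>, with \<open>p \<otimes> c\<close> being \<open>g \<mapsto> c(g) p\<close>. The lemmas
  \<open>tensor_universal_exists\<close> and \<open>tensor_universal_unique\<close> below are its universal property.
\<close>

definition tensor :: "'v::real_vector sym_algebra \<Rightarrow> ('g \<Rightarrow>\<^sub>0 complex) \<Rightarrow> 'g \<Rightarrow>\<^sub>0 'v sym_algebra"
  where "tensor p c = Poly_Mapping.map (\<lambda>z. sym_scale z p) c"

definition tensor_scale ::
  "complex \<Rightarrow> ('g \<Rightarrow>\<^sub>0 'v::real_vector sym_algebra) \<Rightarrow> 'g \<Rightarrow>\<^sub>0 'v sym_algebra" where
  "tensor_scale c h = Poly_Mapping.map (sym_scale c) h"

definition tensor_carrier ::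
  "('g, 'm) monoid_scheme \<Rightarrow> ('g \<Rightarrow>\<^sub>0 'v::real_vector sym_algebra) set" where
  "tensor_carrier G = {h. Poly_Mapping.keys h \<subseteq> carrier G}"

definition on_tensor_space ::
  "('g, 'm) monoid_scheme \<Rightarrow> (complex, 'g \<Rightarrow>\<^sub>0 'v::real_vector sym_algebra) module \<Rightarrow> bool" where
  "on_tensor_space G H \<longleftrightarrow>
     carrier H = tensor_carrier G \<and> zero H = 0 \<and> add H = (+) \<and> smult H = tensor_scale"

lemma sym_const_add: "sym_const (c + d) = sym_const c + sym_const d"
  by (simp add: sym_const_def single_add)

lemma sym_const_mult: "sym_const (c * d) = sym_const c * sym_const d"
  by (simp add: sym_const_def mult_single)

lemma sym_scale_add_left: "sym_scale (c + d) p = sym_scale c p + sym_scale d p"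
  by transfer (simp add: sym_const_add distrib_right sym_eq_def sym_ideal.zero)

lemma sym_scale_add_right: "sym_scale c (p + q) = sym_scale c p + sym_scale c q"
  by transfer (simp add: distrib_left sym_eq_def sym_ideal.zero)

lemma sym_scale_scale: "sym_scale c (sym_scale d p) = sym_scale (c * d) p"
  by transfer (simp add: sym_const_mult mult.assoc sym_eq_def sym_ideal.zero)

lemma sym_scale_one [simp]: "sym_scale 1 p = p"
  by transfer (simp add: sym_const_def sym_eq_def sym_ideal.zero)

lemma sym_scale_zero_left [simp]: "sym_scale 0 p = 0"
  using sym_scale_add_left[of 0 0 p] by simp

lemma sym_scale_zero_right [simp]: "sym_scale c 0 = 0"
  using sym_scale_add_right[of c 0 0] by simp

lemma lookup_tensor: "Poly_Mapping.lookup (tensor p c) g = sym_scale (Poly_Mapping.lookup c g) p"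
  by (simp add: tensor_def Poly_Mapping.map.rep_eq when_def)

lemma lookup_tensor_scale:
  "Poly_Mapping.lookup (tensor_scale c h) g = sym_scale c (Poly_Mapping.lookup h g)"
  by (simp add: tensor_scale_def Poly_Mapping.map.rep_eq when_def)

lemma tensor_decomposition:
  "h = (\<Sum>g\<in>Poly_Mapping.keys h. tensor (Poly_Mapping.lookup h g) (Poly_Mapping.single g 1))"
proof (rule poly_mapping_eqI)
  fix x
  have "Poly_Mapping.lookup (\<Sum>g\<in>Poly_Mapping.keys h.
          tensor (Poly_Mapping.lookup h g) (Poly_Mapping.single g 1)) x
      = (\<Sum>g\<in>Poly_Mapping.keys h. if g = x then Poly_Mapping.lookup h g else 0)"
    unfolding lookup_sum lookup_tensor lookup_single
    by (intro sum.cong) (auto simp: when_def)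
  also have "\<dots> = Poly_Mapping.lookup h x"
    by (simp add: in_keys_iff)
  finally show "Poly_Mapping.lookup h x = Poly_Mapping.lookup (\<Sum>g\<in>Poly_Mapping.keys h.
          tensor (Poly_Mapping.lookup h g) (Poly_Mapping.single g 1)) x" ..
qed

lemma tensor_universal_exists:
  fixes scale :: "complex \<Rightarrow> 'm::ab_group_add \<Rightarrow> 'm"
    and G :: "('g, 'x) monoid_scheme"
    and B :: "'v::real_vector sym_algebra \<Rightarrow> ('g \<Rightarrow>\<^sub>0 complex) \<Rightarrow> 'm"
  assumes add1: "\<And>p q c. c \<in> carrier (group_algebra G) \<Longrightarrow> B (p + q) c = B p c + B q c"
    and add2: "\<And>p c d. c \<in> carrier (group_algebra G) \<Longrightarrow> d \<in> carrier (group_algebra G) \<Longrightarrow>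
       B p (c + d) = B p c + B p d"
    and scale1: "\<And>z p c. c \<in> carrier (group_algebra G) \<Longrightarrow> B (sym_scale z p) c = scale z (B p c)"
    and scale2: "\<And>z p c. c \<in> carrier (group_algebra G) \<Longrightarrow>
       B p (z \<odot>\<^bsub>group_algebra G\<^esub> c) = scale z (B p c)"
    and scale: "vector_space scale"
  shows "\<exists>L. (\<forall>h\<in>tensor_carrier G. \<forall>h'\<in>tensor_carrier G. L (h + h') = L h + L h') \<and>
             (\<forall>z. \<forall>h\<in>tensor_carrier G. L (tensor_scale z h) = scale z (L h)) \<and>
             (\<forall>p. \<forall>c\<in>carrier (group_algebra G). L (tensor p c) = B p c)"
proof -
  interpret vector_space scale
    by (rule scale)
  define L where "L = (\<lambda>h :: 'g \<Rightarrow>\<^sub>0 'v sym_algebra.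
    \<Sum>g\<in>Poly_Mapping.keys h. B (Poly_Mapping.lookup h g) (Poly_Mapping.single g 1))"
  have single_in: "Poly_Mapping.single g z \<in> carrier (group_algebra G)" if "g \<in> carrier G" for g z
    using that by (auto simp: group_algebra_def)
  have B0: "B 0 c = 0" if "c \<in> carrier (group_algebra G)" for c
    using add1[OF that, of 0 0] by simp
  have B0': "B p 0 = 0" for p
    using add2[of 0 0 p] by (simp add: group_algebra_def)
  have L_eq: "L h = (\<Sum>g\<in>K. B (Poly_Mapping.lookup h g) (Poly_Mapping.single g 1))"
    if "Poly_Mapping.keys h \<subseteq> K" "finite K" "K \<subseteq> carrier G" for h K
    unfolding L_def using that
    by (intro sum.mono_neutral_left) (auto simp: in_keys_iff subset_iff intro!: B0 single_in)
  have L_add: "L (h + h') = L h + L h'" if "h \<in> tensor_carrier G" "h' \<in> tensor_carrier G" for h h'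
  proof -
    let ?K = "Poly_Mapping.keys h \<union> Poly_Mapping.keys h'"
    have K: "?K \<subseteq> carrier G" "finite ?K" "Poly_Mapping.keys (h + h') \<subseteq> ?K"
      using that keys_add[of h h'] by (auto simp: tensor_carrier_def)
    have "L (h + h') = (\<Sum>g\<in>?K. B (Poly_Mapping.lookup (h + h') g) (Poly_Mapping.single g 1))"
      using K by (intro L_eq) auto
    also have "\<dots> = (\<Sum>g\<in>?K. B (Poly_Mapping.lookup h g) (Poly_Mapping.single g 1)) +
        (\<Sum>g\<in>?K. B (Poly_Mapping.lookup h' g) (Poly_Mapping.single g 1))"
      using K unfolding lookup_add sum.distrib[symmetric]
      by (intro sum.cong refl add1 single_in) auto
    also have "\<dots> = L h + L h'"
      using K by (simp add: L_eq[of h ?K] L_eq[of h' ?K])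
    finally show ?thesis .
  qed
  have L_scale: "L (tensor_scale z h) = scale z (L h)" if "h \<in> tensor_carrier G" for z h
  proof -
    let ?K = "Poly_Mapping.keys h"
    have K: "?K \<subseteq> carrier G" "finite ?K" "Poly_Mapping.keys (tensor_scale z h) \<subseteq> ?K"
      using that by (auto simp: tensor_carrier_def in_keys_iff lookup_tensor_scale)
    have "L (tensor_scale z h) =
        (\<Sum>g\<in>?K. B (Poly_Mapping.lookup (tensor_scale z h) g) (Poly_Mapping.single g 1))"
      using K by (intro L_eq) auto
    also have "\<dots> = (\<Sum>g\<in>?K. scale z (B (Poly_Mapping.lookup h g) (Poly_Mapping.single g 1)))"
      using K unfolding lookup_tensor_scale by (intro sum.cong refl scale1 single_in) auto
    finally show ?thesis
      by (simp add: L_def scale_sum_right)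
  qed
  have L_tensor: "L (tensor p c) = B p c" if c: "c \<in> carrier (group_algebra G)" for p c
  proof -
    let ?K = "Poly_Mapping.keys c"
    have K: "?K \<subseteq> carrier G" "finite ?K" "Poly_Mapping.keys (tensor p c) \<subseteq> ?K"
      using c by (auto simp: group_algebra_def in_keys_iff lookup_tensor)
    have B_sum: "B p (\<Sum>g\<in>F. Poly_Mapping.single g (f g)) = (\<Sum>g\<in>F. B p (Poly_Mapping.single g (f g)))"
      if "finite F" "F \<subseteq> carrier G" for F f
      using that
    proof (induction F rule: finite_induct)
      case (insert g F)
      have "(\<Sum>g\<in>F. Poly_Mapping.single g (f g)) \<in> carrier (group_algebra G)"
        using insert.prems keys_sum[of "\<lambda>g. Poly_Mapping.single g (f g)" F]
        by (force simp: group_algebra_def split: if_splits)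
      then show ?case
        using insert by (simp add: add2 single_in)
    qed (simp add: B0')
    have single_scale: "Poly_Mapping.single g z = z \<odot>\<^bsub>group_algebra G\<^esub> Poly_Mapping.single g 1" for g z
      by (simp add: group_algebra_def)
    have "L (tensor p c) =
        (\<Sum>g\<in>?K. B (Poly_Mapping.lookup (tensor p c) g) (Poly_Mapping.single g 1))"
      using K by (intro L_eq) auto
    also have "\<dots> = (\<Sum>g\<in>?K. scale (Poly_Mapping.lookup c g) (B p (Poly_Mapping.single g 1)))"
      using K unfolding lookup_tensor by (intro sum.cong refl scale1 single_in) auto
    also have "\<dots> = (\<Sum>g\<in>?K. B p (Poly_Mapping.single g (Poly_Mapping.lookup c g)))"
    proof (intro sum.cong refl)
      fix g
      assume "g \<in> ?K"
      with K have "Poly_Mapping.single g 1 \<in> carrier (group_algebra G)"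
        by (intro single_in) auto
      from scale2[OF this, of p "Poly_Mapping.lookup c g"]
      show "scale (Poly_Mapping.lookup c g) (B p (Poly_Mapping.single g 1)) =
          B p (Poly_Mapping.single g (Poly_Mapping.lookup c g))"
        by (subst single_scale) simp
    qed
    also have "\<dots> = B p (\<Sum>g\<in>?K. Poly_Mapping.single g (Poly_Mapping.lookup c g))"
      using K by (simp add: B_sum)
    also have "(\<Sum>g\<in>?K. Poly_Mapping.single g (Poly_Mapping.lookup c g)) = c"
      by (rule poly_mapping_eqI) (simp add: lookup_sum lookup_single when_def in_keys_iff)
    finally show ?thesis .
  qed
  show ?thesis
    using L_add L_scale L_tensor by blast
qed

lemma tensor_universal_unique:
  fixes L L' :: "('g \<Rightarrow>\<^sub>0 'v::real_vector sym_algebra) \<Rightarrow> 'm::ab_group_add"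
  assumes "\<And>h h'. h \<in> tensor_carrier G \<Longrightarrow> h' \<in> tensor_carrier G \<Longrightarrow> L (h + h') = L h + L h'"
    and "\<And>h h'. h \<in> tensor_carrier G \<Longrightarrow> h' \<in> tensor_carrier G \<Longrightarrow> L' (h + h') = L' h + L' h'"
    and eq: "\<And>p c. c \<in> carrier (group_algebra G) \<Longrightarrow> L (tensor p c) = L' (tensor p c)"
    and h: "h \<in> tensor_carrier G"
  shows "L h = L' h"
proof -
  define t where "t = (\<lambda>g. tensor (Poly_Mapping.lookup h g) (Poly_Mapping.single g 1))"
  have t_in: "t g \<in> tensor_carrier G" if "g \<in> carrier G" for g
    using that
    by (auto simp: t_def tensor_carrier_def in_keys_iff lookup_tensor lookup_single when_def
        split: if_splits)
  have t_eq: "L (t g) = L' (t g)" if "g \<in> carrier G" for g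
    unfolding t_def using that by (intro eq) (auto simp: group_algebra_def)
  have zero_in: "(0 :: 'g \<Rightarrow>\<^sub>0 'v sym_algebra) \<in> tensor_carrier G"
    by (simp add: tensor_carrier_def)
  have "sum t F \<in> tensor_carrier G \<and> L (sum t F) = L' (sum t F)"
    if "finite F" "F \<subseteq> carrier G" for F
    using that
  proof (induction F rule: finite_induct)
    case empty
    then show ?case
      using assms(1)[of 0 0] assms(2)[of 0 0] zero_in by simp
  next
    case (insert g F)
    have "t g + sum t F \<in> tensor_carrier G"
      using insert t_in[of g] keys_add[of "t g" "sum t F"] by (auto simp: tensor_carrier_def)
    then show ?case
      using insert assms(1,2)[of "t g" "sum t F"] t_in[of g] t_eq[of g] by simp
  qed
  moreover have "h = sum t (Poly_Mapping.keys h)"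
    unfolding t_def by (rule tensor_decomposition)
  ultimately show ?thesis
    using h by (metis finite_keys mem_Collect_eq tensor_carrier_def)
qed

section \<open>The degenerate affine Hecke algebra\<close>

text \<open>
  The identification of \<open>H\<close> with \<open>S(V)\<^sub>\<complex> \<otimes> \<complex>[W]\<close> is understood, as usual, to be given by
  multiplication in \<open>H\<close>: \<open>(p \<otimes> e)(1 \<otimes> c) = p \<otimes> c\<close>. Without this the remaining conditions say nothing
  about general products, and \<open>H\<close> is not unique. Extensionality of the multiplication is a
  convention fixing its values outside the carrier.
\<close>

definition Hecke_algebra ::
  "('v::euclidean_space \<Rightarrow>\<^sub>L real) set \<Rightarrow> ('v \<Rightarrow>\<^sub>L real) set \<Rightarrow> ('v \<Rightarrow>\<^sub>L real) \<Rightarrow>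
   ('v affine_functional \<Rightarrow> real) \<Rightarrow> (complex, ('v \<Rightarrow> 'v) \<Rightarrow>\<^sub>0 'v sym_algebra) module \<Rightarrow> bool" where
  "Hecke_algebra \<Sigma>0 I0 \<phi> k H \<longleftrightarrow>
     (let W = affine_Weyl_group \<Sigma>0;
          of_sym = (\<lambda>p. tensor p \<one>\<^bsub>group_algebra W\<^esub>);
          of_grp = (\<lambda>c. tensor 1 c);
          refl = (\<lambda>a. of_grp (Poly_Mapping.single (aff_reflection a) 1));
          vec = (\<lambda>v. of_sym (sym_embed v))
      in complex_algebra H \<and>
         case_prod (mult H) \<in> extensional (carrier H \<times> carrier H) \<and>
         on_tensor_space W H \<and>
         of_sym \<in> algebra_hom Sym H \<and> inj_on of_sym (carrier Sym) \<and>
         of_grp \<in> algebra_hom (group_algebra W) H \<and> inj_on of_grp (carrier (group_algebra W)) \<and>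
         (\<forall>p. \<forall>c\<in>carrier (group_algebra W). of_sym p \<otimes>\<^bsub>H\<^esub> of_grp c = tensor p c) \<and>
         (\<forall>a\<in>affine_basis I0 \<phi>. \<forall>v.
            refl a \<otimes>\<^bsub>H\<^esub> vec v \<ominus>\<^bsub>H\<^esub> vec (lin_reflection (fst a) v) \<otimes>\<^bsub>H\<^esub> refl a =
            complex_of_real (k a * blinfun_apply (fst a) v) \<odot>\<^bsub>H\<^esub> \<one>\<^bsub>H\<^esub>))"

section \<open>Dunkl-type operators on smooth functions\<close>

primrec continuously_differentiable_on ::
  "nat \<Rightarrow> 'v::real_normed_vector set \<Rightarrow> ('v \<Rightarrow> 'b::real_normed_vector) \<Rightarrow> bool" where
  "continuously_differentiable_on 0 S f \<longleftrightarrow> continuous_on S f"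
| "continuously_differentiable_on (Suc n) S f \<longleftrightarrow>
     (\<forall>x\<in>S. f differentiable at x) \<and>
     (\<forall>v. continuously_differentiable_on n S (\<lambda>x. frechet_derivative f (at x) v))"

text \<open>
  \<open>C\<^sup>\<infinity>(S)\<close> for open \<open>S\<close>. A function on \<open>S\<close> is represented by its extension by \<open>0\<close>, so that equality of
  elements is equality on \<open>S\<close>.
\<close>

definition smooth_functions :: "'v::real_normed_vector set \<Rightarrow> (complex, 'v \<Rightarrow> complex) module" where
  "smooth_functions S = \<lparr>
     carrier = {f. (\<forall>n. continuously_differentiable_on n S f) \<and> (\<forall>x. x \<notin> S \<longrightarrow> f x = 0)},
     mult = (\<lambda>f g x. f x * g x),
     one = (\<lambda>x. if x \<in> S then 1 else 0),
     zero = (\<lambda>x. 0),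
     add = (\<lambda>f g x. f x + g x),
     smult = (\<lambda>c f x. c * f x)\<rparr>"

definition neg_indicator :: "'v::euclidean_space affine_functional \<Rightarrow> 'v \<Rightarrow> complex" where
  "neg_indicator a x = (if aff_apply a x < 0 then 1 else 0)"

definition Dunkl_operator ::
  "('v::euclidean_space \<Rightarrow>\<^sub>L real) set \<Rightarrow> ('v \<Rightarrow>\<^sub>L real) set \<Rightarrow> ('v \<Rightarrow>\<^sub>L real) \<Rightarrow>
   ('v affine_functional \<Rightarrow> real) \<Rightarrow> 'v \<Rightarrow> ('v \<Rightarrow> complex) \<Rightarrow> 'v \<Rightarrow> complex" where
  "Dunkl_operator \<Sigma>0 I0 \<phi> k v =
     (\<lambda>f\<in>carrier (smooth_functions (regular_set \<Sigma>0 I0 \<phi>)). \<lambda>x.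
        if x \<in> regular_set \<Sigma>0 I0 \<phi> then
          frechet_derivative f (at x) v +
          (\<Sum>a\<in>{a \<in> positive_affine_roots \<Sigma>0 I0 \<phi>. neg_indicator a x \<noteq> 0}.
             complex_of_real (k a * blinfun_apply (fst a) v) *
             neg_indicator a x * fun_action (aff_reflection a) f x)
        else 0)"

definition Dunkl_hom ::
  "('v::euclidean_space \<Rightarrow>\<^sub>L real) set \<Rightarrow> ('v \<Rightarrow>\<^sub>L real) set \<Rightarrow> ('v \<Rightarrow>\<^sub>L real) \<Rightarrow>
   ('v affine_functional \<Rightarrow> real) \<Rightarrow> 'v sym_algebra \<Rightarrow> ('v \<Rightarrow> complex) \<Rightarrow> 'v \<Rightarrow> complex" where
  "Dunkl_hom \<Sigma>0 I0 \<phi> k =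
     (THE \<Phi>. \<Phi> \<in> algebra_hom Sym (End_algebra (smooth_functions (regular_set \<Sigma>0 I0 \<phi>))) \<and>
             (\<forall>v. \<Phi> (sym_embed v) = Dunkl_operator \<Sigma>0 I0 \<phi> k v))"

definition Dunkl_representation ::
  "('v::euclidean_space \<Rightarrow>\<^sub>L real) set \<Rightarrow> ('v \<Rightarrow>\<^sub>L real) set \<Rightarrow> ('v \<Rightarrow>\<^sub>L real) \<Rightarrow>
   ('v affine_functional \<Rightarrow> real) \<Rightarrow> (complex, ('v \<Rightarrow> 'v) \<Rightarrow>\<^sub>0 'v sym_algebra) module \<Rightarrow>
   ((('v \<Rightarrow> 'v) \<Rightarrow>\<^sub>0 'v sym_algebra) \<Rightarrow> ('v \<Rightarrow> complex) \<Rightarrow> 'v \<Rightarrow> complex) \<Rightarrow> bool" where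
  "Dunkl_representation \<Sigma>0 I0 \<phi> k H \<pi> \<longleftrightarrow>
     (let W = affine_Weyl_group \<Sigma>0;
          C = smooth_functions (regular_set \<Sigma>0 I0 \<phi>)
      in \<pi> \<in> algebra_hom H (End_algebra C) \<and> \<pi> \<in> extensional (carrier H) \<and>
         (\<forall>p. \<pi> (tensor p \<one>\<^bsub>group_algebra W\<^esub>) = Dunkl_hom \<Sigma>0 I0 \<phi> k p) \<and>
         (\<forall>w\<in>carrier W. \<pi> (tensor 1 (Poly_Mapping.single w 1)) = restrict (fun_action w) (carrier C)))"

end

theory Submission
  imports Defs
begin

text \<open>
  On the fundamental alcove every \<open>\<chi>\<^sub>a\<close> with \<open>a\<close> positive vanishes, so there the Dunkl operators are plain
  directional derivatives. A simple reflection permutes the other positive roots; reindexing the sum gives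
  the cross relations between simple reflections and Dunkl operators. The commutator of two Dunkl operators
  is therefore intertwined with itself by the Weyl group, and since it vanishes on the alcove, whose
  translates cover the regular set, it vanishes everywhere.

  The operators \<open>\<Sum>\<^sub>w p\<^sub>w(\<D>) w\<close> determine their coefficients: tested on a function supported in one alcove,
  which the Weyl group moves freely, the sum collapses to \<open>p\<^sub>w(\<partial>)\<close>, and exponentials separate
  polynomials. By the cross relations these operators are closed under composition, so the product of \<open>H\<close>
  can be transported from the endomorphism algebra. Conversely the cross relations determine every product,
  which forces any other algebra with the stated properties to act in the same way, hence to be equal to \<open>H\<close>.
\<close>

section \<open>Symmetric algebras\<close>

text \<open>Two devices keep the argument free of explicit normal-ordering formulas. Closure under
  composition is proved only as an existence statement (\<open>realized\<close>): the cross relation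
  moves a simple reflection past one vector at the cost of a term with fewer factors. Faithfulness
  then makes the representing tensor unique, so it can serve as the product, and the ring axioms,
  associativity included, become identities between composed operators.

  Commutativity of the Dunkl operators is not checked term by term. The intertwining works because
  the error terms that the cross relation adds to \<open>Dunkl u (Dunkl v f)\<close> are together
  symmetric in \<open>u\<close> and \<open>v\<close>, so they cancel in the commutator.

  Cross relations are available for simple reflections, whereas the group is generated by all
  reflections. Hence the argument on heights, by which each reflection is a word in simple ones, and
  the exchange argument, by which no nontrivial element keeps a point of the alcove inside the
  alcove.\<close>

lemma poly_mapping_add_induct [case_names zero single add]:
  fixes p :: "'a \<Rightarrow>\<^sub>0 'b::comm_monoid_add"
  assumes "P 0" and "\<And>m c. P (Poly_Mapping.single m c)" and "\<And>p q. P p \<Longrightarrow> P q \<Longrightarrow> P (p + q)"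
  shows "P p"
proof -
  have "P (\<Sum>m\<in>F. Poly_Mapping.single m (Poly_Mapping.lookup p m))" if "finite F" for F
    using that by induction (auto intro: assms)
  moreover have "(\<Sum>m\<in>Poly_Mapping.keys p. Poly_Mapping.single m (Poly_Mapping.lookup p m)) = p"
    by (rule poly_mapping_eqI) (simp add: lookup_sum lookup_single when_def in_keys_iff)
  ultimately show ?thesis
    by (metis finite_keys)
qed

text \<open>Monomials are turned into multisets because \<open>fold_mset\<close> applies commuting
  operators in an order that never has to be named.\<close>

definition exponent_mset :: "('v \<Rightarrow>\<^sub>0 nat) \<Rightarrow> 'v multiset" where
  "exponent_mset m = Abs_multiset (Poly_Mapping.lookup m)"

lemma count_exponent_mset [simp]: "count (exponent_mset m) = Poly_Mapping.lookup m"
proof -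
  have "{x. 0 < Poly_Mapping.lookup m x} = Poly_Mapping.keys m"
    by (auto simp: in_keys_iff)
  then show ?thesis
    unfolding exponent_mset_def by (simp add: count_Abs_multiset)
qed

lemma exponent_mset_0 [simp]: "exponent_mset 0 = {#}"
  and exponent_mset_add [simp]: "exponent_mset (m + n) = exponent_mset m + exponent_mset n"
  and exponent_mset_single [simp]: "exponent_mset (Poly_Mapping.single v 1) = {#v#}"
  by (auto intro!: multiset_eqI simp: lookup_add lookup_single when_def)

lemma exponent_induct [case_names zero add_single]:
  assumes "P 0" and "\<And>v m. P m \<Longrightarrow> P (Poly_Mapping.single v 1 + m)"
  shows "P (m :: 'v \<Rightarrow>\<^sub>0 nat)"
proof (induction "exponent_mset m" arbitrary: m)
  case empty
  then have "m = 0"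
    by (intro poly_mapping_eqI) (metis count_empty count_exponent_mset lookup_zero)
  then show ?case
    using assms(1) by simp
next
  case (add v M)
  have v: "Poly_Mapping.lookup m v = Suc (count M v)"
    using arg_cong[OF add(2), of "\<lambda>M. count M v"] by simp
  have "m = Poly_Mapping.single v 1 + (m - Poly_Mapping.single v 1)"
    using v by (intro poly_mapping_eqI) (auto simp: lookup_add lookup_minus lookup_single when_def)
  moreover have "M = exponent_mset (m - Poly_Mapping.single v 1)"
    using arg_cong[OF add(2), of count]
    by (intro multiset_eqI) (auto simp: lookup_minus lookup_single when_def fun_eq_iff split: if_splits)
  ultimately show ?case
    using add(1) assms(2) by metis
qed

lemma single_exponent_Suc:
  "Poly_Mapping.single (Poly_Mapping.single v 1 + m) 1 = sym_var v * Poly_Mapping.single m 1"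
  by (simp add: sym_var_def mult_single)

lemma single_eq_sym_const_mult: "Poly_Mapping.single m c = sym_const c * Poly_Mapping.single m 1"
  by (simp add: sym_const_def mult_single)

lemma sym_scale_mult_left: "sym_scale c p * q = sym_scale c (p * q)"
  by transfer (simp add: sym_eq_def sym_ideal.zero mult.assoc)

lemma sym_scale_mult_right: "p * sym_scale c q = sym_scale c (p * q)"
  by (metis mult.commute sym_scale_mult_left)

lemma sym_embed_add: "sym_embed (u + v) = sym_embed u + sym_embed v"
  by transfer (simp add: sym_eq_def sym_ideal.additive)

lemma sym_embed_scaleR: "sym_embed (r *\<^sub>R v) = sym_scale (of_real r) (sym_embed v)"
  by transfer (simp add: sym_eq_def sym_ideal.homogeneous)

lemma sym_scale_eq_0_iff: "sym_scale c p = 0 \<longleftrightarrow> c = 0 \<or> p = 0"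
proof
  assume "sym_scale c p = 0"
  then have "sym_scale (inverse c) (sym_scale c p) = 0"
    by simp
  then show "c = 0 \<or> p = 0"
    by (cases "c = 0") (auto simp: sym_scale_scale)
qed auto

lemma sym_algebra_cases:
  obtains P where "p = abs_sym_algebra P"
  by (metis Quotient_sym_algebra Quotient_abs_rep)

lemma abs_sym_algebra_eqs:
  "abs_sym_algebra (P + Q) = abs_sym_algebra P + abs_sym_algebra Q"
  "abs_sym_algebra (P * Q) = abs_sym_algebra P * abs_sym_algebra Q"
  "abs_sym_algebra (sym_const c) = sym_scale c 1"
  "abs_sym_algebra (sym_var v) = sym_embed v"
  "abs_sym_algebra 0 = 0"
  "abs_sym_algebra 1 = 1"
  by (simp_all add: plus_sym_algebra.abs_eq times_sym_algebra.abs_eq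
      sym_embed.abs_eq zero_sym_algebra_def one_sym_algebra_def sym_scale.abs_eq)

text \<open>Peeling off one vector on the left matches the cross relations, which speak about single
  vectors. The zero element is reached by scaling with 0.\<close>

lemma sym_algebra_induct [case_names one add scale embed]:
  fixes p :: "'v::real_vector sym_algebra"
  assumes one: "P 1" and add: "\<And>p q. P p \<Longrightarrow> P q \<Longrightarrow> P (p + q)"
    and scale: "\<And>c p. P p \<Longrightarrow> P (sym_scale c p)"
    and embed: "\<And>v p. P p \<Longrightarrow> P (sym_embed v * p)"
  shows "P p"
proof -
  obtain Q where Q: "p = abs_sym_algebra Q"
    by (rule sym_algebra_cases)
  have "P (abs_sym_algebra Q)"
  proof (induction Q rule: poly_mapping_add_induct)
    case zero
    then show ?case
      using scale[OF one, of 0] by (simp add: abs_sym_algebra_eqs)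
  next
    case (single m c)
    have "P (abs_sym_algebra (Poly_Mapping.single m 1))"
    proof (induction m rule: exponent_induct)
      case zero
      then show ?case
        using one by (simp add: abs_sym_algebra_eqs)
    next
      case (add_single v m)
      then show ?case
        unfolding single_exponent_Suc abs_sym_algebra_eqs by (rule embed)
    qed
    then show ?case
      unfolding single_eq_sym_const_mult[of m c] by (simp add: abs_sym_algebra_eqs sym_scale_mult_left scale)
  next
    case (add p q)
    then show ?case
      unfolding abs_sym_algebra_eqs by (rule assms(2))
  qed
  then show ?thesis
    by (simp add: Q)
qed

lemma sym_embed_eq_sum_Basis:
  fixes v :: "'v::euclidean_space"
  shows "sym_embed v = (\<Sum>b\<in>Basis. sym_scale (of_real (v \<bullet> b)) (sym_embed b))"
proof -
  have *: "sym_embed (\<Sum>b\<in>A. (v \<bullet> b) *\<^sub>R b) = (\<Sum>b\<in>A. sym_scale (of_real (v \<bullet> b)) (sym_embed b))"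
    if "finite A" for A
    using that
  proof induction
    case empty
    then show ?case
      using sym_embed_add[of "0::'v" 0] by simp
  qed (simp add: sym_embed_add sym_embed_scaleR)
  show ?thesis
    using *[of Basis] by (simp add: euclidean_representation)
qed

text \<open>A general representative has one variable for each vector of the space, and these
  variables are linearly dependent in the quotient. Expanding every vector in the standard basis
  leaves independent variables, so that coefficients can be recovered from values.\<close>

lemma sym_algebra_basis_representation:
  fixes p :: "'v::euclidean_space sym_algebra"
  shows "\<exists>Q. p = abs_sym_algebra Q \<and> (\<forall>m\<in>Poly_Mapping.keys Q. Poly_Mapping.keys m \<subseteq> Basis)"
    (is "\<exists>Q. _ \<and> ?R Q")
proof (induction p rule: sym_algebra_induct)
  case one
  have "?R 1"
    by (auto simp flip: single_one split: if_splits)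
  then show ?case
    using abs_sym_algebra_eqs(6) by metis
next
  case (add p q)
  then obtain P Q where "p = abs_sym_algebra P" "?R P" "q = abs_sym_algebra Q" "?R Q"
    by blast
  then show ?case
    using keys_add[of P Q] by (intro exI[of _ "P + Q"]) (auto simp: abs_sym_algebra_eqs)
next
  case (scale c p)
  then obtain P where P: "p = abs_sym_algebra P" "?R P"
    by blast
  have "?R (sym_const c * P)"
    using keys_mult[of "sym_const c" P] P(2) by (auto simp: sym_const_def split: if_splits dest!: subsetD)
  with P show ?case
    by (intro exI[of _ "sym_const c * P"]) (simp add: abs_sym_algebra_eqs sym_scale_mult_left)
next
  case (embed v p)
  then obtain P where P: "p = abs_sym_algebra P" "?R P"
    by blast
  have R_var: "?R (sym_const c * (sym_var b * P))" if "b \<in> Basis" for b c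
  proof
    fix m
    assume "m \<in> Poly_Mapping.keys (sym_const c * (sym_var b * P))"
    moreover have "sym_const c * (sym_var b * P) = Poly_Mapping.single (Poly_Mapping.single b 1) c * P"
      by (simp add: sym_const_def sym_var_def mult_single flip: mult.assoc)
    ultimately obtain n where n: "m = Poly_Mapping.single b 1 + n" "n \<in> Poly_Mapping.keys P"
      using keys_mult[of "Poly_Mapping.single (Poly_Mapping.single b 1) c" P]
      by (auto split: if_splits)
    with P that show "Poly_Mapping.keys m \<subseteq> Basis"
      using keys_add[of "Poly_Mapping.single b (1::nat)" n] by auto
  qed
  have "\<exists>Q. (\<Sum>b\<in>A. sym_scale (of_real (v \<bullet> b)) (sym_embed b)) * p = abs_sym_algebra Q \<and> ?R Q"
    if "finite A" "A \<subseteq> Basis" for A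
    using that
  proof induction
    case empty
    then show ?case
      by (intro exI[of _ 0]) (simp add: abs_sym_algebra_eqs)
  next
    case (insert b A)
    then obtain Q where "(\<Sum>b\<in>A. sym_scale (of_real (v \<bullet> b)) (sym_embed b)) * p = abs_sym_algebra Q" "?R Q"
      by blast
    with insert P R_var[of b "of_real (v \<bullet> b)"] show ?case
      using keys_add[of "sym_const (of_real (v \<bullet> b)) * (sym_var b * P)" Q]
      by (intro exI[of _ "sym_const (of_real (v \<bullet> b)) * (sym_var b * P) + Q"])
        (auto simp: abs_sym_algebra_eqs distrib_right sym_scale_mult_left)
  qed
  from this[of Basis] show ?case
    by (simp flip: sym_embed_eq_sum_Basis)
qed

text \<open>Induction on the number of variables: grouped by the exponent of \<open>b\<close>, the
  sum is a polynomial in the single number \<open>t b\<close>, whose coefficients vanish by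
  \<open>polyfun_eq_0\<close>. Inside a group the exponent of \<open>b\<close> is constant, so the
  other exponents still separate the monomials.\<close>

lemma polynomial_coeffs_eq_0:
  fixes c :: "('v \<Rightarrow>\<^sub>0 nat) \<Rightarrow> complex"
  assumes "finite B" "finite K"
    and "inj_on (\<lambda>m. restrict (Poly_Mapping.lookup m) B) K"
    and "\<And>t :: 'v \<Rightarrow> complex. (\<Sum>m\<in>K. c m * (\<Prod>b\<in>B. t b ^ Poly_Mapping.lookup m b)) = 0"
    and "m \<in> K"
  shows "c m = 0"
  using assms
proof (induction B arbitrary: K m rule: finite_induct)
  case empty
  \<comment> \<open>Without variables all restrictions coincide, so injectivity leaves one
    monomial.\<close>
  then have "K = {m}"
    by (auto simp: inj_on_def)
  with empty(3)[of "\<lambda>_. 0"] show ?case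
    by simp
next
  case (insert b B)
  let ?K = "\<lambda>j. {m \<in> K. Poly_Mapping.lookup m b = j}"
  let ?h = "\<lambda>t m. c m * (\<Prod>b\<in>B. t b ^ Poly_Mapping.lookup m b)"
  have inj: "inj_on (\<lambda>m. restrict (Poly_Mapping.lookup m) B) (?K j)" for j
  proof (rule inj_onI)
    fix m n
    assume *: "m \<in> ?K j" "n \<in> ?K j"
      "restrict (Poly_Mapping.lookup m) B = restrict (Poly_Mapping.lookup n) B"
    then have "restrict (Poly_Mapping.lookup m) (insert b B) = restrict (Poly_Mapping.lookup n) (insert b B)"
      unfolding restrict_def fun_eq_iff by (metis (mono_tags, lifting) insert_iff mem_Collect_eq)
    with * inj_onD[OF insert.prems(2)] show "m = n"
      by (metis (no_types, lifting) mem_Collect_eq)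
  qed
  have "(\<Sum>m\<in>?K j. ?h t m) = 0" for j and t :: "'v \<Rightarrow> complex"
  proof -
    \<comment> \<open>A common bound for the exponents of \<open>b\<close>; inserting
      \<open>j\<close> makes \<open>j\<close> an admissible index even if no monomial has that
      exponent.\<close>
    define N where "N = Max (insert j ((\<lambda>m. Poly_Mapping.lookup m b) ` K))"
    have N: "Poly_Mapping.lookup m b \<le> N" if "m \<in> K" for m
      unfolding N_def using that insert.prems(1) by (intro Max_ge) auto
    have "j \<le> N"
      unfolding N_def using insert.prems(1) by (intro Max_ge) auto
    have "(\<Sum>i\<le>N. (\<Sum>m\<in>?K i. ?h t m) * s ^ i) = 0" for s
    proof -
      have "(\<Sum>i\<le>N. (\<Sum>m\<in>?K i. ?h t m) * s ^ i) =
          (\<Sum>i\<le>N. \<Sum>m\<in>?K i. ?h t m * s ^ Poly_Mapping.lookup m b)"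
        by (simp add: sum_distrib_right)
      also have "\<dots> = (\<Sum>m\<in>K. ?h t m * s ^ Poly_Mapping.lookup m b)"
        using insert.prems(1) N by (intro sum.group) auto
      also have "\<dots> = (\<Sum>m\<in>K. c m * (\<Prod>a\<in>insert b B. (t(b := s)) a ^ Poly_Mapping.lookup m a))"
      proof (intro sum.cong refl)
        fix m
        have "(\<Prod>a\<in>B. (t(b := s)) a ^ Poly_Mapping.lookup m a) = (\<Prod>a\<in>B. t a ^ Poly_Mapping.lookup m a)"
          using insert.hyps by (intro prod.cong) auto
        then show "?h t m * s ^ Poly_Mapping.lookup m b =
            c m * (\<Prod>a\<in>insert b B. (t(b := s)) a ^ Poly_Mapping.lookup m a)"
          using insert.hyps by simp
      qed
      also have "\<dots> = 0"
        by (rule insert.prems(3))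
      finally show ?thesis .
    qed
    then show ?thesis
      using polyfun_eq_0[of "\<lambda>i. \<Sum>m\<in>?K i. ?h t m" N] \<open>j \<le> N\<close> by blast
  qed
  then show ?case
    by (intro insert.IH[OF _ inj]) (use insert.prems in auto)
qed

section \<open>Evaluating symmetric algebra elements at commuting operators\<close>

text \<open>Linearity in the vector is what makes the relations of \<open>sym_ideal\<close> act by
  zero. All laws are required on \<open>C\<close> alone, a subset of a full function type.\<close>

locale commuting_operators =
  fixes C :: "('x \<Rightarrow> complex) set"
    and D :: "'v::real_vector \<Rightarrow> ('x \<Rightarrow> complex) \<Rightarrow> 'x \<Rightarrow> complex"
  assumes zero_in: "(\<lambda>x. 0) \<in> C"
    and add_in: "f \<in> C \<Longrightarrow> g \<in> C \<Longrightarrow> (\<lambda>x. f x + g x) \<in> C"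
    and scale_in: "f \<in> C \<Longrightarrow> (\<lambda>x. c * f x) \<in> C"
    and D_in: "f \<in> C \<Longrightarrow> D v f \<in> C"
    and D_add: "f \<in> C \<Longrightarrow> g \<in> C \<Longrightarrow> D v (\<lambda>x. f x + g x) = (\<lambda>x. D v f x + D v g x)"
    and D_scale: "f \<in> C \<Longrightarrow> D v (\<lambda>x. c * f x) = (\<lambda>x. c * D v f x)"
    and D_add_vec: "f \<in> C \<Longrightarrow> D (u + v) f = (\<lambda>x. D u f x + D v f x)"
    and D_scaleR_vec: "f \<in> C \<Longrightarrow> D (r *\<^sub>R v) f = (\<lambda>x. of_real r * D v f x)"
    and D_commute: "f \<in> C \<Longrightarrow> D u (D v f) = D v (D u f)"
begin

lemma sum_in: "(\<And>i. i \<in> I \<Longrightarrow> f i \<in> C) \<Longrightarrow> (\<lambda>x. \<Sum>i\<in>I. f i x) \<in> C"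
  by (induction I rule: infinite_finite_induct) (simp_all add: zero_in add_in)

text \<open>The operators are made total so that they commute on the whole type.\<close>

definition total_op :: "'v \<Rightarrow> ('x \<Rightarrow> complex) \<Rightarrow> 'x \<Rightarrow> complex" where
  "total_op v f = (if f \<in> C then D v f else f)"

sublocale total_op: comp_fun_commute total_op
  by unfold_locales (auto simp: total_op_def fun_eq_iff D_in D_commute)

definition monomial_op :: "('v \<Rightarrow>\<^sub>0 nat) \<Rightarrow> ('x \<Rightarrow> complex) \<Rightarrow> 'x \<Rightarrow> complex" where
  "monomial_op m f = fold_mset total_op f (exponent_mset m)"

lemma monomial_op_0 [simp]: "monomial_op 0 f = f"
  by (simp add: monomial_op_def)

lemma monomial_op_add: "monomial_op (m + n) f = monomial_op m (monomial_op n f)"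
  by (metis monomial_op_def exponent_mset_add total_op.fold_mset_union add.commute)

lemma monomial_op_single: "f \<in> C \<Longrightarrow> monomial_op (Poly_Mapping.single v 1) f = D v f"
  by (simp add: monomial_op_def total_op_def del: One_nat_def)

lemma monomial_op_in: "f \<in> C \<Longrightarrow> monomial_op m f \<in> C"
  by (induction m rule: exponent_induct) (simp_all add: monomial_op_add monomial_op_single D_in del: One_nat_def)

lemma monomial_op_linear:
  assumes "f \<in> C" "g \<in> C"
  shows "monomial_op m (\<lambda>x. f x + g x) = (\<lambda>x. monomial_op m f x + monomial_op m g x)"
    and "monomial_op m (\<lambda>x. c * f x) = (\<lambda>x. c * monomial_op m f x)"
  using assms
  by (induction m rule: exponent_induct)
    (simp_all add: monomial_op_add monomial_op_single monomial_op_in add_in scale_in D_add D_scale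
      del: One_nat_def)

definition poly_op :: "(('v \<Rightarrow>\<^sub>0 nat) \<Rightarrow>\<^sub>0 complex) \<Rightarrow> ('x \<Rightarrow> complex) \<Rightarrow> 'x \<Rightarrow> complex" where
  "poly_op P f = (\<lambda>x. \<Sum>m\<in>Poly_Mapping.keys P. Poly_Mapping.lookup P m * monomial_op m f x)"

lemma poly_op_superset:
  "finite K \<Longrightarrow> Poly_Mapping.keys P \<subseteq> K \<Longrightarrow>
    poly_op P f = (\<lambda>x. \<Sum>m\<in>K. Poly_Mapping.lookup P m * monomial_op m f x)"
  unfolding poly_op_def by (intro ext sum.mono_neutral_left) (auto simp: in_keys_iff)

lemma poly_op_add: "poly_op (P + Q) f = (\<lambda>x. poly_op P f x + poly_op Q f x)"
proof -
  let ?K = "Poly_Mapping.keys P \<union> Poly_Mapping.keys Q"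
  have "poly_op R f = (\<lambda>x. \<Sum>m\<in>?K. Poly_Mapping.lookup R m * monomial_op m f x)"
    if "R \<in> {P, Q, P + Q}" for R
    using that keys_add[of P Q] by (intro poly_op_superset) auto
  then show ?thesis
    by (simp add: lookup_add distrib_right sum.distrib)
qed

lemma poly_op_0 [simp]: "poly_op 0 f = (\<lambda>x. 0)"
  by (simp add: poly_op_def)

lemma poly_op_single: "poly_op (Poly_Mapping.single m c) f = (\<lambda>x. c * monomial_op m f x)"
  by (simp add: poly_op_def)

lemma poly_op_1: "poly_op 1 f = f"
  unfolding single_one[symmetric] poly_op_single by simp

lemma poly_op_in: "f \<in> C \<Longrightarrow> poly_op P f \<in> C"
  unfolding poly_op_def by (intro sum_in scale_in monomial_op_in)

lemma poly_op_linear: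
  assumes "f \<in> C" "g \<in> C"
  shows "poly_op P (\<lambda>x. f x + g x) = (\<lambda>x. poly_op P f x + poly_op P g x)"
    and "poly_op P (\<lambda>x. c * f x) = (\<lambda>x. c * poly_op P f x)"
  using assms
  by (simp_all add: poly_op_def monomial_op_linear distrib_left sum.distrib sum_distrib_left mult.left_commute)

lemma poly_op_mult:
  assumes f: "f \<in> C"
  shows "poly_op (P * Q) f = poly_op P (poly_op Q f)"
proof (induction P rule: poly_mapping_add_induct)
  case (single m c)
  show ?case
  proof (induction Q rule: poly_mapping_add_induct)
    case zero
    then show ?case
      using poly_op_linear(2)[OF zero_in zero_in, of "Poly_Mapping.single m c" 0] by simp
  next
    case (single n d)
    then show ?case
      using f by (simp add: mult_single poly_op_single monomial_op_add monomial_op_in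
          monomial_op_linear(2)[OF monomial_op_in monomial_op_in] mult.assoc)
  next
    case (add p q)
    then show ?case
      using f by (simp add: poly_op_add distrib_left poly_op_linear poly_op_in)
  qed
qed (simp_all add: distrib_right poly_op_add)

lemma poly_op_sym_var: "f \<in> C \<Longrightarrow> poly_op (sym_var v) f = D v f"
  by (simp add: sym_var_def poly_op_single monomial_op_single del: One_nat_def)

lemma poly_op_sym_const: "poly_op (sym_const c) f = (\<lambda>x. c * f x)"
  by (simp add: sym_const_def poly_op_single)

lemma poly_op_minus: "poly_op (P - Q) f = (\<lambda>x. poly_op P f x - poly_op Q f x)"
  using poly_op_add[of "P - Q" Q f] by simp

text \<open>Linearity in the vector kills the generators, and multiplicativity of the evaluation
  kills their multiples.\<close>

lemma poly_op_sym_ideal: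
  assumes "P \<in> sym_ideal" "f \<in> C"
  shows "poly_op P f = (\<lambda>x. 0)"
  using assms
proof (induction arbitrary: f)
  case (mult p q)
  then show ?case
    using poly_op_linear(2)[OF zero_in zero_in, of q 0] by (simp add: poly_op_mult)
qed (simp_all add: poly_op_add poly_op_minus poly_op_sym_var poly_op_mult poly_op_sym_const D_add_vec D_scaleR_vec D_in)

text \<open>A representative is chosen because evaluation does not respect \<open>sym_eq\<close>
  outside \<open>C\<close>, where \<open>total_op\<close> is the identity. On \<open>C\<close> the
  choice is irrelevant by \<open>sym_op_abs\<close>.\<close>

definition sym_op :: "'v sym_algebra \<Rightarrow> ('x \<Rightarrow> complex) \<Rightarrow> 'x \<Rightarrow> complex" where
  "sym_op p = poly_op (rep_sym_algebra p)"

lemma sym_op_abs: "f \<in> C \<Longrightarrow> sym_op (abs_sym_algebra P) f = poly_op P f"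
proof -
  assume f: "f \<in> C"
  have "sym_eq (rep_sym_algebra (abs_sym_algebra P)) P"
    by (metis Quotient_rep_abs Quotient_sym_algebra equivp_reflp equivp_sym_eq)
  then show ?thesis
    using poly_op_sym_ideal[OF _ f, of "rep_sym_algebra (abs_sym_algebra P) - P"]
    by (simp add: sym_eq_def sym_op_def poly_op_minus fun_eq_iff)
qed

context
  fixes f assumes f: "f \<in> C"
begin

lemma sym_op_in: "sym_op p f \<in> C"
  unfolding sym_op_def using f by (rule poly_op_in)

lemma sym_op_0 [simp]: "sym_op 0 f = (\<lambda>x. 0)"
  using sym_op_abs[OF f, of 0] by (simp add: abs_sym_algebra_eqs)

lemma sym_op_1 [simp]: "sym_op 1 f = f"
  using sym_op_abs[OF f, of 1] by (simp add: abs_sym_algebra_eqs poly_op_1)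

lemma sym_op_embed: "sym_op (sym_embed v) f = D v f"
  using sym_op_abs[OF f, of "sym_var v"] f by (simp add: abs_sym_algebra_eqs poly_op_sym_var)

lemma sym_op_add: "sym_op (p + q) f = (\<lambda>x. sym_op p f x + sym_op q f x)"
  by (rule sym_algebra_cases[of p], rule sym_algebra_cases[of q])
    (simp add: sym_op_abs f poly_op_add flip: abs_sym_algebra_eqs)

lemma sym_op_mult: "sym_op (p * q) f = sym_op p (sym_op q f)"
  by (rule sym_algebra_cases[of p], rule sym_algebra_cases[of q])
    (simp add: sym_op_abs f poly_op_in poly_op_mult flip: abs_sym_algebra_eqs)

end

lemma sym_op_linear:
  assumes "f \<in> C" "g \<in> C"
  shows "sym_op p (\<lambda>x. f x + g x) = (\<lambda>x. sym_op p f x + sym_op p g x)"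
    and "sym_op p (\<lambda>x. c * f x) = (\<lambda>x. c * sym_op p f x)"
  unfolding sym_op_def using assms by (rule poly_op_linear)+

lemma sym_op_scale:
  assumes f: "f \<in> C"
  shows "sym_op (sym_scale c p) f = (\<lambda>x. c * sym_op p f x)"
proof -
  have "sym_op (sym_scale c 1) f = (\<lambda>x. c * f x)"
    using sym_op_abs[OF f, of "sym_const c"] by (simp add: abs_sym_algebra_eqs poly_op_sym_const)
  moreover have "sym_scale c p = p * sym_scale c 1"
    by (simp add: sym_scale_mult_right)
  ultimately show ?thesis
    using f by (simp add: sym_op_mult sym_op_linear(2)[OF f f])
qed

end

section \<open>Reflections\<close>

lemma dual_inner_commute: "dual_inner \<xi> \<eta> = dual_inner \<eta> \<xi>"
  by (simp add: dual_inner_def mult.commute)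

lemma dual_inner_linear:
  "dual_inner (\<xi> + \<zeta>) \<eta> = dual_inner \<xi> \<eta> + dual_inner \<zeta> \<eta>"
  "dual_inner \<eta> (\<xi> + \<zeta>) = dual_inner \<eta> \<xi> + dual_inner \<eta> \<zeta>"
  "dual_inner (\<xi> - \<zeta>) \<eta> = dual_inner \<xi> \<eta> - dual_inner \<zeta> \<eta>"
  "dual_inner \<eta> (\<xi> - \<zeta>) = dual_inner \<eta> \<xi> - dual_inner \<eta> \<zeta>"
  "dual_inner (r *\<^sub>R \<xi>) \<eta> = r * dual_inner \<xi> \<eta>"
  "dual_inner \<eta> (r *\<^sub>R \<xi>) = r * dual_inner \<eta> \<xi>"
  by (simp_all add: dual_inner_def blinfun.add_left blinfun.diff_left blinfun.scaleR_left algebra_simps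
      sum.distrib sum_subtractf sum_distrib_left)

lemma dual_inner_self_pos: "\<alpha> \<noteq> 0 \<Longrightarrow> dual_inner \<alpha> \<alpha> > 0"
  by (simp flip: norm_eq_dual_inner)

lemma coroot_self [simp]: "\<alpha> \<noteq> 0 \<Longrightarrow> blinfun_apply \<alpha> (coroot \<alpha>) = 2"
  by (simp add: coroot_apply norm_eq_dual_inner[symmetric])

lemma blinfun_separates:
  fixes u v :: "'v::euclidean_space"
  assumes "\<And>\<xi> :: 'v \<Rightarrow>\<^sub>L real. blinfun_apply \<xi> u = blinfun_apply \<xi> v"
  shows "u = v"
proof (rule euclidean_eqI)
  fix b :: 'v
  show "u \<bullet> b = v \<bullet> b"
    using assms[of "blinfun_inner_left b"] by (simp add: inner_commute)
qed

lemma coroot_uminus [simp]: "coroot (- \<alpha>) = - coroot \<alpha>"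
  by (rule blinfun_separates) (simp add: coroot_apply blinfun.minus_right dual_inner_def sum_negf
      blinfun.minus_left)

lemma lin_reflection_involution: "\<alpha> \<noteq> 0 \<Longrightarrow> lin_reflection \<alpha> (lin_reflection \<alpha> x) = x"
  by (simp add: lin_reflection_def blinfun.diff_right blinfun.scaleR_right algebra_simps)

lemma lin_reflection_linear:
  "lin_reflection \<alpha> (x + y) = lin_reflection \<alpha> x + lin_reflection \<alpha> y"
  "lin_reflection \<alpha> (r *\<^sub>R x) = r *\<^sub>R lin_reflection \<alpha> x"
  by (simp_all add: lin_reflection_def blinfun.add_right blinfun.scaleR_right algebra_simps)

text \<open>The reflection in \<open>\<alpha>\<close> is an isometry, so the reflected root has the
  norm of \<open>\<beta>\<close> and the two coroots share their denominator.\<close>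

lemma coroot_reflection:
  assumes "\<alpha> \<noteq> 0" "\<beta> \<noteq> 0"
  shows "coroot (\<beta> - blinfun_apply \<beta> (coroot \<alpha>) *\<^sub>R \<alpha>) = lin_reflection \<alpha> (coroot \<beta>)"
proof (rule blinfun_separates)
  fix \<xi> :: "'a \<Rightarrow>\<^sub>L real"
  define n where "n = blinfun_apply \<beta> (coroot \<alpha>)"
  have n: "n = 2 * dual_inner \<beta> \<alpha> / dual_inner \<alpha> \<alpha>"
    by (simp add: n_def coroot_apply norm_eq_dual_inner)
  have "dual_inner \<alpha> \<alpha> > 0" "dual_inner \<beta> \<beta> > 0"
    using assms dual_inner_self_pos by blast+
  moreover from this have "dual_inner (\<beta> - n *\<^sub>R \<alpha>) (\<beta> - n *\<^sub>R \<alpha>) = dual_inner \<beta> \<beta>"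
    by (simp add: dual_inner_linear n dual_inner_commute[of \<alpha> \<beta>] field_simps power2_eq_square)
  ultimately show "blinfun_apply \<xi> (coroot (\<beta> - n *\<^sub>R \<alpha>)) = blinfun_apply \<xi> (lin_reflection \<alpha> (coroot \<beta>))"
    by (simp add: coroot_apply lin_reflection_def norm_eq_dual_inner dual_inner_linear n
        blinfun.diff_right blinfun.scaleR_right dual_inner_commute[of \<alpha> \<beta>] field_simps)
qed

lemma aff_apply_add: "aff_apply (a + b) x = aff_apply a x + aff_apply b x"
  and aff_apply_diff: "aff_apply (a - b) x = aff_apply a x - aff_apply b x"
  and aff_apply_uminus: "aff_apply (- a) x = - aff_apply a x"
  and aff_apply_scaleR: "aff_apply (r *\<^sub>R a) x = r * aff_apply a x"
  and aff_apply_0 [simp]: "aff_apply 0 x = 0"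
  by (simp_all add: aff_apply_def blinfun.add_left blinfun.diff_left blinfun.minus_left
      blinfun.scaleR_left algebra_simps)

lemma aff_apply_reflection_self: "fst a \<noteq> 0 \<Longrightarrow> aff_apply a (aff_reflection a x) = - aff_apply a x"
  unfolding aff_reflection_def by (simp add: aff_apply_def[of a "x - _"] blinfun.diff_right blinfun.scaleR_right)
    (simp add: aff_apply_def)

lemma aff_reflection_involution [simp]:
  "fst a \<noteq> 0 \<Longrightarrow> aff_reflection a (aff_reflection a x) = x"
  using aff_apply_reflection_self[of a x]
  by (simp add: aff_reflection_def[of a "aff_reflection a x"]) (simp add: aff_reflection_def)

lemma aff_reflection_uminus: "aff_reflection (- a) = aff_reflection a"
  by (simp add: aff_reflection_def fun_eq_iff aff_apply_uminus)

lemma aff_reflection_diff: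
  "aff_reflection a x - aff_reflection a y = lin_reflection (fst a) (x - y)"
  by (simp add: aff_reflection_def aff_apply_def lin_reflection_def blinfun.diff_right algebra_simps)

text \<open>The reflection acting on functionals. Written as subtraction of a multiple of
  \<open>a\<close>, it shows directly how coefficients in the basis and heights change;
  \<open>aff_apply_root_reflection\<close> identifies it with composition by
  \<open>aff_reflection a\<close>.\<close>

definition root_reflection ::
  "'v::euclidean_space affine_functional \<Rightarrow> 'v affine_functional \<Rightarrow> 'v affine_functional" where
  "root_reflection a b = b - blinfun_apply (fst b) (coroot (fst a)) *\<^sub>R a"

lemma aff_apply_root_reflection: "aff_apply (root_reflection a b) x = aff_apply b (aff_reflection a x)"
  by (simp add: root_reflection_def aff_reflection_def aff_apply_diff aff_apply_scaleR)
    (simp add: aff_apply_def blinfun.diff_right blinfun.scaleR_right)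

lemma fst_root_reflection_apply:
  "blinfun_apply (fst (root_reflection a b)) v = blinfun_apply (fst b) (lin_reflection (fst a) v)"
  by (simp add: root_reflection_def lin_reflection_def blinfun.diff_left blinfun.scaleR_left
      blinfun.diff_right blinfun.scaleR_right)

lemma root_reflection_involution:
  "fst a \<noteq> 0 \<Longrightarrow> root_reflection a (root_reflection a b) = b"
  by (simp add: root_reflection_def blinfun.diff_left blinfun.scaleR_left algebra_simps)

lemma root_reflection_self: "fst a \<noteq> 0 \<Longrightarrow> root_reflection a a = - a"
  by (simp add: root_reflection_def algebra_simps) (simp add: scaleR_2)

text \<open>Differences of points transform by the linear part of \<open>aff_reflection a\<close>,
  which carries the coroot of \<open>b\<close> to that of the reflected root.\<close>

lemma aff_reflection_root_reflection:
  assumes "fst a \<noteq> 0" "fst b \<noteq> 0"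
  shows "aff_reflection (root_reflection a b) = aff_reflection a \<circ> aff_reflection b \<circ> aff_reflection a"
proof
  fix x
  let ?y = "aff_reflection a x"
  have "aff_reflection a (aff_reflection b ?y) - aff_reflection a ?y =
      lin_reflection (fst a) (- aff_apply b ?y *\<^sub>R coroot (fst b))"
    by (simp add: aff_reflection_diff) (simp add: aff_reflection_def)
  then have "aff_reflection a (aff_reflection b ?y) = x - aff_apply b ?y *\<^sub>R lin_reflection (fst a) (coroot (fst b))"
    using assms by (simp add: lin_reflection_linear algebra_simps del: scaleR_minus_left)
      (simp add: lin_reflection_def blinfun.minus_right blinfun.scaleR_right algebra_simps)
  moreover have "coroot (fst (root_reflection a b)) = lin_reflection (fst a) (coroot (fst b))"
    unfolding root_reflection_def using coroot_reflection[OF assms] by simp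
  ultimately show "aff_reflection (root_reflection a b) x =
      (aff_reflection a \<circ> aff_reflection b \<circ> aff_reflection a) x"
    by (simp add: aff_reflection_def[of "root_reflection a b"] aff_apply_root_reflection)
qed

lemma bij_aff_reflection: "fst a \<noteq> 0 \<Longrightarrow> bij (aff_reflection a)"
  by (rule o_bij[of "aff_reflection a"]) (auto simp: fun_eq_iff)

lemma inv_aff_reflection [simp]: "fst a \<noteq> 0 \<Longrightarrow> inv_into UNIV (aff_reflection a) = aff_reflection a"
  by (rule inv_unique_comp) (auto simp: fun_eq_iff)

section \<open>Nonnegative integer combinations\<close>

lemma nonneg_comb_induct [consumes 1, case_names zero add]:
  assumes "x \<in> nonneg_comb B" and "P 0" and "\<And>x b. P x \<Longrightarrow> b \<in> B \<Longrightarrow> P (x + b)"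
  shows "P x"
proof -
  obtain c :: "'a \<Rightarrow> nat" where x: "x = (\<Sum>b\<in>B. of_nat (c b) *\<^sub>R b)"
    using assms(1) by (auto simp: nonneg_comb_def)
  have step: "P (y + of_nat n *\<^sub>R b)" if "P y" "b \<in> B" for y b n
  proof (induction n)
    case (Suc n)
    then show ?case
      using assms(3)[OF Suc.IH that(2)] by (simp add: algebra_simps)
  qed (simp add: that)
  have "P (\<Sum>b\<in>F. of_nat (c b) *\<^sub>R b)" if "finite F" "F \<subseteq> B" for F
    using that
  proof induction
    case (insert b F)
    then show ?case
      using step[of "\<Sum>b\<in>F. of_nat (c b) *\<^sub>R b" b "c b"] by (simp add: add.commute)
  qed (simp add: assms)
  \<comment> \<open>For infinite \<open>B\<close> the defining sum is 0 by convention, which the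
    zero case covers.\<close>
  then show ?thesis
    using assms(2) x by (cases "finite B") auto
qed

lemma nonneg_comb_0: "0 \<in> nonneg_comb B"
  unfolding nonneg_comb_def by (auto intro: exI[of _ "\<lambda>_. 0"])

lemma nonneg_comb_add: "x \<in> nonneg_comb B \<Longrightarrow> y \<in> nonneg_comb B \<Longrightarrow> x + y \<in> nonneg_comb B"
proof -
  assume "x \<in> nonneg_comb B" "y \<in> nonneg_comb B"
  then obtain c d :: "'a \<Rightarrow> nat"
    where "x = (\<Sum>b\<in>B. of_nat (c b) *\<^sub>R b)" "y = (\<Sum>b\<in>B. of_nat (d b) *\<^sub>R b)"
    by (auto simp: nonneg_comb_def)
  then have "x + y = (\<Sum>b\<in>B. of_nat (c b + d b) *\<^sub>R b)"
    by (simp add: scaleR_left_distrib sum.distrib)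
  then show ?thesis
    unfolding nonneg_comb_def mem_Collect_eq by (rule exI[of _ "\<lambda>b. c b + d b"])
qed

lemma nonneg_comb_base: "finite B \<Longrightarrow> b \<in> B \<Longrightarrow> b \<in> nonneg_comb B"
  unfolding nonneg_comb_def
  by (rule CollectI, rule exI[of _ "\<lambda>x. of_bool (x = b)"])
    (simp add: if_distrib[of "\<lambda>r. r *\<^sub>R _"] of_bool_def if_distrib[of "of_nat"] cong: if_cong)

lemma nonneg_comb_multiple: "x \<in> nonneg_comb B \<Longrightarrow> of_nat n *\<^sub>R x \<in> nonneg_comb B"
  by (induction n) (auto simp: nonneg_comb_0 algebra_simps intro: nonneg_comb_add)

section \<open>The affine root system\<close>

locale affine_setting =
  fixes \<Sigma>0 I0 :: "('v::euclidean_space \<Rightarrow>\<^sub>L real) set"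
    and \<phi> :: "'v \<Rightarrow>\<^sub>L real"
    and k :: "'v affine_functional \<Rightarrow> real"
  assumes root_system: "root_system \<Sigma>0"
    and crystallographic: "crystallographic \<Sigma>0"
    and reduced: "reduced_roots \<Sigma>0"
    and basis: "root_basis \<Sigma>0 I0"
    and highest: "highest_root \<Sigma>0 I0 \<phi>"
    and multiplicity: "multiplicity_function \<Sigma>0 k"
begin

abbreviation "Roots \<equiv> affine_roots \<Sigma>0"
abbreviation "Pos \<equiv> positive_affine_roots \<Sigma>0 I0 \<phi>"
abbreviation "Simple \<equiv> affine_basis I0 \<phi>"
abbreviation "Weyl \<equiv> affine_Weyl_group \<Sigma>0"
abbreviation "Reg \<equiv> regular_set \<Sigma>0 I0 \<phi>"

lemma finite_roots: "finite \<Sigma>0"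
  and nonzero_root: "\<alpha> \<in> \<Sigma>0 \<Longrightarrow> \<alpha> \<noteq> 0"
  using root_system by (auto simp: root_system_def)

lemma reflect_root: "\<alpha> \<in> \<Sigma>0 \<Longrightarrow> \<beta> \<in> \<Sigma>0 \<Longrightarrow> \<beta> - blinfun_apply \<beta> (coroot \<alpha>) *\<^sub>R \<alpha> \<in> \<Sigma>0"
  using root_system by (auto simp: root_system_def coroot_apply)

lemma pairing_int: "\<alpha> \<in> \<Sigma>0 \<Longrightarrow> \<beta> \<in> \<Sigma>0 \<Longrightarrow> blinfun_apply \<beta> (coroot \<alpha>) \<in> \<int>"
  using crystallographic by (auto simp: crystallographic_def coroot_apply)

lemma uminus_root: "\<alpha> \<in> \<Sigma>0 \<Longrightarrow> - \<alpha> \<in> \<Sigma>0"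
  using reflect_root[of \<alpha> \<alpha>] nonzero_root[of \<alpha>] by (simp add: scaleR_2)

lemma finite_basis: "finite I0"
  and basis_root: "\<alpha> \<in> I0 \<Longrightarrow> \<alpha> \<in> \<Sigma>0"
  and independent_basis: "independent I0"
  using basis finite_roots finite_subset by (auto simp: root_basis_def)

lemma finite_Simple: "finite Simple"
  using finite_basis by (simp add: affine_basis_def)

lemma root_in: "a \<in> Roots \<Longrightarrow> fst a \<in> \<Sigma>0"
  by (auto simp: affine_roots_def)

lemma fst_nonzero [simp]: "a \<in> Roots \<Longrightarrow> fst a \<noteq> 0"
  using root_in nonzero_root by blast

lemma root_pair: "\<alpha> \<in> \<Sigma>0 \<Longrightarrow> (\<alpha>, of_int m) \<in> Roots"
  by (auto simp: affine_roots_def)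

lemma root_cases:
  assumes "a \<in> Roots"
  obtains \<alpha> m where "a = (\<alpha>, of_int m)" "\<alpha> \<in> \<Sigma>0"
  using assms by (auto simp: affine_roots_def)

lemma uminus_affine_root: "a \<in> Roots \<Longrightarrow> - a \<in> Roots"
  by (elim root_cases) (metis of_int_minus root_pair uminus_Pair uminus_root)

lemma root_reflection_in: "a \<in> Roots \<Longrightarrow> b \<in> Roots \<Longrightarrow> root_reflection a b \<in> Roots"
proof (elim root_cases)
  fix \<alpha> \<beta> m n
  assume *: "a = (\<alpha>, of_int m)" "b = (\<beta>, of_int n)" "\<alpha> \<in> \<Sigma>0" "\<beta> \<in> \<Sigma>0"
  then obtain l where "blinfun_apply \<beta> (coroot \<alpha>) = of_int l"
    using pairing_int by (metis Ints_cases)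
  with * have "root_reflection a b = (\<beta> - blinfun_apply \<beta> (coroot \<alpha>) *\<^sub>R \<alpha>, of_int (n - l * m))"
    by (simp add: root_reflection_def)
  with * show ?thesis
    using reflect_root root_pair by metis
qed

text \<open>Independence provides a linear form on the dual space with value 1 on all simple roots;
  in finite dimension it is evaluation at a point. The value of a root at this point is its
  height.\<close>

lemma exists_dual_point: "\<exists>x. \<forall>\<alpha>\<in>I0. blinfun_apply \<alpha> x = 1"
proof -
  obtain g :: "('v \<Rightarrow>\<^sub>L real) \<Rightarrow> real" where g: "linear g" "\<forall>\<alpha>\<in>I0. g \<alpha> = 1"
    using linear_independent_extend[OF independent_basis, of "\<lambda>_. 1"] by blast
  have "g \<alpha> = blinfun_apply \<alpha> (\<Sum>b\<in>Basis. g (blinfun_inner_left b) *\<^sub>R b)" for \<alpha>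
  proof -
    have "\<alpha> = (\<Sum>b\<in>Basis. blinfun_apply \<alpha> b *\<^sub>R blinfun_inner_left b)"
    proof (rule blinfun_eqI)
      fix x
      show "blinfun_apply \<alpha> x = blinfun_apply (\<Sum>b\<in>Basis. blinfun_apply \<alpha> b *\<^sub>R blinfun_inner_left b) x"
        unfolding blinfun_eq_inner_sum[of \<alpha> x]
        by (simp add: inner_sum_left blinfun.sum_left blinfun.scaleR_left inner_commute[of x])
    qed
    then have "g \<alpha> = g (\<Sum>b\<in>Basis. blinfun_apply \<alpha> b *\<^sub>R blinfun_inner_left b)"
      by (rule arg_cong)
    also have "\<dots> = (\<Sum>b\<in>Basis. blinfun_apply \<alpha> b * g (blinfun_inner_left b))"
      by (simp add: linear_sum[OF g(1)] linear_scale[OF g(1)])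
    finally show ?thesis
      by (simp add: blinfun.sum_right blinfun.scaleR_right mult.commute)
  qed
  with g(2) show ?thesis
    by metis
qed

lemma highest_in: "\<phi> \<in> \<Sigma>0"
  and highest_add: "\<alpha> \<in> \<Sigma>0 \<Longrightarrow> \<phi> + \<alpha> \<in> nonneg_comb I0"
proof -
  show "\<phi> \<in> \<Sigma>0"
    using highest by (simp add: highest_root_def)
  show "\<phi> + \<alpha> \<in> nonneg_comb I0" if "\<alpha> \<in> \<Sigma>0"
    using highest uminus_root[OF that] by (force simp: highest_root_def)
qed

lemma dual_point_height:
  assumes x: "\<forall>\<alpha>\<in>I0. blinfun_apply \<alpha> x = 1" and "\<xi> \<in> nonneg_comb I0"
  shows "\<xi> = 0 \<or> blinfun_apply \<xi> x > 0"
  using assms(2)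
  by (induction rule: nonneg_comb_induct) (use x in \<open>auto simp: blinfun.add_left\<close>)

text \<open>Otherwise \<open>- \<phi>\<close> has positive height. But \<open>\<phi>\<close>
  dominates every root, in particular \<open>- \<phi>\<close>, so \<open>\<phi> + \<phi>\<close> has
  positive height as well.\<close>

lemma highest_nonneg: "\<phi> \<in> nonneg_comb I0"
proof (rule ccontr)
  assume "\<phi> \<notin> nonneg_comb I0"
  then have neg: "- \<phi> \<in> nonneg_comb I0"
    using basis highest_in by (auto simp: root_basis_def)
  obtain x where "\<forall>\<alpha>\<in>I0. blinfun_apply \<alpha> x = 1"
    using exists_dual_point by blast
  moreover have "\<phi> + \<phi> \<noteq> 0"
    using nonzero_root[OF highest_in] by (simp flip: scaleR_2)
  ultimately show False
    using dual_point_height[OF _ neg] dual_point_height[OF _ highest_add[OF highest_in]] nonzero_root[OF highest_in]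
    by (fastforce simp: blinfun.add_left blinfun.minus_left)
qed

section \<open>Positive and negative affine roots\<close>

lemma Simple_cases:
  assumes "a \<in> Simple"
  obtains "a = (- \<phi>, 1)" | \<alpha> where "\<alpha> \<in> I0" "a = (\<alpha>, 0)"
  using assms by (auto simp: affine_basis_def)

lemma nonneg_comb_embed: "\<xi> \<in> nonneg_comb I0 \<Longrightarrow> (\<xi>, 0) \<in> nonneg_comb Simple"
proof (induction rule: nonneg_comb_induct)
  case zero
  then show ?case
    using nonneg_comb_0[of Simple] by (simp add: zero_prod_def)
next
  case (add x b)
  then have "(b, 0) \<in> Simple"
    by (simp add: affine_basis_def)
  then have "(x, 0) + (b, 0) \<in> nonneg_comb Simple"
    by (intro nonneg_comb_add nonneg_comb_base finite_Simple add.IH)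
  then show ?case
    by simp
qed

lemma Simple_subset_Pos: "a \<in> Simple \<Longrightarrow> a \<in> Pos"
  using root_pair[OF uminus_root[OF highest_in], of 1] root_pair[of _ 0] basis_root
    nonneg_comb_base[OF finite_Simple, of a]
  by (auto simp: positive_affine_roots_def elim: Simple_cases)

lemma Pos_subset_Roots: "a \<in> Pos \<Longrightarrow> a \<in> Roots"
  by (simp add: positive_affine_roots_def)

lemma Simple_in_Roots: "a \<in> Simple \<Longrightarrow> a \<in> Roots"
  using Simple_subset_Pos Pos_subset_Roots by blast

text \<open>The constant term decides. A root with constant \<open>m > 0\<close> is \<open>m\<close>
  times the affine simple root plus \<open>m - 1\<close> times \<open>\<phi>\<close> plus
  \<open>\<phi> + \<alpha>\<close>, and the last two are nonnegative combinations of
  \<open>I0\<close>. For \<open>m < 0\<close> the negative is treated, and for \<open>m = 0\<close>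
  the finite root system answers.\<close>

lemma Pos_or_neg:
  assumes "a \<in> Roots"
  shows "a \<in> Pos \<or> - a \<in> Pos"
proof -
  have *: "(\<alpha>, of_nat m) \<in> nonneg_comb Simple" if "\<alpha> \<in> \<Sigma>0" and m: "m > 0" for \<alpha> m
  proof -
    obtain n where n: "m = Suc n"
      using m gr0_implies_Suc by blast
    have "(\<alpha>, real m) = of_nat m *\<^sub>R (- \<phi>, 1) + (of_nat n *\<^sub>R (\<phi>, 0) + (\<phi> + \<alpha>, 0))"
      by (simp add: n algebra_simps)
    also have "\<dots> \<in> nonneg_comb Simple"
      using that
      by (intro nonneg_comb_add nonneg_comb_multiple nonneg_comb_embed highest_nonneg highest_add
          nonneg_comb_base finite_Simple) (auto simp: affine_basis_def)
    finally show ?thesis .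
  qed
  obtain \<alpha> m where a: "a = (\<alpha>, of_int m)" "\<alpha> \<in> \<Sigma>0"
    using assms by (rule root_cases)
  consider "m > 0" | "m < 0" | "m = 0"
    by linarith
  then have "a \<in> nonneg_comb Simple \<or> - a \<in> nonneg_comb Simple"
  proof cases
    case 1
    then show ?thesis
      using *[OF a(2), of "nat m"] a by simp
  next
    case 2
    then show ?thesis
      using *[OF uminus_root[OF a(2)], of "nat (- m)"] a by simp
  next
    case 3
    then show ?thesis
      using basis a nonneg_comb_embed[of \<alpha>] nonneg_comb_embed[of "- \<alpha>"] by (auto simp: root_basis_def)
  qed
  then show ?thesis
    using assms uminus_affine_root by (auto simp: positive_affine_roots_def)
qed

lemma exists_base_point: "\<exists>x. \<exists>t>0. \<forall>a\<in>Simple. aff_apply a x = t"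
proof -
  obtain x where x: "\<forall>\<alpha>\<in>I0. blinfun_apply \<alpha> x = 1"
    using exists_dual_point by blast
  \<comment> \<open>\<open>t\<close> solves \<open>1 - t * \<phi> x = t\<close>: after scaling by
    \<open>t\<close> the affine simple root takes the same value as the other simple roots.\<close>
  define t where "t = 1 / (1 + blinfun_apply \<phi> x)"
  have "1 + blinfun_apply \<phi> x > 0"
    using dual_point_height[OF x highest_nonneg] by auto
  then have "t > 0" "1 - t * blinfun_apply \<phi> x = t"
    by (auto simp: t_def field_simps)
  then show ?thesis
    using x
    by (intro exI[of _ "t *\<^sub>R x"] exI[of _ t])
      (auto simp: aff_apply_def blinfun.scaleR_right blinfun.minus_left elim!: Simple_cases)
qed

definition base_point :: 'v where
  "base_point = (SOME x. \<exists>t>0. \<forall>a\<in>Simple. aff_apply a x = t)"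

text \<open>All simple roots take the value \<open>t\<close> at the base point, so a positive root
  takes \<open>t\<close> times the sum of its coefficients. This number is the height used for the
  induction in \<open>reflection_is_word\<close>.\<close>

lemma height_ex: "\<exists>t>0. \<forall>a\<in>Pos. \<exists>n::nat. n > 0 \<and> aff_apply a base_point = t * real n"
proof -
  obtain t where t: "t > 0" "\<forall>a\<in>Simple. aff_apply a base_point = t"
    using someI_ex[OF exists_base_point] unfolding base_point_def by blast
  have "a = 0 \<or> (\<exists>n::nat. n > 0 \<and> aff_apply a base_point = t * real n)" if "a \<in> nonneg_comb Simple" for a
    using that
  proof (induction rule: nonneg_comb_induct)
    case (add x b)
    then consider "x = 0" | n where "n > 0" "aff_apply x base_point = t * real n"
      by blast
    then show ?case
    proof cases
      case 1
      with add t show ?thesis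
        by (intro disjI2 exI[of _ 1]) simp
    next
      case (2 n)
      with add t show ?thesis
        by (intro disjI2 exI[of _ "Suc n"]) (simp add: aff_apply_add algebra_simps)
    qed
  qed simp
  moreover have "a \<noteq> 0" if "a \<in> Pos" for a
    using that fst_nonzero Pos_subset_Roots by fastforce
  ultimately show ?thesis
    using t(1) unfolding positive_affine_roots_def by blast
qed

lemma Pos_not_neg: "a \<in> Pos \<Longrightarrow> - a \<notin> Pos"
  using height_ex by (metis aff_apply_uminus mult_pos_pos neg_0_less_iff_less not_less_iff_gr_or_eq of_nat_0_less_iff)

lemma independent_Simple: "independent Simple"
proof -
  have "linear (\<lambda>\<alpha>::'v \<Rightarrow>\<^sub>L real. (\<alpha>, 0::real))"
    by (rule linearI) auto
  then have "independent ((\<lambda>\<alpha>. (\<alpha>, 0::real)) ` I0)"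
    by (rule linear_independent_injective_image[OF _ independent_basis]) (auto simp: inj_on_def)
  moreover have "(- \<phi>, 1::real) \<notin> span ((\<lambda>\<alpha>. (\<alpha>, 0)) ` I0)"
  proof
    assume "(- \<phi>, 1::real) \<in> span ((\<lambda>\<alpha>. (\<alpha>, 0)) ` I0)"
    moreover have "snd x = 0" if "x \<in> span ((\<lambda>\<alpha>. (\<alpha>, 0::real)) ` I0)" for x
      using that by (induction rule: span_induct_alt) auto
    ultimately show False
      by fastforce
  qed
  ultimately show ?thesis
    unfolding affine_basis_def by (rule independent_insertI[rotated])
qed

text \<open>If the reflected root were negative, \<open>b\<close> and its negated reflection would
  be two nonnegative combinations whose sum is a multiple of \<open>a\<close>. Independence then
  leaves \<open>b\<close> only its coefficient at \<open>a\<close>, and reducedness forces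
  \<open>b = a\<close>.\<close>

lemma root_reflection_simple_Pos:
  assumes a: "a \<in> Simple" and b: "b \<in> Pos" and ne: "b \<noteq> a"
  shows "root_reflection a b \<in> Pos"
proof (rule ccontr)
  assume "root_reflection a b \<notin> Pos"
  then have neg: "- root_reflection a b \<in> Pos"
    using Pos_or_neg root_reflection_in Simple_in_Roots Pos_subset_Roots a b by blast
  define r where "r = blinfun_apply (fst b) (coroot (fst a))"
  obtain c where c: "b = (\<Sum>x\<in>Simple. of_nat (c x) *\<^sub>R x)"
    using b by (auto simp: positive_affine_roots_def nonneg_comb_def)
  obtain d where d: "- root_reflection a b = (\<Sum>x\<in>Simple. of_nat (d x) *\<^sub>R x)"
    using neg by (auto simp: positive_affine_roots_def nonneg_comb_def)
  have "(\<Sum>x\<in>Simple. (of_nat (c x) + of_nat (d x) - (if x = a then r else 0)) *\<^sub>R x) =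
      b + - root_reflection a b - (\<Sum>x\<in>Simple. (if x = a then r else 0) *\<^sub>R x)"
    unfolding d unfolding c by (simp only: scaleR_left_distrib scaleR_left_diff_distrib sum.distrib sum_subtractf)
  also have "(\<Sum>x\<in>Simple. (if x = a then r else 0) *\<^sub>R x) = r *\<^sub>R a"
    using a finite_Simple by (simp add: if_distrib[of "\<lambda>r. r *\<^sub>R _"] cong: if_cong)
  also have "b + - root_reflection a b - r *\<^sub>R a = 0"
    by (simp add: root_reflection_def r_def)
  finally have 0: "of_nat (c x) + of_nat (d x) - (if x = a then r else 0) = 0" if "x \<in> Simple" for x
    using independentD[OF independent_Simple finite_Simple order_refl, of
        "\<lambda>x. of_nat (c x) + of_nat (d x) - (if x = a then r else 0)" x] that by blast
  have "c x = 0" if "x \<in> Simple" "x \<noteq> a" for x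
  proof -
    have "real (c x) + real (d x) = 0"
      using 0[OF that(1)] that(2) by simp
    then show ?thesis
      by linarith
  qed
  then have "b = (\<Sum>x\<in>Simple. (if x = a then real (c a) else 0) *\<^sub>R x)"
    unfolding c by (intro sum.cong) auto
  then have b_eq: "b = real (c a) *\<^sub>R a"
    using a finite_Simple by (simp add: if_distrib[of "\<lambda>r. r *\<^sub>R _"] cong: if_cong)
  then have "real (c a) *\<^sub>R fst a \<in> \<Sigma>0"
    using root_in[OF Pos_subset_Roots[OF b]] by (metis fst_scaleR)
  then have "real (c a) = 1 \<or> real (c a) = - 1"
    using reduced root_in[OF Simple_in_Roots[OF a]] unfolding reduced_roots_def by blast
  then show False
    using ne b_eq by (auto simp del: of_nat_eq_1_iff)
qed

lemma Pos_reflected: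
  assumes a: "a \<in> Simple" and b: "b \<in> Pos" and "root_reflection a b \<notin> Pos"
  shows "b = a"
  using root_reflection_simple_Pos assms by blast

lemma bij_betw_root_reflection:
  assumes a: "a \<in> Simple"
  shows "bij_betw (root_reflection a) (Pos - {a}) (Pos - {a})"
proof (rule bij_betwI)
  have fa: "fst a \<noteq> 0"
    using a Simple_in_Roots by simp
  show f: "root_reflection a \<in> Pos - {a} \<rightarrow> Pos - {a}"
  proof
    fix b
    assume b: "b \<in> Pos - {a}"
    have "root_reflection a b \<noteq> a"
      by (metis DiffE Pos_not_neg Simple_subset_Pos a b fa root_reflection_involution root_reflection_self)
    then show "root_reflection a b \<in> Pos - {a}"
      using root_reflection_simple_Pos a b by auto
  qed
  show "root_reflection a \<in> Pos - {a} \<rightarrow> Pos - {a}"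
    by (rule f)
qed (use a in \<open>simp_all add: root_reflection_involution Simple_in_Roots\<close>)

subsection \<open>Regular points and the fundamental alcove\<close>

lemma Reg_iff: "x \<in> Reg \<longleftrightarrow> (\<forall>a\<in>Roots. aff_apply a x \<noteq> 0)"
proof -
  have "x \<in> Reg \<longleftrightarrow> (\<forall>a\<in>Pos. aff_apply a x \<noteq> 0)"
    by (auto simp: regular_set_def)
  then show ?thesis
    by (metis Pos_or_neg Pos_subset_Roots aff_apply_uminus neg_equal_0_iff_equal)
qed

lemma reflection_Reg: "a \<in> Roots \<Longrightarrow> aff_reflection a x \<in> Reg \<longleftrightarrow> x \<in> Reg"
proof -
  have "aff_reflection a x \<in> Reg" if "a \<in> Roots" "x \<in> Reg" for x
    unfolding Reg_iff
  proof
    fix b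
    assume "b \<in> Roots"
    then have "aff_apply (root_reflection a b) x \<noteq> 0"
      using that root_reflection_in Reg_iff by blast
    then show "aff_apply b (aff_reflection a x) \<noteq> 0"
      by (simp add: aff_apply_root_reflection)
  qed
  then show "a \<in> Roots \<Longrightarrow> ?thesis"
    by (metis aff_reflection_involution fst_nonzero)
qed

definition alcove :: "'v set" where
  "alcove = {x. \<forall>a\<in>Pos. aff_apply a x > 0}"

lemma alcove_subset_Reg: "alcove \<subseteq> Reg"
  by (force simp: alcove_def regular_set_def)

lemma base_point_in_alcove: "base_point \<in> alcove"
  unfolding alcove_def using height_ex by force

lemma simple_negative:
  assumes "x \<in> Reg" "x \<notin> alcove"
  shows "\<exists>a\<in>Simple. aff_apply a x < 0"
proof (rule ccontr)
  assume "\<not> ?thesis"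
  then have *: "\<forall>a\<in>Simple. aff_apply a x > 0"
    using assms(1) Simple_in_Roots by (force simp: Reg_iff not_less)
  have "a = 0 \<or> aff_apply a x > 0" if "a \<in> nonneg_comb Simple" for a
    using that by (induction rule: nonneg_comb_induct) (use * in \<open>auto simp: aff_apply_add\<close>)
  then have "x \<in> alcove"
    unfolding alcove_def positive_affine_roots_def by (force dest: fst_nonzero)
  with assms(2) show False
    by simp
qed

text \<open>These are the walls that separate \<open>x\<close> from the fundamental alcove, and at
  the same time the terms of a Dunkl operator that are present at \<open>x\<close>.\<close>

definition negative_roots :: "'v \<Rightarrow> 'v affine_functional set" where
  "negative_roots x = {a \<in> Pos. aff_apply a x < 0}"

lemma Pos_snd_nonneg: "a \<in> Pos \<Longrightarrow> snd a \<ge> 0"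
proof -
  have "snd a \<ge> 0" if "a \<in> nonneg_comb Simple" for a
    using that by (induction rule: nonneg_comb_induct) (auto elim!: Simple_cases)
  then show "a \<in> Pos \<Longrightarrow> ?thesis"
    by (simp add: positive_affine_roots_def)
qed

text \<open>A positive root has a nonnegative constant, and a negative value at \<open>x\<close>
  bounds this constant from above; there are finitely many gradients.\<close>

lemma finite_negative_roots: "finite (negative_roots x)"
proof (rule finite_subset)
  let ?F = "(\<lambda>(\<alpha>, m). (\<alpha>, real_of_int m)) ` (SIGMA \<alpha>:\<Sigma>0. {0..- \<lfloor>blinfun_apply \<alpha> x\<rfloor>})"
  show "finite ?F"
    using finite_roots by auto
  show "negative_roots x \<subseteq> ?F"
  proof
    fix a
    assume a: "a \<in> negative_roots x"
    then obtain \<alpha> m where \<alpha>: "a = (\<alpha>, of_int m)" "\<alpha> \<in> \<Sigma>0"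
      by (auto simp: negative_roots_def elim!: root_cases dest!: Pos_subset_Roots)
    with a have "m \<ge> 0" "blinfun_apply \<alpha> x < - m"
      using Pos_snd_nonneg[of a] by (auto simp: negative_roots_def aff_apply_def)
    then have "m \<in> {0..- \<lfloor>blinfun_apply \<alpha> x\<rfloor>}"
      by simp linarith
    with \<alpha> show "a \<in> ?F"
      by force
  qed
qed

text \<open>A simple reflection permutes the positive roots other than its own, so only the sign of
  \<open>a\<close> itself is left out of the comparison.\<close>

lemma negative_roots_reflection:
  assumes a: "a \<in> Simple"
  shows "negative_roots (aff_reflection a x) - {a} = root_reflection a ` (negative_roots x - {a})"
proof -
  have fa: "fst a \<noteq> 0"
    using a Simple_in_Roots by simp
  note bij = bij_betw_root_reflection[OF a]
  have inv: "root_reflection a (root_reflection a b) = b" for b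
    using root_reflection_involution[OF fa] .
  show ?thesis
  proof (intro equalityI subsetI)
    fix b
    assume b: "b \<in> negative_roots (aff_reflection a x) - {a}"
    then have "root_reflection a b \<in> Pos - {a}"
      using bij_betwE[OF bij] by (simp add: negative_roots_def)
    moreover have "aff_apply (root_reflection a b) x < 0"
      using b by (simp add: aff_apply_root_reflection negative_roots_def)
    ultimately show "b \<in> root_reflection a ` (negative_roots x - {a})"
      by (intro image_eqI[of _ _ "root_reflection a b"]) (auto simp: inv negative_roots_def)
  next
    fix b
    assume "b \<in> root_reflection a ` (negative_roots x - {a})"
    then obtain c where c: "c \<in> negative_roots x - {a}" "b = root_reflection a c"
      by blast
    then have "b \<in> Pos - {a}"
      using bij_betwE[OF bij] by (simp add: negative_roots_def)
    then show "b \<in> negative_roots (aff_reflection a x) - {a}"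
      using c fa by (simp add: negative_roots_def aff_apply_root_reflection)
  qed
qed

subsection \<open>The affine Weyl group\<close>

text \<open>Words are kept as lists because the exchange argument deletes letters and the freeness
  proof is an induction on length.\<close>

definition word_map :: "'v affine_functional list \<Rightarrow> 'v \<Rightarrow> 'v" where
  "word_map as = foldr (\<lambda>a w. aff_reflection a \<circ> w) as id"

lemma word_map_simps [simp]:
  "word_map [] = id" "word_map (a # as) = aff_reflection a \<circ> word_map as"
  by (simp_all add: word_map_def)

lemma word_map_append: "word_map (as @ bs) = word_map as \<circ> word_map bs"
  by (induction as) (auto simp: comp_assoc)

text \<open>Induction on the height at the base point. A positive root that is not simple pairs
  positively with some simple root \<open>a\<close>, for otherwise it would pair nonpositively with
  itself. Reflecting it in \<open>a\<close> gives a positive root of smaller height, and conjugating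
  the word of that root by \<open>a\<close> gives a word for the reflection in
  \<open>b\<close>.\<close>

lemma reflection_is_word: "b \<in> Roots \<Longrightarrow> \<exists>as. set as \<subseteq> Simple \<and> aff_reflection b = word_map as"
proof -
  obtain t where t: "t > 0" "\<forall>a\<in>Pos. \<exists>n::nat. n > 0 \<and> aff_apply a base_point = t * real n"
    using height_ex by blast
  have pos: "\<exists>as. set as \<subseteq> Simple \<and> aff_reflection b = word_map as"
    if "b \<in> Pos" "aff_apply b base_point = t * real n" for b n
    using that
  proof (induction n arbitrary: b rule: less_induct)
    case (less n)
    show ?case
    proof (cases "b \<in> Simple")
      case True
      then show ?thesis
        by (intro exI[of _ "[b]"]) simp
    next
      case False
      have "\<exists>a\<in>Simple. dual_inner (fst b) (fst a) > 0"
      proof (rule ccontr)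
        assume "\<not> ?thesis"
        then have *: "\<forall>a\<in>Simple. dual_inner (fst b) (fst a) \<le> 0"
          by (auto simp: not_less)
        have "dual_inner (fst b) (fst x) \<le> 0" if "x \<in> nonneg_comb Simple" for x
          using that
        proof (induction rule: nonneg_comb_induct)
          case zero
          then show ?case
            by (simp add: dual_inner_def)
        next
          case (add x c)
          with * show ?case
            by (simp add: dual_inner_linear add_nonpos_nonpos)
        qed
        then have "dual_inner (fst b) (fst b) \<le> 0"
          using less.prems by (simp add: positive_affine_roots_def)
        moreover have "fst b \<noteq> 0"
          using less.prems Pos_subset_Roots by simp
        ultimately show False
          using dual_inner_self_pos by fastforce
      qed
      then obtain a where a: "a \<in> Simple" "dual_inner (fst b) (fst a) > 0"
        by blast
      let ?c = "root_reflection a b"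
      have c: "?c \<in> Pos"
        using root_reflection_simple_Pos a(1) less.prems False by blast
      have nz: "fst a \<noteq> 0" "fst b \<noteq> 0"
        using a(1) less.prems Simple_in_Roots Pos_subset_Roots by simp_all
      have "blinfun_apply (fst b) (coroot (fst a)) > 0"
        using a(2) nz by (simp add: coroot_apply)
      moreover have "aff_apply a base_point > 0"
        using base_point_in_alcove Simple_subset_Pos[OF a(1)] by (simp add: alcove_def)
      ultimately have "aff_apply ?c base_point < t * real n"
        using less.prems by (simp add: root_reflection_def aff_apply_diff aff_apply_scaleR)
      moreover obtain m :: nat where m: "aff_apply ?c base_point = t * real m"
        using t(2) c by blast
      ultimately have "m < n"
        using t(1) by simp
      with less.IH c m obtain as where as: "set as \<subseteq> Simple" "aff_reflection ?c = word_map as"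
        by blast
      have "aff_reflection a \<circ> aff_reflection a = id"
        using nz by (auto simp: fun_eq_iff)
      then have "aff_reflection b = aff_reflection a \<circ> word_map as \<circ> aff_reflection a"
        unfolding as(2)[symmetric] aff_reflection_root_reflection[OF nz]
        using nz by (simp add: fun_eq_iff)
      then have "aff_reflection b = word_map (a # as @ [a])"
        by (simp add: word_map_append comp_assoc)
      with as(1) a(1) show ?thesis
        by (intro exI[of _ "a # as @ [a]"]) auto
    qed
  qed
  assume "b \<in> Roots"
  then show ?thesis
    using Pos_or_neg[of b] pos t(2) aff_reflection_uminus[of b] by metis
qed

lemma word_map_bij: "set as \<subseteq> Roots \<Longrightarrow> bij (word_map as)"
  by (induction as) (simp_all add: bij_comp bij_aff_reflection)

lemma restrict_to_UNIV [simp]: "restrict f UNIV = f"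
  by (simp add: restrict_def)

lemma Weyl_one [simp]: "\<one>\<^bsub>Weyl\<^esub> = id"
  by (simp add: affine_Weyl_group_def BijGroup_def id_def)

lemma Weyl_eq_words: "carrier Weyl = {word_map as | as. set as \<subseteq> Simple}"
proof (intro equalityI subsetI)
  fix w
  assume "w \<in> carrier Weyl"
  then have "w \<in> generate (BijGroup UNIV) (aff_reflection ` Roots)"
    by (simp add: affine_Weyl_group_def)
  then show "w \<in> {word_map as | as. set as \<subseteq> Simple}"
  proof induction
    case one
    then show ?case
      by (auto simp: BijGroup_def id_def intro!: exI[of _ "[]"])
  next
    case (incl h)
    then show ?case
      using reflection_is_word by blast
  next
    case (inv h)
    then obtain a where a: "a \<in> Roots" "h = aff_reflection a"
      by blast
    then have "h \<in> Bij UNIV"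
      by (simp add: Bij_def bij_aff_reflection)
    then have "inv\<^bsub>BijGroup UNIV\<^esub> h = h"
      using a inv_aff_reflection[of a] by (simp add: inv_BijGroup)
    then show ?case
      using a(2) reflection_is_word[OF a(1)] by auto
  next
    case (eng h1 h2)
    then obtain as bs where *: "set as \<subseteq> Simple" "h1 = word_map as" "set bs \<subseteq> Simple" "h2 = word_map bs"
      by blast
    then have "h1 \<in> Bij UNIV" "h2 \<in> Bij UNIV"
      using word_map_bij Simple_in_Roots by (auto simp: Bij_def subset_iff)
    then have "h1 \<otimes>\<^bsub>BijGroup UNIV\<^esub> h2 = word_map (as @ bs)"
      using * by (simp add: BijGroup_def word_map_append compose_def comp_def)
    with * show ?case
      by (intro CollectI exI[of _ "as @ bs"]) simp
  qed
next
  fix w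
  assume "w \<in> {word_map as | as. set as \<subseteq> Simple}"
  then obtain as where "set as \<subseteq> Simple" "w = word_map as"
    by blast
  then have "w \<in> generate (BijGroup UNIV) (aff_reflection ` Roots) \<and> w \<in> Bij UNIV"
  proof (induction as arbitrary: w)
    case Nil
    then show ?case
      using generate.one[of "BijGroup UNIV" "aff_reflection ` Roots"]
      by (simp add: BijGroup_def id_def Bij_def bij_id[unfolded id_def])
  next
    case (Cons a as)
    then have a: "a \<in> Roots" "aff_reflection a \<in> Bij UNIV"
      by (simp_all add: Simple_in_Roots Bij_def bij_aff_reflection)
    have "aff_reflection a \<otimes>\<^bsub>BijGroup UNIV\<^esub> word_map as \<in> generate (BijGroup UNIV) (aff_reflection ` Roots)"
      using Cons generate.eng[OF generate.incl[OF imageI[OF a(1)]]] by auto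
    moreover have "aff_reflection a \<otimes>\<^bsub>BijGroup UNIV\<^esub> word_map as = w"
      using Cons a by (simp add: BijGroup_def compose_def comp_def)
    moreover have "w \<in> Bij UNIV"
    proof -
      have "set (a # as) \<subseteq> Roots"
        using Cons.prems Simple_in_Roots by auto
      then show ?thesis
        using word_map_bij Cons.prems by (simp add: Bij_def del: word_map_simps)
    qed
    ultimately show ?case
      by simp
  qed
  then show "w \<in> carrier Weyl"
    by (simp add: affine_Weyl_group_def)
qed

lemma Weyl_bij: "w \<in> carrier Weyl \<Longrightarrow> bij w"
  using word_map_bij Simple_in_Roots by (force simp: Weyl_eq_words)

lemma Weyl_mult: "u \<in> carrier Weyl \<Longrightarrow> w \<in> carrier Weyl \<Longrightarrow> u \<otimes>\<^bsub>Weyl\<^esub> w = u \<circ> w"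
  using Weyl_bij[of u] Weyl_bij[of w]
  by (simp add: affine_Weyl_group_def BijGroup_def Bij_def compose_def comp_def)

lemma Weyl_id [simp]: "id \<in> carrier Weyl"
  unfolding Weyl_eq_words by (auto intro!: exI[of _ "[]"])

lemma Weyl_comp: "u \<in> carrier Weyl \<Longrightarrow> w \<in> carrier Weyl \<Longrightarrow> u \<circ> w \<in> carrier Weyl"
  unfolding Weyl_eq_words by (clarsimp, rename_tac as bs, rule_tac x = "as @ bs" in exI) (simp add: word_map_append)

lemma Weyl_reflection: "a \<in> Roots \<Longrightarrow> aff_reflection a \<in> carrier Weyl"
  unfolding Weyl_eq_words using reflection_is_word by blast

lemma Weyl_induct [consumes 1, case_names id reflection]:
  assumes "w \<in> carrier Weyl" and "P id"
    and "\<And>a w. a \<in> Simple \<Longrightarrow> w \<in> carrier Weyl \<Longrightarrow> P w \<Longrightarrow> P (aff_reflection a \<circ> w)"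
  shows "P w"
proof -
  obtain as where "set as \<subseteq> Simple" "w = word_map as"
    using assms(1) by (auto simp: Weyl_eq_words)
  then show ?thesis
    by (induction as arbitrary: w) (auto intro!: assms simp: Weyl_eq_words)
qed

lemma Weyl_inv: "w \<in> carrier Weyl \<Longrightarrow> inv_into UNIV w \<in> carrier Weyl"
proof (induction rule: Weyl_induct)
  case (reflection a w)
  then have "inv_into UNIV (aff_reflection a \<circ> w) = inv_into UNIV w \<circ> aff_reflection a"
    using o_inv_distrib[OF bij_aff_reflection Weyl_bij, of a w] Simple_in_Roots by simp
  then show ?case
    using reflection Weyl_comp[OF _ Weyl_reflection, OF reflection(3) Simple_in_Roots] by metis
qed (metis Weyl_id inv_id)

text \<open>Each step reflects in a negative simple root, which lowers the number of negative roots by one.\<close>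

lemma Reg_translate:
  assumes "x \<in> Reg"
  shows "\<exists>w\<in>carrier Weyl. \<exists>y\<in>alcove. x = w y"
  using assms
proof (induction "card (negative_roots x)" arbitrary: x rule: less_induct)
  case less
  show ?case
  proof (cases "x \<in> alcove")
    case True
    then show ?thesis
      by (intro bexI[of _ id] bexI[of _ x]) simp_all
  next
    case False
    then obtain a where a: "a \<in> Simple" "aff_apply a x < 0"
      using simple_negative less.prems by blast
    let ?y = "aff_reflection a x"
    have ar: "a \<in> Roots" "a \<in> Pos"
      using a Simple_in_Roots Simple_subset_Pos by auto
    have "a \<notin> negative_roots ?y"
      using a ar by (simp add: negative_roots_def aff_apply_reflection_self)
    then have "negative_roots ?y = root_reflection a ` (negative_roots x - {a})"
      using negative_roots_reflection[OF a(1), of x] by simp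
    then have "card (negative_roots ?y) \<le> card (negative_roots x - {a})"
      using card_image_le[of "negative_roots x - {a}"] finite_negative_roots by auto
    also have "\<dots> < card (negative_roots x)"
      using a ar finite_negative_roots by (intro psubset_card_mono) (auto simp: negative_roots_def)
    finally obtain w y where w: "w \<in> carrier Weyl" "y \<in> alcove" "?y = w y"
      using less.hyps[of ?y] less.prems reflection_Reg[OF ar(1)] by blast
    then have "x = (aff_reflection a \<circ> w) y"
      using ar by (metis aff_reflection_involution comp_apply fst_nonzero)
    with w ar show ?thesis
      using Weyl_comp Weyl_reflection by blast
  qed
qed

section \<open>The exchange condition and the free action on the alcove\<close>

definition root_word :: "'v affine_functional list \<Rightarrow> 'v affine_functional \<Rightarrow> 'v affine_functional" where
  "root_word as = foldr root_reflection as"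

lemma root_word_simps [simp]:
  "root_word [] b = b" "root_word (a # as) b = root_reflection a (root_word as b)"
  by (simp_all add: root_word_def)

lemma root_word_in: "set as \<subseteq> Roots \<Longrightarrow> b \<in> Roots \<Longrightarrow> root_word as b \<in> Roots"
  by (induction as) (auto simp: root_reflection_in)

lemma aff_apply_root_word:
  "set as \<subseteq> Roots \<Longrightarrow> aff_apply (root_word as b) (word_map as x) = aff_apply b x"
  by (induction as) (simp_all add: aff_apply_root_reflection)

lemma aff_reflection_root_word:
  "set as \<subseteq> Roots \<Longrightarrow> b \<in> Roots \<Longrightarrow>
    aff_reflection (root_word as b) \<circ> word_map as = word_map as \<circ> aff_reflection b"
proof (induction as)
  case (Cons a as)
  then have "aff_reflection (root_word as b) (word_map as x) = word_map as (aff_reflection b x)" for x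
    by (simp add: fun_eq_iff)
  with Cons.prems show ?case
    by (simp add: fun_eq_iff aff_reflection_root_reflection root_word_in)
qed simp

text \<open>Applied letter by letter from the right, the word turns the positive root
  \<open>a\<close> negative at some letter \<open>b\<close>. Only \<open>b\<close> itself changes
  sign there, so the root reached just before is \<open>b\<close>. Hence the reflection in
  \<open>b\<close> can be moved through the letters to its right, where it becomes the reflection in
  \<open>a\<close> and cancels the last letter.\<close>

lemma exchange:
  assumes "set as \<subseteq> Simple" "a \<in> Simple" "root_word as a \<notin> Pos"
  shows "\<exists>bs. set bs \<subseteq> Simple \<and> length bs < length as \<and> word_map (as @ [a]) = word_map bs"
  using assms
proof (induction as)
  case Nil
  then show ?case
    by (simp add: Simple_subset_Pos)
next
  case (Cons b as)
  show ?case
  proof (cases "root_word as a \<in> Pos")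
    case True
    have roots: "set as \<subseteq> Roots" "a \<in> Roots"
      using Cons.prems Simple_in_Roots by auto
    from True Cons.prems have "root_word as a = b"
      using Pos_reflected[of b "root_word as a"] by simp
    then have "aff_reflection b (word_map as x) = word_map as (aff_reflection a x)" for x
      using aff_reflection_root_word[OF roots] by (simp add: fun_eq_iff)
    then have "word_map ((b # as) @ [a]) = word_map as"
      using roots by (simp add: word_map_append fun_eq_iff)
    with Cons.prems show ?thesis
      by (intro exI[of _ as]) auto
  next
    case False
    then obtain bs where "set bs \<subseteq> Simple" "length bs < length as" "word_map (as @ [a]) = word_map bs"
      using Cons by auto
    with Cons.prems show ?thesis
      by (intro exI[of _ "b # bs"]) auto
  qed
qed

text \<open>If a nonempty word sends \<open>x\<close> into the alcove, let \<open>a\<close> be its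
  last letter. The image of \<open>a\<close> under the preceding letters takes the negative value
  \<open>- aff_apply a x\<close> at a point of the alcove, so it is not positive and
  \<open>exchange\<close> shortens the word.\<close>

lemma word_map_free:
  assumes "set as \<subseteq> Simple" "x \<in> alcove" "word_map as x \<in> alcove"
  shows "word_map as = id"
  using assms(1,3)
proof (induction "length as" arbitrary: as rule: less_induct)
  case less
  show ?case
  proof (cases as rule: rev_cases)
    case (snoc bs a)
    have a: "a \<in> Simple" "set bs \<subseteq> Simple" "a \<in> Pos" "a \<in> Roots" "set bs \<subseteq> Roots"
      using less.prems snoc Simple_subset_Pos Simple_in_Roots by auto
    have "aff_apply (root_word bs a) (word_map as x) = - aff_apply a x"
      using a by (simp add: snoc word_map_append aff_apply_root_word aff_apply_reflection_self)
    also have "\<dots> < 0"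
      using assms(2) a by (simp add: alcove_def)
    finally have "root_word bs a \<notin> Pos"
      using less.prems by (force simp: alcove_def)
    then obtain cs where "set cs \<subseteq> Simple" "length cs < length bs" "word_map as = word_map cs"
      using exchange[of bs a] a snoc by blast
    then show ?thesis
      using less snoc by (metis length_append_singleton less_Suc_eq)
  qed simp
qed

lemma Weyl_free: "w \<in> carrier Weyl \<Longrightarrow> x \<in> alcove \<Longrightarrow> w x \<in> alcove \<Longrightarrow> w = id"
  using word_map_free by (auto simp: Weyl_eq_words)

end

section \<open>Smooth functions\<close>

lemma continuously_differentiable_on_subset:
  "continuously_differentiable_on n S f \<Longrightarrow> U \<subseteq> S \<Longrightarrow> continuously_differentiable_on n U f"
  by (induction n arbitrary: f) (auto intro: continuous_on_subset)

text \<open>On an open set all derivatives depend only on the values there.\<close>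

lemma continuously_differentiable_on_cong:
  assumes "open S" "\<And>x. x \<in> S \<Longrightarrow> f x = g x" "continuously_differentiable_on n S f"
  shows "continuously_differentiable_on n S g"
  using assms(2,3)
proof (induction n arbitrary: f g)
  case 0
  then show ?case
    using continuous_on_cong by fastforce
next
  case (Suc n)
  have f: "f differentiable at x" if "x \<in> S" for x
    using Suc.prems that by simp
  then have "g differentiable at x" if "x \<in> S" for x
    using that assms(1) Suc.prems(1) unfolding differentiable_def
    by (meson has_derivative_transform_within_open)
  moreover have "continuously_differentiable_on n S (\<lambda>x. frechet_derivative g (at x) v)" for v
  proof (rule Suc.IH)
    show "continuously_differentiable_on n S (\<lambda>x. frechet_derivative f (at x) v)"
      using Suc.prems by simp
    show "frechet_derivative f (at x) v = frechet_derivative g (at x) v" if "x \<in> S" for x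
      using frechet_derivative_transform_within_open[OF f assms(1)] Suc.prems(1) that by metis
  qed
  ultimately show ?case
    by simp
qed

lemma continuously_differentiable_on_SucI:
  assumes "open S" "\<And>x. x \<in> S \<Longrightarrow> (f has_derivative F x) (at x)"
    and "\<And>v. continuously_differentiable_on n S (\<lambda>x. F x v)"
  shows "continuously_differentiable_on (Suc n) S f"
proof -
  have "F x = frechet_derivative f (at x)" if "x \<in> S" for x
    using assms(2)[OF that] by (rule frechet_derivative_at)
  then have "continuously_differentiable_on n S (\<lambda>x. frechet_derivative f (at x) v)" for v
    by (intro continuously_differentiable_on_cong[OF assms(1) _ assms(3)]) simp
  then show ?thesis
    using assms(2) unfolding continuously_differentiable_on.simps differentiable_def by blast
qed

lemma continuously_differentiable_on_SucD:
  assumes "continuously_differentiable_on (Suc n) S f"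
  shows "x \<in> S \<Longrightarrow> (f has_derivative frechet_derivative f (at x)) (at x)"
    and "continuously_differentiable_on n S (\<lambda>x. frechet_derivative f (at x) v)"
  using assms by (simp_all flip: frechet_derivative_works)

text \<open>Reduces smoothness on the regular set to neighbourhoods on which the set of negative
  roots is constant.\<close>

lemma continuously_differentiable_on_local:
  assumes "\<And>x. x \<in> S \<Longrightarrow> \<exists>U. open U \<and> x \<in> U \<and> continuously_differentiable_on n U f"
  shows "continuously_differentiable_on n S f"
  using assms
proof (induction n arbitrary: f)
  case 0
  have "continuous (at x) f" if x: "x \<in> S" for x
  proof -
    obtain U where "open U" "x \<in> U" "continuous_on U f"
      using 0[OF x] by auto
    then show ?thesis
      by (simp add: continuous_on_eq_continuous_at)
  qed
  then show ?case
    by (simp add: continuous_at_imp_continuous_on)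
next
  case (Suc n)
  have "f differentiable at x" if x: "x \<in> S" for x
    using Suc.prems[OF x] by auto
  moreover have "continuously_differentiable_on n S (\<lambda>x. frechet_derivative f (at x) v)" for v
  proof (rule Suc.IH)
    fix x
    assume "x \<in> S"
    then obtain U where "open U" "x \<in> U" "continuously_differentiable_on (Suc n) U f"
      using Suc.prems by blast
    then show "\<exists>U. open U \<and> x \<in> U \<and> continuously_differentiable_on n U (\<lambda>x. frechet_derivative f (at x) v)"
      by (intro exI[of _ U]) simp
  qed
  ultimately show ?case
    by simp
qed

lemma continuously_differentiable_on_const: "continuously_differentiable_on n S (\<lambda>x. c)"
  by (induction n arbitrary: c) auto

lemma continuously_differentiable_on_add:
  assumes "open S" "continuously_differentiable_on n S f" "continuously_differentiable_on n S g"
  shows "continuously_differentiable_on n S (\<lambda>x. f x + g x)"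
  using assms(2,3)
proof (induction n arbitrary: f g)
  case (Suc n)
  note D = continuously_differentiable_on_SucD[OF Suc.prems(1)] continuously_differentiable_on_SucD[OF Suc.prems(2)]
  show ?case
    by (rule continuously_differentiable_on_SucI[OF assms(1) has_derivative_add[OF D(1,3)] Suc.IH[OF D(2,4)]])
qed (simp add: continuous_on_add)

lemma continuously_differentiable_on_bounded_linear:
  assumes "open S" "bounded_linear h" "continuously_differentiable_on n S f"
  shows "continuously_differentiable_on n S (\<lambda>x. h (f x))"
  using assms(3)
proof (induction n arbitrary: f)
  case 0
  then show ?case
    using bounded_linear.continuous_on[OF assms(2)] by simp
next
  case (Suc n)
  note D = continuously_differentiable_on_SucD[OF Suc.prems]
  show ?case
    by (rule continuously_differentiable_on_SucI[OF assms(1) bounded_linear.has_derivative[OF assms(2) D(1)]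
        Suc.IH[OF D(2)]])
qed

lemma continuously_differentiable_on_sum:
  assumes "open S" "\<And>i. i \<in> I \<Longrightarrow> continuously_differentiable_on n S (f i)"
  shows "continuously_differentiable_on n S (\<lambda>x. \<Sum>i\<in>I. f i x)"
  using assms(2)
  by (induction I rule: infinite_finite_induct)
    (simp_all add: continuously_differentiable_on_const continuously_differentiable_on_add assms(1))

text \<open>The derivative of \<open>A\<close> is the same map \<open>L\<close> at every point. The
  derivative of the composite is therefore again a composite with \<open>A\<close>, and the
  induction needs no product rule.\<close>

lemma continuously_differentiable_on_compose_affine:
  assumes "open S" "\<And>x. x \<in> S \<Longrightarrow> A x \<in> T"
    and A: "\<And>x. (A has_derivative L) (at x)"
    and "continuously_differentiable_on n T f"
  shows "continuously_differentiable_on n S (\<lambda>x. f (A x))"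
  using assms(4)
proof (induction n arbitrary: f)
  case 0
  have "continuous_on S A"
    using has_derivative_continuous[OF A] by (simp add: continuous_at_imp_continuous_on)
  then show ?case
    using 0 assms(2) by (auto intro: continuous_on_compose2)
next
  case (Suc n)
  note D = continuously_differentiable_on_SucD[OF Suc.prems]
  show ?case
    by (rule continuously_differentiable_on_SucI[OF assms(1) has_derivative_compose[OF A D(1)] Suc.IH[OF D(2)]])
      (rule assms(2))
qed

lemma has_derivative_exp_linear:
  fixes L :: "'v::real_normed_vector \<Rightarrow> complex"
  assumes "bounded_linear L"
  shows "((\<lambda>x. c * exp (L x)) has_derivative (\<lambda>v. c * L v * exp (L x))) (at x)"
proof -
  have "(exp has_derivative (*) (exp (L x))) (at (L x))"
    using DERIV_exp[of "L x"] by (simp add: has_field_derivative_def)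
  from has_derivative_compose[OF bounded_linear.has_derivative[OF assms has_derivative_ident] this]
  have "((\<lambda>x. exp (L x)) has_derivative (\<lambda>v. exp (L x) * L v)) (at x)" .
  from has_derivative_mult_right[OF this, of c] show ?thesis
    by (simp add: mult_ac)
qed

lemma continuously_differentiable_on_exp:
  fixes L :: "'v::real_normed_vector \<Rightarrow> complex"
  assumes "open S" "bounded_linear L"
  shows "continuously_differentiable_on n S (\<lambda>x. c * exp (L x))"
proof (induction n arbitrary: c)
  case 0
  then show ?case
    using has_derivative_continuous[OF has_derivative_exp_linear[OF assms(2)]]
    by (simp add: continuous_at_imp_continuous_on)
next
  case (Suc n)
  show ?case
    by (rule continuously_differentiable_on_SucI[OF assms(1) has_derivative_exp_linear[OF assms(2)] Suc.IH])
qed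

text \<open>The second difference of \<open>g\<close> is evaluated by applying the mean value theorem in each direction.\<close>

lemma second_difference:
  fixes g :: "'v::real_normed_vector \<Rightarrow> real"
  assumes ball: "ball x e \<subseteq> S" and t: "t > 0" "t * (norm u + norm v) < e"
    and g: "\<And>y. y \<in> S \<Longrightarrow> (g has_derivative G y) (at y)"
    and G: "\<And>y. y \<in> S \<Longrightarrow> ((\<lambda>z. G z u) has_derivative H y) (at y)"
  shows "\<exists>p. dist x p < e \<and> g (x + t *\<^sub>R u + t *\<^sub>R v) - g (x + t *\<^sub>R u) - g (x + t *\<^sub>R v) + g x = t\<^sup>2 * H p v"
proof -
  have near: "dist x (x + s *\<^sub>R u + r *\<^sub>R v) \<le> t * (norm u + norm v)" if "0 \<le> s" "s \<le> t" "0 \<le> r" "r \<le> t" for s r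
  proof -
    have "norm (s *\<^sub>R u + r *\<^sub>R v) \<le> s * norm u + r * norm v"
      using norm_triangle_ineq[of "s *\<^sub>R u" "r *\<^sub>R v"] that by simp
    also have "\<dots> \<le> t * norm u + t * norm v"
      using that by (intro add_mono mult_right_mono) auto
    finally have "norm (s *\<^sub>R u + r *\<^sub>R v) \<le> t * (norm u + norm v)"
      by (simp add: distrib_left)
    moreover have "dist x (x + w) = norm w" for w
      by (simp add: dist_norm)
    ultimately show ?thesis
      by (simp add: add.assoc)
  qed
  then have S: "x + s *\<^sub>R u + r *\<^sub>R v \<in> S" if "0 \<le> s" "s \<le> t" "0 \<le> r" "r \<le> t" for s r
    using near[OF that] t by (intro subsetD[OF ball]) simp
  have line: "((\<lambda>s. F (y + s *\<^sub>R w)) has_field_derivative F' w) (at s)"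
    if "(F has_derivative F') (at (y + s *\<^sub>R w))" for F :: "'v \<Rightarrow> real" and F' y w s
  proof -
    have "((\<lambda>s. y + s *\<^sub>R w) has_derivative (\<lambda>h. h *\<^sub>R w)) (at s)"
      by (auto intro!: derivative_eq_intros)
    from has_derivative_compose[OF this that] have "((\<lambda>s. F (y + s *\<^sub>R w)) has_derivative (\<lambda>h. F' (h *\<^sub>R w))) (at s)" .
    moreover have "F' (h *\<^sub>R w) = F' w * h" for h
      using has_derivative_linear[OF that] by (simp add: linear_scale)
    ultimately show ?thesis
      by (simp add: has_field_derivative_def)
  qed
  have "\<exists>s. 0 < s \<and> s < t \<and>
      (g (x + t *\<^sub>R v + t *\<^sub>R u) - g (x + t *\<^sub>R u)) - (g (x + t *\<^sub>R v + 0 *\<^sub>R u) - g (x + 0 *\<^sub>R u)) =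
      (t - 0) * (G (x + t *\<^sub>R v + s *\<^sub>R u) u - G (x + s *\<^sub>R u) u)"
  proof (intro MVT2 DERIV_diff)
    fix s
    assume s: "0 \<le> s" "s \<le> t"
    show "((\<lambda>s. g (x + t *\<^sub>R v + s *\<^sub>R u)) has_field_derivative G (x + t *\<^sub>R v + s *\<^sub>R u) u) (at s)"
      using S[of s t] s t by (intro line g) (simp add: algebra_simps)
    show "((\<lambda>s. g (x + s *\<^sub>R u)) has_field_derivative G (x + s *\<^sub>R u) u) (at s)"
      using S[of s 0] s t by (intro line g) simp
  qed (use t in auto)
  then obtain s where s: "0 < s" "s < t"
    "g (x + t *\<^sub>R v + t *\<^sub>R u) - g (x + t *\<^sub>R u) - g (x + t *\<^sub>R v) + g x =
      t * (G (x + t *\<^sub>R v + s *\<^sub>R u) u - G (x + s *\<^sub>R u) u)"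
    by (metis (no_types, lifting) add_0_right diff_diff_eq2 diff_add_eq diff_zero scaleR_zero_left)
  have "\<exists>r. 0 < r \<and> r < t \<and> G (x + s *\<^sub>R u + t *\<^sub>R v) u - G (x + s *\<^sub>R u + 0 *\<^sub>R v) u =
      (t - 0) * H (x + s *\<^sub>R u + r *\<^sub>R v) v"
  proof (intro MVT2)
    fix r
    assume "0 \<le> r" "r \<le> t"
    then show "((\<lambda>r. G (x + s *\<^sub>R u + r *\<^sub>R v) u) has_field_derivative H (x + s *\<^sub>R u + r *\<^sub>R v) v) (at r)"
      using S[of s r] s t by (intro line G) simp
  qed (use t in auto)
  then obtain r where r: "0 < r" "r < t" "G (x + s *\<^sub>R u + t *\<^sub>R v) u - G (x + s *\<^sub>R u) u =
      t * H (x + s *\<^sub>R u + r *\<^sub>R v) v"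
    by auto
  have swap: "x + t *\<^sub>R v + s *\<^sub>R u = x + s *\<^sub>R u + t *\<^sub>R v" for s
    by simp
  have "dist x (x + s *\<^sub>R u + r *\<^sub>R v) < e"
    using near[of s r] r(1,2) s(1,2) t by simp
  then show ?thesis
    using s(3) unfolding swap r(3)
    by (intro exI[of _ "x + s *\<^sub>R u + r *\<^sub>R v"]) (simp add: power2_eq_square)
qed

text \<open>The second difference is symmetric in the two directions, so it equals
  \<open>t\<^sup>2\<close> times either mixed derivative, each at some point near \<open>x\<close>.
  Continuity of both derivatives excludes different values at \<open>x\<close>.\<close>

lemma mixed_derivatives_real:
  fixes g :: "'v::real_normed_vector \<Rightarrow> real"
  assumes "open S" "x \<in> S"
    and g: "\<And>y. y \<in> S \<Longrightarrow> (g has_derivative G y) (at y)"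
    and Hu: "\<And>y. y \<in> S \<Longrightarrow> ((\<lambda>z. G z u) has_derivative H y) (at y)"
    and Hv: "\<And>y. y \<in> S \<Longrightarrow> ((\<lambda>z. G z v) has_derivative K y) (at y)"
    and cont: "continuous_on S (\<lambda>y. H y v)" "continuous_on S (\<lambda>y. K y u)"
  shows "H x v = K x u"
proof (rule ccontr)
  assume "H x v \<noteq> K x u"
  define d where "d = \<bar>H x v - K x u\<bar> / 2"
  have d: "d > 0"
    using \<open>H x v \<noteq> K x u\<close> by (simp add: d_def)
  have "isCont (\<lambda>y. H y v) x" "isCont (\<lambda>y. K y u) x"
    using cont assms(1,2) by (simp_all add: continuous_on_eq_continuous_at)
  then obtain e1 e2 where e: "e1 > 0" "\<And>y. dist x y < e1 \<Longrightarrow> dist (H y v) (H x v) < d"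
    "e2 > 0" "\<And>y. dist x y < e2 \<Longrightarrow> dist (K y u) (K x u) < d"
    using d unfolding continuous_at_eps_delta by (metis dist_commute)
  obtain e3 where e3: "e3 > 0" "ball x e3 \<subseteq> S"
    using assms(1,2) open_contains_ball by blast
  define e where "e = min e3 (min e1 e2)"
  have e0: "e > 0" "ball x e \<subseteq> S"
    using e e3 by (auto simp: e_def)
  \<comment> \<open>The parallelogram spanned by \<open>t *\<^sub>R u\<close> and
    \<open>t *\<^sub>R v\<close> must stay in the ball of radius \<open>e\<close>; the summand 1
    keeps the denominator positive when both vectors are 0.\<close>
  define t where "t = e / (2 * (1 + norm u + norm v))"
  have pos: "1 + norm u + norm v > 0"
    by (simp add: add_pos_nonneg)
  have t: "t > 0" "t * (norm u + norm v) < e" "t * (norm v + norm u) < e"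
    using e0 pos by (auto simp: t_def field_simps add_pos_nonneg intro!: add_nonneg_pos mult_nonneg_nonneg)
  obtain p where p: "dist x p < e"
    "g (x + t *\<^sub>R u + t *\<^sub>R v) - g (x + t *\<^sub>R u) - g (x + t *\<^sub>R v) + g x = t\<^sup>2 * H p v"
    using second_difference[OF e0(2) t(1,2) g Hu] by blast
  obtain q where q: "dist x q < e"
    "g (x + t *\<^sub>R v + t *\<^sub>R u) - g (x + t *\<^sub>R v) - g (x + t *\<^sub>R u) + g x = t\<^sup>2 * K q u"
    using second_difference[OF e0(2) t(1,3) g Hv] by blast
  have "t\<^sup>2 * H p v = t\<^sup>2 * K q u"
    unfolding p(2)[symmetric] q(2)[symmetric] by (simp add: algebra_simps)
  then have "H p v = K q u"
    using t by simp
  moreover have "dist (H p v) (H x v) < d" "dist (K q u) (K x u) < d"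
    using e p q by (auto simp: e_def)
  moreover have "\<bar>H x v - K x u\<bar> = 2 * d"
    by (simp add: d_def)
  ultimately show False
    unfolding dist_real_def by (smt (verit))
qed

text \<open>The mean value theorem is real, so real and imaginary parts are treated
  separately.\<close>

lemma mixed_derivatives:
  fixes f :: "'v::real_normed_vector \<Rightarrow> complex"
  assumes S: "open S" "x \<in> S" and f: "\<And>n. continuously_differentiable_on n S f"
  shows "frechet_derivative (\<lambda>z. frechet_derivative f (at z) u) (at x) v =
    frechet_derivative (\<lambda>z. frechet_derivative f (at z) v) (at x) u"
proof -
  have f1: "(f has_derivative frechet_derivative f (at y)) (at y)" if "y \<in> S" for y
    using f[of "Suc 0"] that by (simp flip: frechet_derivative_works)
  have f2: "((\<lambda>z. frechet_derivative f (at z) w) has_derivative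
      frechet_derivative (\<lambda>z. frechet_derivative f (at z) w) (at y)) (at y)" if "y \<in> S" for y w
    using f[of "Suc (Suc 0)"] that by (simp flip: frechet_derivative_works)
  have f3: "continuous_on S (\<lambda>y. frechet_derivative (\<lambda>z. frechet_derivative f (at z) w) (at y) w')" for w w'
    using f[of "Suc (Suc 0)"] by simp
  have *: "h (frechet_derivative (\<lambda>z. frechet_derivative f (at z) u) (at x) v) =
      h (frechet_derivative (\<lambda>z. frechet_derivative f (at z) v) (at x) u)"
    if h: "bounded_linear h" for h :: "complex \<Rightarrow> real"
    using S f1 f2 f3
    by (intro mixed_derivatives_real[of S x "\<lambda>y. h (f y)" "\<lambda>y w. h (frechet_derivative f (at y) w)" u
          "\<lambda>y w. h (frechet_derivative (\<lambda>z. frechet_derivative f (at z) u) (at y) w)" v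
          "\<lambda>y w. h (frechet_derivative (\<lambda>z. frechet_derivative f (at z) v) (at y) w)"])
      (auto intro: bounded_linear.has_derivative[OF h] bounded_linear.continuous_on[OF h])
  show ?thesis
    by (rule complex_eqI) (use *[OF bounded_linear_Re] *[OF bounded_linear_Im] in auto)
qed

section \<open>The Weyl group action and the Dunkl operators\<close>

lemma fun_action_comp:
  "bij u \<Longrightarrow> bij w \<Longrightarrow> fun_action (u \<circ> w) f = fun_action u (fun_action w f)"
  by (simp add: fun_action_def o_inv_distrib)

lemma fun_action_id [simp]: "fun_action id f = f"
  by (simp add: fun_action_def)

lemma fun_action_reflection: "fst a \<noteq> 0 \<Longrightarrow> fun_action (aff_reflection a) f = (\<lambda>x. f (aff_reflection a x))"
  by (simp add: fun_action_def)

context affine_setting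
begin

abbreviation "Smooth \<equiv> smooth_functions Reg"
abbreviation "C \<equiv> carrier Smooth"
abbreviation "Dunkl \<equiv> Dunkl_operator \<Sigma>0 I0 \<phi> k"

lemma C_iff: "f \<in> C \<longleftrightarrow> (\<forall>n. continuously_differentiable_on n Reg f) \<and> (\<forall>x. x \<notin> Reg \<longrightarrow> f x = 0)"
  by (simp add: smooth_functions_def)

text \<open>Infinitely many roots have to keep their sign on one neighbourhood. No
  \<open>\<alpha>\<close> in \<open>\<Sigma>0\<close> takes an integer value at a regular point, so
  near \<open>x\<close> each of these finitely many gradients stays between two consecutive
  integers, which fixes the signs of all its integer translates.\<close>

lemma local_signs:
  assumes "x \<in> Reg"
  shows "\<exists>U. open U \<and> x \<in> U \<and> U \<subseteq> Reg \<and> (\<forall>y\<in>U. \<forall>a\<in>Roots. aff_apply a y < 0 \<longleftrightarrow> aff_apply a x < 0)"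
proof -
  define N where "N = (\<lambda>\<alpha> :: 'v \<Rightarrow>\<^sub>L real. \<lfloor>blinfun_apply \<alpha> x\<rfloor>)"
  define U where "U = (\<Inter>\<alpha>\<in>\<Sigma>0. {y. real_of_int (N \<alpha>) < blinfun_apply \<alpha> y} \<inter> {y. blinfun_apply \<alpha> y < real_of_int (N \<alpha> + 1)})"
  have "open U"
    unfolding U_def using finite_roots
    by (intro open_INT ballI open_Int open_Collect_less continuous_intros) auto
  have x: "x \<in> U"
    unfolding U_def
  proof
    fix \<alpha>
    assume "\<alpha> \<in> \<Sigma>0"
    then have "aff_apply (\<alpha>, of_int (- N \<alpha>)) x \<noteq> 0"
      using assms root_pair Reg_iff by blast
    then have "blinfun_apply \<alpha> x \<noteq> of_int (N \<alpha>)"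
      by (simp add: aff_apply_def)
    moreover have "of_int (N \<alpha>) \<le> blinfun_apply \<alpha> x" "blinfun_apply \<alpha> x < of_int (N \<alpha> + 1)"
      unfolding N_def by linarith+
    ultimately show "x \<in> {y. real_of_int (N \<alpha>) < blinfun_apply \<alpha> y} \<inter> {y. blinfun_apply \<alpha> y < real_of_int (N \<alpha> + 1)}"
      by simp
  qed
  have signs: "(aff_apply a y < 0 \<longleftrightarrow> N (fst a) + \<lfloor>snd a\<rfloor> < 0) \<and> aff_apply a y \<noteq> 0"
    if y: "y \<in> U" and a: "a \<in> Roots" for y a
  proof -
    obtain \<alpha> m where \<alpha>: "a = (\<alpha>, of_int m)" "\<alpha> \<in> \<Sigma>0"
      using a by (rule root_cases)
    with y have "of_int (N \<alpha>) < blinfun_apply \<alpha> y" "blinfun_apply \<alpha> y < of_int (N \<alpha> + 1)"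
      unfolding U_def by blast+
    moreover have "N \<alpha> + m < 0 \<Longrightarrow> real_of_int (N \<alpha> + 1) \<le> - real_of_int m"
      by linarith
    moreover have "\<not> N \<alpha> + m < 0 \<Longrightarrow> - real_of_int m \<le> real_of_int (N \<alpha>)"
      by linarith
    ultimately show ?thesis
      by (cases "N \<alpha> + m < 0") (simp_all add: \<alpha> aff_apply_def)
  qed
  have "U \<subseteq> Reg"
    using signs Reg_iff by blast
  with \<open>open U\<close> x signs show ?thesis
    by (intro exI[of _ U]) simp
qed

lemma open_Reg: "open Reg"
proof (subst open_subopen, rule ballI)
  show "\<exists>T. open T \<and> x \<in> T \<and> T \<subseteq> Reg" if "x \<in> Reg" for x
    using local_signs[OF that] by blast
qed

lemma local_negative_roots:
  assumes "x \<in> Reg"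
  shows "\<exists>U. open U \<and> x \<in> U \<and> U \<subseteq> Reg \<and> (\<forall>y\<in>U. negative_roots y = negative_roots x)"
proof -
  obtain U where U: "open U" "x \<in> U" "U \<subseteq> Reg"
    "\<forall>y\<in>U. \<forall>a\<in>Roots. aff_apply a y < 0 \<longleftrightarrow> aff_apply a x < 0"
    using local_signs[OF assms] by blast
  have "negative_roots y = negative_roots x" if "y \<in> U" for y
    unfolding negative_roots_def using U(4) that by (auto simp: Pos_subset_Roots)
  with U(1-3) show ?thesis
    by blast
qed

lemma alcove_iff: "x \<in> alcove \<longleftrightarrow> x \<in> Reg \<and> negative_roots x = {}"
proof -
  have "x \<in> Reg \<longleftrightarrow> (\<forall>a\<in>Pos. aff_apply a x \<noteq> 0)"
    by (auto simp: regular_set_def)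
  then show ?thesis
    by (auto simp: alcove_def negative_roots_def linorder_neq_iff)
qed

lemma open_alcove: "open alcove"
proof (subst open_subopen, rule ballI)
  fix x
  assume x: "x \<in> alcove"
  then have "x \<in> Reg"
    by (simp add: alcove_iff)
  then obtain U where "open U" "x \<in> U" "U \<subseteq> Reg" "\<forall>y\<in>U. negative_roots y = negative_roots x"
    by (metis local_negative_roots)
  moreover from this have "y \<in> alcove" if "y \<in> U" for y
    using x that unfolding alcove_iff by (metis subsetD)
  ultimately show "\<exists>T. open T \<and> x \<in> T \<and> T \<subseteq> alcove"
    by (intro exI[of _ U]) blast
qed

lemma has_derivative_aff_reflection: "(aff_reflection a has_derivative lin_reflection (fst a)) (at x)"
proof -
  have "((\<lambda>x. x - (blinfun_apply (fst a) x + snd a) *\<^sub>R coroot (fst a)) has_derivative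
      (\<lambda>v. v - blinfun_apply (fst a) v *\<^sub>R coroot (fst a))) (at x)"
    by (auto intro!: derivative_eq_intros)
  then show ?thesis
    by (simp add: aff_reflection_def[abs_def] lin_reflection_def[abs_def] aff_apply_def)
qed

section \<open>The function space and the Dunkl operators on it\<close>

lemma C_zero: "(\<lambda>x. 0) \<in> C"
  by (simp add: C_iff continuously_differentiable_on_const)

lemma C_add: "f \<in> C \<Longrightarrow> g \<in> C \<Longrightarrow> (\<lambda>x. f x + g x) \<in> C"
  by (simp add: C_iff continuously_differentiable_on_add open_Reg)

lemma C_scale: "f \<in> C \<Longrightarrow> (\<lambda>x. c * f x) \<in> C"
  by (simp add: C_iff continuously_differentiable_on_bounded_linear open_Reg bounded_linear_mult_right)

lemma C_reflection:
  assumes f: "f \<in> C" and a: "a \<in> Roots"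
  shows "(\<lambda>x. f (aff_reflection a x)) \<in> C"
  unfolding C_iff
proof (intro conjI allI impI)
  show "continuously_differentiable_on n Reg (\<lambda>x. f (aff_reflection a x))" for n
    using f a
    by (intro continuously_differentiable_on_compose_affine[OF open_Reg _ has_derivative_aff_reflection, where T = Reg])
      (simp_all add: reflection_Reg C_iff)
  show "f (aff_reflection a x) = 0" if "x \<notin> Reg" for x
    using f a that by (simp add: C_iff reflection_Reg)
qed

lemma C_fun_action: "w \<in> carrier Weyl \<Longrightarrow> f \<in> C \<Longrightarrow> fun_action w f \<in> C"
proof (induction rule: Weyl_induct)
  case (reflection a w)
  then have a: "a \<in> Roots"
    by (simp add: Simple_in_Roots)
  then have "fun_action (aff_reflection a \<circ> w) f = (\<lambda>x. fun_action w f (aff_reflection a x))"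
    using fun_action_comp[OF bij_aff_reflection Weyl_bij, of a w f] reflection(2)
    by (simp only: fun_action_reflection fst_nonzero simp_thms)
  with reflection a show ?case
    using C_reflection[of "fun_action w f" a] by metis
qed simp

lemma fun_action_mult:
  "u \<in> carrier Weyl \<Longrightarrow> w \<in> carrier Weyl \<Longrightarrow> fun_action (u \<circ> w) f = fun_action u (fun_action w f)"
  by (simp add: fun_action_comp Weyl_bij)

lemma C_has_derivative:
  "f \<in> C \<Longrightarrow> x \<in> Reg \<Longrightarrow> (f has_derivative frechet_derivative f (at x)) (at x)"
  using continuously_differentiable_on_SucD(1)[of 0 Reg f x]
  by (simp add: C_iff del: continuously_differentiable_on.simps)

lemma C_derivative: "f \<in> C \<Longrightarrow> continuously_differentiable_on n Reg (\<lambda>x. frechet_derivative f (at x) v)"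
  using continuously_differentiable_on_SucD(2)[of n Reg f v]
  by (simp add: C_iff del: continuously_differentiable_on.simps)

text \<open>The index set is a separate argument: near a regular point it can be frozen at
  \<open>negative_roots x\<close>, and the term of a single root can be split off.\<close>

definition reflection_sum :: "('v \<Rightarrow> complex) \<Rightarrow> 'v \<Rightarrow> 'v affine_functional set \<Rightarrow> 'v \<Rightarrow> complex" where
  "reflection_sum f v A x =
    (\<Sum>a\<in>A. complex_of_real (k a * blinfun_apply (fst a) v) * f (aff_reflection a x))"

lemma Dunkl_apply:
  assumes "f \<in> C"
  shows "Dunkl v f x = (if x \<in> Reg then frechet_derivative f (at x) v + reflection_sum f v (negative_roots x) x else 0)"
proof -
  have eq: "{a \<in> Pos. neg_indicator a x \<noteq> 0} = negative_roots x" for x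
    by (auto simp: negative_roots_def neg_indicator_def)
  have "(\<Sum>a\<in>negative_roots x. complex_of_real (k a * blinfun_apply (fst a) v) *
      neg_indicator a x * fun_action (aff_reflection a) f x) = reflection_sum f v (negative_roots x) x"
    unfolding reflection_sum_def
    by (intro sum.cong refl) (simp add: negative_roots_def neg_indicator_def Pos_subset_Roots fun_action_reflection)
  then show ?thesis
    using assms unfolding Dunkl_operator_def eq by simp
qed

text \<open>Near a regular point the set of negative roots is constant, so the operator is a fixed
  finite sum of smooth functions there.\<close>

lemma Dunkl_in:
  assumes f: "f \<in> C"
  shows "Dunkl v f \<in> C"
  unfolding C_iff
proof (intro conjI allI impI)
  fix n
  show "continuously_differentiable_on n Reg (Dunkl v f)"
  proof (rule continuously_differentiable_on_local)
    fix x
    assume "x \<in> Reg"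
    then obtain U where U: "open U" "x \<in> U" "U \<subseteq> Reg" "\<forall>y\<in>U. negative_roots y = negative_roots x"
      by (metis local_negative_roots)
    have sum: "continuously_differentiable_on n U (\<lambda>y. frechet_derivative f (at y) v + reflection_sum f v (negative_roots x) y)"
      unfolding reflection_sum_def
    proof (intro continuously_differentiable_on_add continuously_differentiable_on_sum \<open>open U\<close>
        continuously_differentiable_on_bounded_linear[OF _ bounded_linear_mult_right])
      show "continuously_differentiable_on n U (\<lambda>y. frechet_derivative f (at y) v)"
        using C_derivative[OF f] U(3) by (rule continuously_differentiable_on_subset)
      fix a
      assume "a \<in> negative_roots x"
      then have "(\<lambda>y. f (aff_reflection a y)) \<in> C"
        using f by (intro C_reflection) (auto simp: negative_roots_def Pos_subset_Roots)
      then show "continuously_differentiable_on n U (\<lambda>y. f (aff_reflection a y))"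
        using continuously_differentiable_on_subset[OF _ U(3)] C_iff by blast
    qed
    have eq: "frechet_derivative f (at y) v + reflection_sum f v (negative_roots x) y = Dunkl v f y"
      if "y \<in> U" for y
      using subsetD[OF U(3) that] U(4)[rule_format, OF that] by (simp only: Dunkl_apply[OF f] if_True)
    have "continuously_differentiable_on n U (Dunkl v f)"
      by (rule continuously_differentiable_on_cong[OF U(1) eq sum])
    with U show "\<exists>U. open U \<and> x \<in> U \<and> continuously_differentiable_on n U (Dunkl v f)"
      by blast
  qed
qed (simp add: Dunkl_apply f)

lemma frechet_add:
  assumes "f \<in> C" "g \<in> C" "x \<in> Reg"
  shows "frechet_derivative (\<lambda>x. f x + g x) (at x) v = frechet_derivative f (at x) v + frechet_derivative g (at x) v"
  using frechet_derivative_at[OF has_derivative_add[OF C_has_derivative C_has_derivative], of f x g] assms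
  by (simp add: fun_eq_iff)

lemma frechet_scale:
  assumes "f \<in> C" "x \<in> Reg"
  shows "frechet_derivative (\<lambda>x. c * f x) (at x) v = c * frechet_derivative f (at x) v"
  using frechet_derivative_at[OF has_derivative_mult_right[OF C_has_derivative], of f x c] assms
  by (simp add: fun_eq_iff)

lemma frechet_linear:
  assumes "f \<in> C" "x \<in> Reg"
  shows "frechet_derivative f (at x) (u + v) = frechet_derivative f (at x) u + frechet_derivative f (at x) v"
    and "frechet_derivative f (at x) (r *\<^sub>R v) = of_real r * frechet_derivative f (at x) v"
  using has_derivative_linear[OF C_has_derivative[OF assms]]
  by (simp_all add: linear_add linear_scale scaleR_conv_of_real)

lemma Dunkl_add: "f \<in> C \<Longrightarrow> g \<in> C \<Longrightarrow> Dunkl v (\<lambda>x. f x + g x) = (\<lambda>x. Dunkl v f x + Dunkl v g x)"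
  by (rule ext) (simp add: Dunkl_apply C_add frechet_add reflection_sum_def distrib_left sum.distrib)

lemma Dunkl_scale: "f \<in> C \<Longrightarrow> Dunkl v (\<lambda>x. c * f x) = (\<lambda>x. c * Dunkl v f x)"
  by (rule ext) (simp add: Dunkl_apply C_scale frechet_scale reflection_sum_def distrib_left sum_distrib_left
      mult.left_commute)

lemma Dunkl_add_vec: "f \<in> C \<Longrightarrow> Dunkl (u + v) f = (\<lambda>x. Dunkl u f x + Dunkl v f x)"
  by (rule ext) (simp add: Dunkl_apply frechet_linear reflection_sum_def blinfun.add_right distrib_left distrib_right sum.distrib)

lemma Dunkl_scaleR_vec: "f \<in> C \<Longrightarrow> Dunkl (r *\<^sub>R v) f = (\<lambda>x. of_real r * Dunkl v f x)"
  by (rule ext) (simp add: Dunkl_apply frechet_linear reflection_sum_def blinfun.scaleR_right distrib_left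
      sum_distrib_left mult_ac)

lemma multiplicity_reflection:
  assumes "a \<in> Roots" "b \<in> Roots"
  shows "k (root_reflection a b) = k b"
proof -
  have "aff_apply (root_reflection a b) = fun_action (aff_reflection a) (aff_apply b)"
    using assms by (simp add: fun_action_reflection aff_apply_root_reflection fun_eq_iff)
  then show ?thesis
    using multiplicity assms root_reflection_in Weyl_reflection unfolding multiplicity_function_def by blast
qed

lemma reflection_sum_remove:
  "finite A \<Longrightarrow> reflection_sum f v A x = reflection_sum f v (A - {a}) x +
    (if a \<in> A then complex_of_real (k a * blinfun_apply (fst a) v) * f (aff_reflection a x) else 0)"
  by (simp add: reflection_sum_def sum.remove[of A a])

text \<open>
  Reindexing by the permutation of the positive roots other than \<open>a\<close> matches all terms but the one at \<open>a\<close>.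
\<close>

lemma Dunkl_reflection:
  assumes f: "f \<in> C" and a: "a \<in> Simple"
  shows "Dunkl v f (aff_reflection a x) =
    Dunkl (lin_reflection (fst a) v) (\<lambda>y. f (aff_reflection a y)) x +
    complex_of_real (k a * blinfun_apply (fst a) v) * f x"
proof (cases "x \<in> Reg")
  case False
  have "aff_reflection a x \<notin> Reg"
    using False a by (simp add: reflection_Reg Simple_in_Roots)
  then show ?thesis
    using False f a by (simp add: Dunkl_apply C_reflection Simple_in_Roots) (simp add: C_iff)
next
  case True
  let ?s = "aff_reflection a" and ?l = "lin_reflection (fst a)" and ?f = "\<lambda>y. f (aff_reflection a y)"
  let ?N = "negative_roots x" and ?M = "negative_roots (?s x)"
  have ar: "a \<in> Roots" "a \<in> Pos" and fa: "fst a \<noteq> 0"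
    using a by (simp_all add: Simple_in_Roots Simple_subset_Pos)
  have sx: "?s x \<in> Reg"
    using True ar by (simp add: reflection_Reg)
  have fC: "?f \<in> C"
    using f ar by (simp add: C_reflection)
  have "(?f has_derivative (\<lambda>v. frechet_derivative f (at (?s x)) (?l v))) (at x)"
    by (rule has_derivative_compose[OF has_derivative_aff_reflection C_has_derivative[OF f sx]])
  then have "frechet_derivative ?f (at x) (?l v) = frechet_derivative f (at (?s x)) v"
    using fa by (simp add: frechet_derivative_at[symmetric] lin_reflection_involution)
  moreover have "reflection_sum f v (?M - {a}) (?s x) = reflection_sum ?f (?l v) (?N - {a}) x"
  proof -
    have "inj_on (root_reflection a) (?N - {a})"
      using fa by (metis inj_on_inverseI root_reflection_involution)
    then have "reflection_sum f v (?M - {a}) (?s x) = (\<Sum>b\<in>?N - {a}.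
        complex_of_real (k (root_reflection a b) * blinfun_apply (fst (root_reflection a b)) v) *
        f (aff_reflection (root_reflection a b) (?s x)))"
      unfolding reflection_sum_def negative_roots_reflection[OF a] by (simp add: sum.reindex)
    also have "\<dots> = reflection_sum ?f (?l v) (?N - {a}) x"
      unfolding reflection_sum_def
    proof (intro sum.cong refl)
      fix b
      assume "b \<in> ?N - {a}"
      then have "b \<in> Roots"
        by (simp add: negative_roots_def Pos_subset_Roots)
      then show "complex_of_real (k (root_reflection a b) * blinfun_apply (fst (root_reflection a b)) v) *
          f (aff_reflection (root_reflection a b) (?s x)) =
          complex_of_real (k b * blinfun_apply (fst b) (?l v)) * f (?s (aff_reflection b x))"
        using ar fa by (simp add: multiplicity_reflection fst_root_reflection_apply aff_reflection_root_reflection)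
    qed
    finally show ?thesis .
  qed
  \<comment> \<open>The root \<open>a\<close> contributes on exactly one side. Its gradient changes
    sign under its own reflection, so both cases leave the same term
    \<open>k a * blinfun_apply (fst a) v\<close> times \<open>f x\<close>.\<close>
  moreover have "a \<in> ?M \<longleftrightarrow> a \<notin> ?N"
    using ar fa True Reg_iff[of x] by (auto simp: negative_roots_def aff_apply_reflection_self)
  moreover have "blinfun_apply (fst a) (?l v) = - blinfun_apply (fst a) v"
    using fa by (simp add: lin_reflection_def blinfun.diff_right blinfun.scaleR_right)
  ultimately show ?thesis
    using True sx f fC fa finite_negative_roots reflection_sum_remove[of ?M f v "?s x" a]
      reflection_sum_remove[of ?N ?f "?l v" x a]
    by (simp add: Dunkl_apply)
qed

section \<open>Commutativity of the Dunkl operators\<close>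

lemma lin_reflection_eq: "lin_reflection \<alpha> v = v + (- blinfun_apply \<alpha> v) *\<^sub>R coroot \<alpha>"
  by (simp add: lin_reflection_def)

definition Dunkl_commutator :: "'v \<Rightarrow> 'v \<Rightarrow> ('v \<Rightarrow> complex) \<Rightarrow> 'v \<Rightarrow> complex" where
  "Dunkl_commutator u v f x = Dunkl u (Dunkl v f) x - Dunkl v (Dunkl u f) x"

text \<open>Applying the cross relation twice leaves
  \<open>?c v * Dunkl (?l u) f + ?c u * Dunkl v f\<close> as error. Expanding \<open>?l u\<close>
  turns the first term into \<open>?c v * Dunkl u f\<close> minus a multiple of
  \<open>Dunkl (coroot (fst a)) f\<close> whose coefficient is symmetric in \<open>u\<close> and
  \<open>v\<close>. The whole error is thus symmetric and drops out.\<close>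

lemma Dunkl_commutator_reflection:
  assumes f: "f \<in> C" and a: "a \<in> Simple"
  shows "Dunkl_commutator u v f (aff_reflection a x) =
    Dunkl_commutator (lin_reflection (fst a) u) (lin_reflection (fst a) v) (\<lambda>y. f (aff_reflection a y)) x"
proof -
  let ?s = "aff_reflection a" and ?l = "lin_reflection (fst a)" and ?f = "\<lambda>y. f (aff_reflection a y)"
  let ?c = "\<lambda>u. complex_of_real (k a * blinfun_apply (fst a) u)"
  have fC: "?f \<in> C"
    using f a by (simp add: C_reflection Simple_in_Roots)
  have *: "Dunkl u (Dunkl v f) (?s x) = Dunkl (?l u) (Dunkl (?l v) ?f) x + ?c v * Dunkl (?l u) f x + ?c u * Dunkl v f x" for u v
  proof -
    have "(\<lambda>y. Dunkl v f (?s y)) = (\<lambda>y. Dunkl (?l v) ?f y + ?c v * f y)"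
      using Dunkl_reflection[OF f a] by blast
    then have "Dunkl u (Dunkl v f) (?s x) = Dunkl (?l u) (\<lambda>y. Dunkl (?l v) ?f y + ?c v * f y) x + ?c u * Dunkl v f x"
      using Dunkl_reflection[OF Dunkl_in[OF f] a, of u v x] by simp
    then show ?thesis
      using f fC by (simp add: Dunkl_add Dunkl_in C_scale Dunkl_scale del: of_real_mult)
  qed
  have l: "Dunkl (?l u) f x = Dunkl u f x - of_real (blinfun_apply (fst a) u) * Dunkl (coroot (fst a)) f x" for u
    unfolding lin_reflection_eq Dunkl_add_vec[OF f] Dunkl_scaleR_vec[OF f] by simp
  show ?thesis
    unfolding Dunkl_commutator_def * l by (simp add: algebra_simps)
qed

text \<open>On the alcove the Dunkl operators are directional derivatives; the Weyl group carries this to all of the regular set.\<close>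

lemma Dunkl_alcove: "f \<in> C \<Longrightarrow> x \<in> alcove \<Longrightarrow> Dunkl v f x = frechet_derivative f (at x) v"
  by (simp add: Dunkl_apply alcove_iff reflection_sum_def)

lemma Dunkl_commutator_eq_0:
  assumes f: "f \<in> C"
  shows "Dunkl_commutator u v f x = 0"
proof (cases "x \<in> Reg")
  case True
  then obtain w y where w: "w \<in> carrier Weyl" and y: "y \<in> alcove" and x: "x = w y"
    using Reg_translate by blast
  show ?thesis
    using w f unfolding x
  \<comment> \<open>Stripping a reflection from \<open>w\<close> replaces the function and both
    vectors by their reflected versions, hence the generalization.\<close>
  proof (induction arbitrary: f u v rule: Weyl_induct)
    case id
    \<comment> \<open>The alcove is open, so the outer derivative sees the inner operator only where
      it is a directional derivative.\<close>
    have "Dunkl u (Dunkl v f) y = frechet_derivative (\<lambda>z. frechet_derivative f (at z) v) (at y) u" for u v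
    proof -
      have "Dunkl v f differentiable at y"
        using C_has_derivative[OF Dunkl_in[OF id]] y alcove_iff differentiable_def by blast
      then have "frechet_derivative (Dunkl v f) (at y) = frechet_derivative (\<lambda>z. frechet_derivative f (at z) v) (at y)"
        using frechet_derivative_transform_within_open[OF _ open_alcove y,
            of "Dunkl v f" "\<lambda>z. frechet_derivative f (at z) v"] Dunkl_alcove[OF id] by simp
      then show ?thesis
        using Dunkl_alcove[OF Dunkl_in[OF id] y] by simp
    qed
    moreover have "continuously_differentiable_on n Reg f" for n
      using id C_iff by blast
    ultimately show ?case
      using mixed_derivatives[OF open_Reg, of y f u v] y by (simp add: Dunkl_commutator_def alcove_iff)
  next
    case (reflection a w)
    then show ?case
      using C_reflection[of f a] by (simp add: Dunkl_commutator_reflection Simple_in_Roots)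
  qed
qed (simp add: Dunkl_commutator_def Dunkl_apply Dunkl_in f)

sublocale commuting_operators C Dunkl
proof
  show "Dunkl u (Dunkl v f) = Dunkl v (Dunkl u f)" if "f \<in> C" for u v f
    using Dunkl_commutator_eq_0[OF that, of u v] by (simp add: Dunkl_commutator_def fun_eq_iff)
qed (simp_all add: C_zero C_add C_scale Dunkl_in Dunkl_add Dunkl_scale Dunkl_add_vec Dunkl_scaleR_vec)

section \<open>The operators attached to tensors\<close>

abbreviation "Tensors \<equiv> (tensor_carrier Weyl :: (('v \<Rightarrow> 'v) \<Rightarrow>\<^sub>0 'v sym_algebra) set)"

lemma Tensors_iff: "h \<in> Tensors \<longleftrightarrow> Poly_Mapping.keys h \<subseteq> carrier Weyl"
  by (simp add: tensor_carrier_def)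

lemma Tensors_0: "0 \<in> Tensors"
  and Tensors_single: "w \<in> carrier Weyl \<Longrightarrow> Poly_Mapping.single w p \<in> Tensors"
  and Tensors_add: "h \<in> Tensors \<Longrightarrow> h' \<in> Tensors \<Longrightarrow> h + h' \<in> Tensors"
  and Tensors_scale: "h \<in> Tensors \<Longrightarrow> tensor_scale c h \<in> Tensors"
  and Tensors_uminus: "h \<in> Tensors \<Longrightarrow> - h \<in> Tensors"
  using keys_add[of h h']
  by (auto simp: Tensors_iff in_keys_iff lookup_tensor_scale subset_iff) (metis sym_scale_zero_right)

lemma Tensors_induct [consumes 1, case_names zero single add]:
  assumes "h \<in> Tensors" and "P 0" and "\<And>w p. w \<in> carrier Weyl \<Longrightarrow> P (Poly_Mapping.single w p)"
    and add: "\<And>h h'. h \<in> Tensors \<Longrightarrow> h' \<in> Tensors \<Longrightarrow> P h \<Longrightarrow> P h' \<Longrightarrow> P (h + h')"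
  shows "P h"
proof -
  have "(\<Sum>w\<in>F. Poly_Mapping.single w (Poly_Mapping.lookup h w)) \<in> Tensors \<and>
      P (\<Sum>w\<in>F. Poly_Mapping.single w (Poly_Mapping.lookup h w))"
    if "finite F" "F \<subseteq> carrier Weyl" for F
    using that by induction (simp_all add: assms Tensors_0 Tensors_add Tensors_single)
  moreover have "(\<Sum>w\<in>Poly_Mapping.keys h. Poly_Mapping.single w (Poly_Mapping.lookup h w)) = h"
    by (rule poly_mapping_eqI) (simp add: lookup_sum lookup_single when_def in_keys_iff)
  ultimately show ?thesis
    using assms(1) by (metis Tensors_iff finite_keys)
qed

definition tensor_op :: "(('v \<Rightarrow> 'v) \<Rightarrow>\<^sub>0 'v sym_algebra) \<Rightarrow> ('v \<Rightarrow> complex) \<Rightarrow> 'v \<Rightarrow> complex" where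
  "tensor_op h f = (\<lambda>x. \<Sum>w\<in>Poly_Mapping.keys h. sym_op (Poly_Mapping.lookup h w) (fun_action w f) x)"

lemma tensor_op_superset:
  assumes "f \<in> C" "finite K" "Poly_Mapping.keys h \<subseteq> K" "K \<subseteq> carrier Weyl"
  shows "tensor_op h f = (\<lambda>x. \<Sum>w\<in>K. sym_op (Poly_Mapping.lookup h w) (fun_action w f) x)"
  unfolding tensor_op_def using assms
  by (intro ext sum.mono_neutral_left) (auto simp: in_keys_iff C_fun_action subset_iff)

lemma tensor_op_0 [simp]: "tensor_op 0 f = (\<lambda>x. 0)"
  by (simp add: tensor_op_def)

lemma tensor_op_single:
  "f \<in> C \<Longrightarrow> w \<in> carrier Weyl \<Longrightarrow> tensor_op (Poly_Mapping.single w p) f = sym_op p (fun_action w f)"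
  by (subst tensor_op_superset[of _ "{w}"]) auto

lemma tensor_op_add:
  assumes "f \<in> C" "h \<in> Tensors" "h' \<in> Tensors"
  shows "tensor_op (h + h') f = (\<lambda>x. tensor_op h f x + tensor_op h' f x)"
proof -
  let ?K = "Poly_Mapping.keys h \<union> Poly_Mapping.keys h'"
  have K: "?K \<subseteq> carrier Weyl"
    using assms by (simp add: Tensors_iff)
  have *: "tensor_op g f = (\<lambda>x. \<Sum>w\<in>?K. sym_op (Poly_Mapping.lookup g w) (fun_action w f) x)"
    if "Poly_Mapping.keys g \<subseteq> ?K" for g
    using tensor_op_superset[OF assms(1) _ that K] by simp
  have "fun_action w f \<in> C" if "w \<in> ?K" for w
    using that K assms C_fun_action by blast
  then have "tensor_op (h + h') f x = tensor_op h f x + tensor_op h' f x" for x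
    using keys_add[of h h'] by (simp add: *[of h] *[of h'] *[of "h + h'"] lookup_add sym_op_add sum.distrib)
  then show ?thesis
    by blast
qed

lemma tensor_op_scale:
  assumes "f \<in> C" "h \<in> Tensors"
  shows "tensor_op (tensor_scale c h) f = (\<lambda>x. c * tensor_op h f x)"
proof -
  have K: "Poly_Mapping.keys h \<subseteq> carrier Weyl" "Poly_Mapping.keys (tensor_scale c h) \<subseteq> Poly_Mapping.keys h"
    using assms by (auto simp: Tensors_iff in_keys_iff lookup_tensor_scale)
  have "fun_action w f \<in> C" if "w \<in> Poly_Mapping.keys h" for w
    using that K assms C_fun_action by blast
  then show ?thesis
    using tensor_op_superset[OF assms(1) finite_keys K(2,1)]
    by (simp add: tensor_op_def lookup_tensor_scale sym_op_scale sum_distrib_left)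
qed

lemma tensor_op_in: "f \<in> C \<Longrightarrow> h \<in> Tensors \<Longrightarrow> tensor_op h f \<in> C"
  unfolding tensor_op_def by (intro sum_in sym_op_in C_fun_action) (auto simp: Tensors_iff)

lemma fun_action_linear:
  "fun_action w (\<lambda>x. f x + g x) = (\<lambda>x. fun_action w f x + fun_action w g x)"
  "fun_action w (\<lambda>x. c * f x) = (\<lambda>x. c * fun_action w f x)"
  by (simp_all add: fun_action_def)

lemma tensor_op_linear:
  assumes "f \<in> C" "g \<in> C" "h \<in> Tensors"
  shows "tensor_op h (\<lambda>x. f x + g x) = (\<lambda>x. tensor_op h f x + tensor_op h g x)"
    and "tensor_op h (\<lambda>x. c * f x) = (\<lambda>x. c * tensor_op h f x)"
proof -
  have "fun_action w f \<in> C" "fun_action w g \<in> C" if "w \<in> Poly_Mapping.keys h" for w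
    using that assms C_fun_action by (auto simp: Tensors_iff)
  then show "tensor_op h (\<lambda>x. f x + g x) = (\<lambda>x. tensor_op h f x + tensor_op h g x)"
    and "tensor_op h (\<lambda>x. c * f x) = (\<lambda>x. c * tensor_op h f x)"
    by (simp_all add: tensor_op_def fun_action_linear sym_op_linear(1) sym_op_linear(2)[of _ "\<lambda>x. 0"] zero_in
        sum.distrib sum_distrib_left)
qed

lemma Dunkl_cross:
  assumes "f \<in> C" "a \<in> Simple"
  shows "fun_action (aff_reflection a) (Dunkl v f) =
    (\<lambda>x. Dunkl (lin_reflection (fst a) v) (fun_action (aff_reflection a) f) x +
      complex_of_real (k a * blinfun_apply (fst a) v) * f x)"
  using Dunkl_reflection[OF assms] assms by (simp add: fun_action_reflection Simple_in_Roots)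

subsection \<open>Products of such operators\<close>

text \<open>Existence of a representing tensor is enough here: the closure proofs never compute one
  for a general product, and \<open>tensor_op_faithful\<close> gives its uniqueness.\<close>

definition realized :: "(('v \<Rightarrow> complex) \<Rightarrow> 'v \<Rightarrow> complex) \<Rightarrow> bool" where
  "realized F \<longleftrightarrow> (\<exists>h\<in>Tensors. \<forall>f\<in>C. F f = tensor_op h f)"

lemma realizedI: "h \<in> Tensors \<Longrightarrow> (\<And>f. f \<in> C \<Longrightarrow> F f = tensor_op h f) \<Longrightarrow> realized F"
  unfolding realized_def by blast

lemma realized_cong: "realized F \<Longrightarrow> (\<And>f. f \<in> C \<Longrightarrow> G f = F f) \<Longrightarrow> realized G"
  unfolding realized_def by simp

lemma realized_0: "realized (\<lambda>f x. 0)"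
  by (rule realizedI[OF Tensors_0]) simp

lemma realized_add:
  assumes "realized F" "realized G"
  shows "realized (\<lambda>f x. F f x + G f x)"
proof -
  obtain h h' where "h \<in> Tensors" "h' \<in> Tensors" "\<forall>f\<in>C. F f = tensor_op h f" "\<forall>f\<in>C. G f = tensor_op h' f"
    using assms unfolding realized_def by blast
  then show ?thesis
    by (intro realizedI[of "h + h'"]) (simp_all add: Tensors_add tensor_op_add)
qed

lemma realized_scale:
  assumes "realized F"
  shows "realized (\<lambda>f x. c * F f x)"
proof -
  obtain h where "h \<in> Tensors" "\<forall>f\<in>C. F f = tensor_op h f"
    using assms unfolding realized_def by blast
  then show ?thesis
    by (intro realizedI[of "tensor_scale c h"]) (simp_all add: Tensors_scale tensor_op_scale)
qed

lemma realized_sym_op: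
  assumes "realized F"
  shows "realized (\<lambda>f. sym_op p (F f))"
proof -
  obtain h where h: "h \<in> Tensors" and F: "\<forall>f\<in>C. F f = tensor_op h f"
    using assms unfolding realized_def by blast
  from h have "realized (\<lambda>f. sym_op p (tensor_op h f))"
  proof (induction rule: Tensors_induct)
    case zero
    then show ?case
      using sym_op_linear(2)[OF zero_in zero_in, of p 0] realized_0 by simp
  next
    case (single w q)
    then show ?case
      by (intro realizedI[of "Poly_Mapping.single w (p * q)"])
        (simp_all add: Tensors_single tensor_op_single sym_op_mult C_fun_action)
  next
    case (add h h')
    then show ?case
      by (intro realized_cong[OF realized_add[OF add(3,4)]])
        (simp add: tensor_op_add sym_op_linear tensor_op_in)
  qed
  then show ?thesis
    by (rule realized_cong) (simp add: F)
qed

lemma realized_fun_action_right: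
  assumes "realized F" and w: "w \<in> carrier Weyl"
  shows "realized (\<lambda>f. F (fun_action w f))"
proof -
  obtain h where h: "h \<in> Tensors" and F: "\<forall>f\<in>C. F f = tensor_op h f"
    using assms unfolding realized_def by blast
  from h have "realized (\<lambda>f. tensor_op h (fun_action w f))"
  proof (induction rule: Tensors_induct)
    case zero
    then show ?case
      using realized_0 by simp
  next
    case (single u q)
    then show ?case
      using w by (intro realizedI[of "Poly_Mapping.single (u \<circ> w) q"])
        (simp_all only: Tensors_single tensor_op_single Weyl_comp fun_action_mult C_fun_action)
  next
    case (add h h')
    then show ?case
      using w by (intro realized_cong[OF realized_add[OF add(3,4)]])
        (simp add: tensor_op_add C_fun_action)
  qed
  then show ?thesis
    by (rule realized_cong) (simp add: F C_fun_action w)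
qed

lemma realized_single: "w \<in> carrier Weyl \<Longrightarrow> realized (\<lambda>f. sym_op p (fun_action w f))"
  by (rule realizedI[of "Poly_Mapping.single w p"]) (simp_all add: tensor_op_single Tensors_single)

text \<open>The cross relation moves the reflection past the leftmost vector. What remains is the
  reflection in front of the shorter product, and a multiple of the shorter product itself.\<close>

lemma realized_reflection_sym_op:
  assumes a: "a \<in> Simple"
  shows "realized (\<lambda>f. fun_action (aff_reflection a) (sym_op p f))"
proof (induction p rule: sym_algebra_induct)
  case one
  have s: "aff_reflection a \<in> carrier Weyl"
    using a by (simp add: Weyl_reflection Simple_in_Roots)
  show ?case
    by (rule realized_cong[OF realized_single[OF s, of 1]]) (simp add: C_fun_action s)
next
  case (add p q)
  then show ?case
    by (intro realized_cong[OF realized_add[OF add]]) (simp add: sym_op_add fun_action_linear)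
next
  case (scale c p)
  then show ?case
    by (intro realized_cong[OF realized_scale[OF scale, of c]]) (simp add: sym_op_scale fun_action_linear)
next
  case (embed v p)
  have s: "aff_reflection a \<in> carrier Weyl"
    using a by (simp add: Weyl_reflection Simple_in_Roots)
  show ?case
    \<comment> \<open>The first summand is the induction hypothesis followed by the reflected
      vector, the second the correction term of the cross relation.\<close>
    by (rule realized_cong[OF realized_add[OF realized_sym_op[OF embed, of "sym_embed (lin_reflection (fst a) v)"]
          realized_scale[OF realized_single[OF Weyl_id, of p], of "complex_of_real (k a * blinfun_apply (fst a) v)"]]])
      (simp add: sym_op_mult sym_op_embed sym_op_in C_fun_action[OF s] Dunkl_cross[OF _ a])
qed

text \<open>The group element is built from simple reflections. Each is moved past the coefficients
  by the preceding lemma, and the group elements already present are absorbed on the right.\<close>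

lemma realized_fun_action:
  assumes "w \<in> carrier Weyl" "realized F"
  shows "realized (\<lambda>f. fun_action w (F f))"
  using assms
proof (induction arbitrary: F rule: Weyl_induct)
  case id
  then show ?case
    by (simp only: fun_action_id)
next
  case (reflection a w)
  let ?s = "aff_reflection a"
  have s: "?s \<in> carrier Weyl"
    using reflection(1) by (simp add: Weyl_reflection Simple_in_Roots)
  have step: "realized (\<lambda>f. fun_action ?s (G f))" if "realized G" for G
  proof -
    obtain h where h: "h \<in> Tensors" and G: "\<forall>f\<in>C. G f = tensor_op h f"
      using \<open>realized G\<close> unfolding realized_def by blast
    from h have "realized (\<lambda>f. fun_action ?s (tensor_op h f))"
    proof (induction rule: Tensors_induct)
      case zero
      then show ?case
        using realized_0 by (simp add: fun_action_def)
    next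
      case (single u q)
      show ?case
        by (rule realized_cong[OF realized_fun_action_right[OF realized_reflection_sym_op[OF reflection(1)] single]])
          (simp add: tensor_op_single single)
    next
      case (add h h')
      then show ?case
        by (intro realized_cong[OF realized_add[OF add(3,4)]]) (simp add: tensor_op_add fun_action_linear)
    qed
    then show ?thesis
      by (rule realized_cong) (simp add: G)
  qed
  show ?case
    unfolding fun_action_mult[OF s reflection(2)] by (intro step reflection)
qed

lemma realized_tensor_op:
  assumes "h \<in> Tensors" "realized F" "\<And>f. f \<in> C \<Longrightarrow> F f \<in> C"
  shows "realized (\<lambda>f. tensor_op h (F f))"
  using assms(1)
proof (induction rule: Tensors_induct)
  case zero
  then show ?case
    using realized_0 by simp
next
  case (single w p)
  show ?case
    by (rule realized_cong[OF realized_sym_op[OF realized_fun_action[OF single assms(2)]]])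
      (simp add: tensor_op_single single assms(3))
next
  case (add h h')
  then show ?case
    by (intro realized_cong[OF realized_add[OF add(3,4)]]) (simp add: tensor_op_add assms(3))
qed

subsection \<open>Faithfulness\<close>

text \<open>No reflection term is present on the alcove and the derivative is local, so the
  operators do not see values outside.\<close>

lemma Dunkl_alcove_cong:
  assumes "f \<in> C" "g \<in> C" "\<And>y. y \<in> alcove \<Longrightarrow> f y = g y" "y \<in> alcove"
  shows "Dunkl v f y = Dunkl v g y"
proof -
  have "f differentiable at y"
    using C_has_derivative[OF assms(1)] assms(4) alcove_subset_Reg differentiable_def by blast
  then show ?thesis
    using frechet_derivative_transform_within_open[OF _ open_alcove assms(4), of f g] assms
    by (simp add: Dunkl_alcove)
qed

lemma sym_op_alcove_eq_0:
  assumes "f \<in> C" "\<And>y. y \<in> alcove \<Longrightarrow> f y = 0" "y \<in> alcove"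
  shows "sym_op p f y = 0"
  using assms(3)
proof (induction p arbitrary: y rule: sym_algebra_induct)
  case (embed v p)
  have "Dunkl v (sym_op p f) y = Dunkl v (\<lambda>x. 0) y"
    using embed assms(1) by (intro Dunkl_alcove_cong sym_op_in zero_in) auto
  also have "\<dots> = 0"
    using Dunkl_scale[OF zero_in, of v 0] by (simp add: fun_eq_iff)
  finally show ?case
    using assms(1) by (simp add: sym_op_mult sym_op_embed sym_op_in)
qed (use assms(1,2) in \<open>simp_all add: sym_op_add sym_op_scale\<close>)

text \<open>The exponential on the alcove is a joint eigenfunction of the Dunkl operators there.\<close>

definition alcove_exp :: "('v \<Rightarrow> complex) \<Rightarrow> 'v \<Rightarrow> complex" where
  "alcove_exp L x = (if x \<in> alcove then exp (L x) else 0)"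

text \<open>Around a regular point the set of negative roots is constant, so a neighbourhood lies
  either inside or outside the alcove. The cutoff is therefore locally constant on the regular
  set.\<close>

lemma alcove_exp_in:
  assumes L: "bounded_linear L"
  shows "alcove_exp L \<in> C"
  unfolding C_iff
proof (intro conjI allI impI)
  show "alcove_exp L x = 0" if "x \<notin> Reg" for x
    using that alcove_subset_Reg by (auto simp: alcove_exp_def)
  show "continuously_differentiable_on n Reg (alcove_exp L)" for n
  proof (rule continuously_differentiable_on_local)
    fix x
    assume x: "x \<in> Reg"
    then obtain U where U: "open U" "x \<in> U" "U \<subseteq> Reg" "\<forall>y\<in>U. negative_roots y = negative_roots x"
      by (metis local_negative_roots)
    have "alcove_exp L y = (if x \<in> alcove then 1 else 0) * exp (L y)" if "y \<in> U" for y
      using subsetD[OF U(3) that] U(4)[rule_format, OF that] x by (simp add: alcove_exp_def alcove_iff)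
    then have "continuously_differentiable_on n U (alcove_exp L)"
      by (intro continuously_differentiable_on_cong[OF U(1) _ continuously_differentiable_on_exp[OF U(1) L]]) simp
    with U show "\<exists>U. open U \<and> x \<in> U \<and> continuously_differentiable_on n U (alcove_exp L)"
      by blast
  qed
qed

lemma Dunkl_alcove_exp:
  assumes L: "bounded_linear L" and y: "y \<in> alcove"
  shows "Dunkl v (alcove_exp L) y = L v * alcove_exp L y"
proof -
  have "((\<lambda>x. 1 * exp (L x)) has_derivative (\<lambda>v. 1 * L v * exp (L y))) (at y)"
    by (rule has_derivative_exp_linear[OF L])
  then have "(alcove_exp L has_derivative (\<lambda>v. L v * exp (L y))) (at y)"
    using has_derivative_transform_within_open[OF _ open_alcove y, of "\<lambda>x. exp (L x)"]
    by (simp add: alcove_exp_def)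
  from frechet_derivative_at[OF this] show ?thesis
    using y by (simp add: Dunkl_alcove alcove_exp_in[OF L] alcove_exp_def fun_eq_iff)
qed

lemma monomial_op_alcove_exp:
  assumes L: "bounded_linear L" and B: "finite B" "Poly_Mapping.keys m \<subseteq> B" and "y \<in> alcove"
  shows "monomial_op m (alcove_exp L) y = (\<Prod>b\<in>B. L b ^ Poly_Mapping.lookup m b) * alcove_exp L y"
  using B(2) assms(4)
proof (induction m arbitrary: y rule: exponent_induct)
  case (add_single v m)
  have "Poly_Mapping.keys (Poly_Mapping.single v 1 + m) = insert v (Poly_Mapping.keys m)"
    by (auto simp: in_keys_iff lookup_add lookup_single when_def split: if_splits)
  with add_single.prems(1) have v: "v \<in> B" "Poly_Mapping.keys m \<subseteq> B"
    by auto
  let ?c = "\<Prod>b\<in>B. L b ^ Poly_Mapping.lookup m b"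
  have E: "alcove_exp L \<in> C"
    by (rule alcove_exp_in[OF L])
  have "monomial_op (Poly_Mapping.single v 1 + m) (alcove_exp L) y = Dunkl v (monomial_op m (alcove_exp L)) y"
    using E by (simp add: monomial_op_add monomial_op_single monomial_op_in del: One_nat_def)
  also have "\<dots> = Dunkl v (\<lambda>x. ?c * alcove_exp L x) y"
    using E v add_single by (intro Dunkl_alcove_cong monomial_op_in scale_in) auto
  also have "\<dots> = ?c * L v * alcove_exp L y"
    using E add_single.prems(2) by (simp add: Dunkl_scale Dunkl_alcove_exp[OF L])
  also have "?c * L v = (\<Prod>b\<in>B. L b ^ Poly_Mapping.lookup (Poly_Mapping.single v 1 + m) b)"
  proof -
    have "(\<Prod>b\<in>B. L b ^ Poly_Mapping.lookup (Poly_Mapping.single v 1) b) = (\<Prod>b\<in>B. if b = v then L v else 1)"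
      by (intro prod.cong) (auto simp: lookup_single when_def)
    then show ?thesis
      using v(1) B(1) by (simp add: lookup_add power_add prod.distrib mult.commute del: One_nat_def)
  qed
  finally show ?case .
qed simp

text \<open>On the alcove \<open>p\<close> multiplies the exponential of \<open>L\<close> by the
  value of its polynomial at the numbers \<open>L b\<close>. These numbers are arbitrary and the
  exponential is nonzero, so the polynomial vanishes identically.\<close>

lemma sym_op_alcove_exp_eq_0:
  assumes "\<And>L y. bounded_linear L \<Longrightarrow> y \<in> alcove \<Longrightarrow> sym_op p (alcove_exp L) y = 0"
  shows "p = 0"
proof -
  obtain Q where Q: "p = abs_sym_algebra Q" "\<forall>m\<in>Poly_Mapping.keys Q. Poly_Mapping.keys m \<subseteq> Basis"
    using sym_algebra_basis_representation by blast
  have "Poly_Mapping.lookup Q m = 0" if "m \<in> Poly_Mapping.keys Q" for m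
  proof (rule polynomial_coeffs_eq_0[where B = Basis and K = "Poly_Mapping.keys Q" and m = m])
    show "inj_on (\<lambda>m. restrict (Poly_Mapping.lookup m) Basis) (Poly_Mapping.keys Q)"
    proof (rule inj_onI, rule poly_mapping_eqI)
      fix m n :: "'v \<Rightarrow>\<^sub>0 nat" and b
      assume mn: "m \<in> Poly_Mapping.keys Q" "n \<in> Poly_Mapping.keys Q"
        and eq: "restrict (Poly_Mapping.lookup m) Basis = restrict (Poly_Mapping.lookup n) Basis"
      show "Poly_Mapping.lookup m b = Poly_Mapping.lookup n b"
      proof (cases "b \<in> Basis")
        case True
        then show ?thesis
          using fun_cong[OF eq, of b] by simp
      next
        case False
        with Q(2) mn have "b \<notin> Poly_Mapping.keys m" "b \<notin> Poly_Mapping.keys n"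
          by blast+
        then show ?thesis
          by (simp add: in_keys_iff)
      qed
    qed
    fix t :: "'v \<Rightarrow> complex"
    \<comment> \<open>The real-linear form with prescribed complex values \<open>t b\<close> on the
      basis.\<close>
    define L where "L = (\<lambda>x. \<Sum>b\<in>Basis. of_real (x \<bullet> b) * t b)"
    have L: "bounded_linear L"
      unfolding L_def
      by (intro bounded_linear_sum bounded_linear_mult_const bounded_linear_compose[OF bounded_linear_of_real]
          bounded_linear_inner_left)
    have Lb: "L b = t b" if "b \<in> Basis" for b
      using that by (simp add: L_def inner_Basis if_distrib[of of_real] if_distrib[of "\<lambda>z. z * _"] cong: if_cong)
    have "0 = poly_op Q (alcove_exp L) base_point"
      using assms[OF L base_point_in_alcove] sym_op_abs[OF alcove_exp_in[OF L]] Q(1) by simp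
    also have "\<dots> = (\<Sum>m\<in>Poly_Mapping.keys Q. Poly_Mapping.lookup Q m *
        (\<Prod>b\<in>Basis. L b ^ Poly_Mapping.lookup m b) * alcove_exp L base_point)"
      unfolding poly_op_def using Q(2)
      by (intro sum.cong refl) (simp add: monomial_op_alcove_exp[OF L finite_Basis _ base_point_in_alcove])
    also have "\<dots> = (\<Sum>m\<in>Poly_Mapping.keys Q. Poly_Mapping.lookup Q m *
        (\<Prod>b\<in>Basis. t b ^ Poly_Mapping.lookup m b)) * alcove_exp L base_point"
      by (simp add: sum_distrib_right Lb)
    finally show "(\<Sum>m\<in>Poly_Mapping.keys Q. Poly_Mapping.lookup Q m *
        (\<Prod>b\<in>Basis. t b ^ Poly_Mapping.lookup m b)) = 0"
      using base_point_in_alcove by (simp add: alcove_exp_def)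
  qed (simp_all add: that)
  then have "Q = 0"
    by (metis in_keys_iff lookup_zero poly_mapping_eqI)
  then show ?thesis
    by (simp add: Q abs_sym_algebra_eqs)
qed

text \<open>
  Testing on functions supported in the single alcove \<open>w\<^sup>-\<^sup>1(alcove)\<close> isolates the coefficient of \<open>w\<close>,
  since the Weyl group acts freely on the alcoves.
\<close>

lemma tensor_op_faithful:
  assumes h: "h \<in> Tensors" and 0: "\<And>f. f \<in> C \<Longrightarrow> tensor_op h f = (\<lambda>x. 0)"
  shows "h = 0"
proof (rule poly_mapping_eqI)
  fix w
  show "Poly_Mapping.lookup h w = Poly_Mapping.lookup 0 w"
  proof (cases "w \<in> Poly_Mapping.keys h")
    case True
    then have w: "w \<in> carrier Weyl"
      using h by (auto simp: Tensors_iff)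
    have "sym_op (Poly_Mapping.lookup h w) (alcove_exp L) y = 0" if L: "bounded_linear L" and y: "y \<in> alcove" for L y
    proof -
      let ?g = "alcove_exp L" and ?i = "inv_into UNIV w"
      have g: "?g \<in> C"
        by (rule alcove_exp_in[OF L])
      have i: "?i \<in> carrier Weyl" "?i \<circ> w = id" "w \<circ> ?i = id"
        using Weyl_inv[OF w] Weyl_bij[OF w] by (auto simp only: bij_is_inj bij_is_surj surj_iff[symmetric] inv_o_cancel)
      have f: "fun_action ?i ?g \<in> C"
        using i g by (simp add: C_fun_action)
      \<comment> \<open>For \<open>u\<close> different from \<open>w\<close>, the element
        \<open>u \<circ> ?i\<close> is not the identity, so by freeness the translated function
        vanishes on the alcove. The operators are local there, so the summand is 0 at
        \<open>y\<close>.\<close>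
      have other: "sym_op (Poly_Mapping.lookup h u) (fun_action u (fun_action ?i ?g)) y = 0"
        if u: "u \<in> Poly_Mapping.keys h - {w}" for u
      proof (rule sym_op_alcove_eq_0[OF _ _ y])
        have uW: "u \<in> carrier Weyl"
          using u h by (auto simp: Tensors_iff)
        show "fun_action u (fun_action ?i ?g) \<in> C"
          using uW f by (simp add: C_fun_action)
        fix z
        assume z: "z \<in> alcove"
        let ?v = "u \<circ> ?i"
        have v: "?v \<in> carrier Weyl"
          using uW i by (simp add: Weyl_comp del: comp_apply)
        have "?v \<noteq> id"
          using u i(2) by (metis DiffD2 comp_assoc comp_id id_comp singletonI)
        then have "inv_into UNIV ?v \<noteq> id"
          using Weyl_bij[OF v] by (metis inv_id inv_inv_eq)
        then have "inv_into UNIV ?v z \<notin> alcove"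
          using Weyl_free[OF Weyl_inv[OF v] z] by blast
        moreover have "fun_action u (fun_action ?i ?g) = fun_action ?v ?g"
          by (rule fun_action_mult[OF uW i(1), symmetric])
        ultimately show "fun_action u (fun_action ?i ?g) z = 0"
          by (simp add: fun_action_def[of ?v] alcove_exp_def)
      qed
      have "0 = tensor_op h (fun_action ?i ?g) y"
        using 0[OF f] by simp
      also have "\<dots> = sym_op (Poly_Mapping.lookup h w) (fun_action w (fun_action ?i ?g)) y"
        unfolding tensor_op_def using True other by (simp add: sum.remove)
      also have "fun_action w (fun_action ?i ?g) = ?g"
        using fun_action_mult[OF w i(1), of ?g] i(3) by simp
      finally show ?thesis
        by simp
    qed
    then show ?thesis
      using sym_op_alcove_exp_eq_0[of "Poly_Mapping.lookup h w"] by simp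
  qed (simp add: in_keys_iff)
qed

end

section \<open>The degenerate affine Hecke algebra\<close>

lemma tensor_single: "tensor p (Poly_Mapping.single w c) = Poly_Mapping.single w (sym_scale c p)"
  by (rule poly_mapping_eqI) (simp add: lookup_tensor lookup_single when_def)

lemma tensor_scale_single: "tensor_scale c (Poly_Mapping.single w p) = Poly_Mapping.single w (sym_scale c p)"
  by (rule poly_mapping_eqI) (simp add: lookup_tensor_scale lookup_single when_def)

lemma tensor_add:
  "tensor (p + q) c = tensor p c + tensor q c" "tensor p (c + d) = tensor p c + tensor p d"
  by (rule poly_mapping_eqI, simp add: lookup_tensor lookup_add sym_scale_add_right sym_scale_add_left)+

lemma tensor_0_right [simp]: "tensor p 0 = 0"
  by (rule poly_mapping_eqI) (simp add: lookup_tensor)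

lemma tensor_one_eq_iff: "tensor (1 :: 'v::real_vector sym_algebra) c = tensor 1 d \<longleftrightarrow> c = d"
proof
  assume eq: "tensor (1 :: 'v sym_algebra) c = tensor 1 d"
  show "c = d"
  proof (rule poly_mapping_eqI)
    fix g
    have "sym_scale (Poly_Mapping.lookup c g) 1 = sym_scale (Poly_Mapping.lookup d g) (1 :: 'v sym_algebra)"
      using arg_cong[OF eq, of "\<lambda>h. Poly_Mapping.lookup h g"] by (simp add: lookup_tensor)
    then have "sym_scale (Poly_Mapping.lookup c g - Poly_Mapping.lookup d g) (1 :: 'v sym_algebra) = 0"
      using sym_scale_add_left[of "Poly_Mapping.lookup c g - Poly_Mapping.lookup d g" "Poly_Mapping.lookup d g" "1 :: 'v sym_algebra"]
      by simp
    then show "Poly_Mapping.lookup c g = Poly_Mapping.lookup d g"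
      by (simp add: sym_scale_eq_0_iff)
  qed
qed simp

lemma group_algebra_simps:
  "carrier (group_algebra G) = {c. Poly_Mapping.keys c \<subseteq> carrier G}"
  "\<one>\<^bsub>group_algebra G\<^esub> = Poly_Mapping.single \<one>\<^bsub>G\<^esub> 1"
  "c \<oplus>\<^bsub>group_algebra G\<^esub> d = c + d"
  "r \<odot>\<^bsub>group_algebra G\<^esub> c = Poly_Mapping.map ((*) r) c"
  by (simp_all add: group_algebra_def)

lemma group_algebra_mult_single:
  "Poly_Mapping.single g r \<otimes>\<^bsub>group_algebra G\<^esub> Poly_Mapping.single h s = Poly_Mapping.single (g \<otimes>\<^bsub>G\<^esub> h) (r * s)"
  by (simp add: group_algebra_def)

lemma complex_ring_simps:
  "carrier complex_ring = UNIV" "c \<otimes>\<^bsub>complex_ring\<^esub> d = c * d" "\<one>\<^bsub>complex_ring\<^esub> = 1"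
  "\<zero>\<^bsub>complex_ring\<^esub> = 0" "c \<oplus>\<^bsub>complex_ring\<^esub> d = c + d"
  by (simp_all add: ring_of_type_algebra_def)

lemma Sym_simps:
  "carrier Sym = UNIV" "p \<otimes>\<^bsub>Sym\<^esub> q = p * q" "\<one>\<^bsub>Sym\<^esub> = 1" "p \<oplus>\<^bsub>Sym\<^esub> q = p + q" "c \<odot>\<^bsub>Sym\<^esub> p = sym_scale c p"
  by (simp_all add: Sym_def)

lemma algebra_homI:
  assumes "\<And>x. x \<in> carrier A \<Longrightarrow> h x \<in> carrier B"
    and "\<And>x y. x \<in> carrier A \<Longrightarrow> y \<in> carrier A \<Longrightarrow> h (x \<otimes>\<^bsub>A\<^esub> y) = h x \<otimes>\<^bsub>B\<^esub> h y"
    and "\<And>x y. x \<in> carrier A \<Longrightarrow> y \<in> carrier A \<Longrightarrow> h (x \<oplus>\<^bsub>A\<^esub> y) = h x \<oplus>\<^bsub>B\<^esub> h y"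
    and "h \<one>\<^bsub>A\<^esub> = \<one>\<^bsub>B\<^esub>"
    and "\<And>c x. x \<in> carrier A \<Longrightarrow> h (c \<odot>\<^bsub>A\<^esub> x) = c \<odot>\<^bsub>B\<^esub> h x"
  shows "h \<in> algebra_hom A B"
  using assms by (simp add: algebra_hom_def ring_hom_memI)

lemma algebra_homD:
  assumes "h \<in> algebra_hom A B"
  shows "x \<in> carrier A \<Longrightarrow> h x \<in> carrier B"
    and "x \<in> carrier A \<Longrightarrow> y \<in> carrier A \<Longrightarrow> h (x \<otimes>\<^bsub>A\<^esub> y) = h x \<otimes>\<^bsub>B\<^esub> h y"
    and "x \<in> carrier A \<Longrightarrow> y \<in> carrier A \<Longrightarrow> h (x \<oplus>\<^bsub>A\<^esub> y) = h x \<oplus>\<^bsub>B\<^esub> h y"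
    and "h \<one>\<^bsub>A\<^esub> = \<one>\<^bsub>B\<^esub>"
    and "x \<in> carrier A \<Longrightarrow> h (c \<odot>\<^bsub>A\<^esub> x) = c \<odot>\<^bsub>B\<^esub> h x"
  using assms by (auto simp: algebra_hom_def ring_hom_def)

context affine_setting
begin

section \<open>The algebra structure on the tensor space\<close>

lemma tensor_in: "c \<in> carrier (group_algebra Weyl) \<Longrightarrow> tensor p c \<in> Tensors"
  by (auto simp: Tensors_iff group_algebra_simps in_keys_iff lookup_tensor) (metis in_keys_iff subsetD sym_scale_zero_left)

lemma tensor_op_tensor:
  assumes "f \<in> C" "c \<in> carrier (group_algebra Weyl)"
  shows "tensor_op (tensor p c) f = (\<lambda>x. \<Sum>w\<in>Poly_Mapping.keys c. Poly_Mapping.lookup c w * sym_op p (fun_action w f) x)"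
proof -
  have K: "Poly_Mapping.keys c \<subseteq> carrier Weyl" "Poly_Mapping.keys (tensor p c) \<subseteq> Poly_Mapping.keys c"
    using assms by (auto simp: group_algebra_simps in_keys_iff lookup_tensor)
  have "fun_action w f \<in> C" if "w \<in> Poly_Mapping.keys c" for w
    using that K assms C_fun_action by blast
  then show ?thesis
    using tensor_op_superset[OF assms(1) finite_keys K(2,1)] by (simp add: lookup_tensor sym_op_scale)
qed

lemma tensor_op_sum:
  assumes "f \<in> C" "\<And>i. i \<in> A \<Longrightarrow> h i \<in> Tensors"
  shows "(\<Sum>i\<in>A. h i) \<in> Tensors \<and> tensor_op (\<Sum>i\<in>A. h i) f = (\<lambda>x. \<Sum>i\<in>A. tensor_op (h i) f x)"
  using assms(2)
  by (induction A rule: infinite_finite_induct) (simp_all add: Tensors_0 Tensors_add tensor_op_add assms(1))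

lemma sym_op_sum:
  assumes "\<And>i. i \<in> A \<Longrightarrow> F i \<in> C"
  shows "sym_op p (\<lambda>x. \<Sum>i\<in>A. F i x) = (\<lambda>x. \<Sum>i\<in>A. sym_op p (F i) x)"
  using assms
proof (induction A rule: infinite_finite_induct)
  case (insert i A)
  then show ?case
    using sym_op_linear(1)[of "F i" "\<lambda>x. \<Sum>i\<in>A. F i x" p] sum_in[of A F] by simp
qed (use sym_op_linear(2)[OF zero_in zero_in, of p 0] in simp_all)

text \<open>Faithfulness in the form in which it is used: identities between tensors are tested on
  functions.\<close>

lemma tensor_eqI:
  assumes "h \<in> Tensors" "h' \<in> Tensors" "\<And>f. f \<in> C \<Longrightarrow> tensor_op h f = tensor_op h' f"
  shows "h = h'"
proof -
  have d: "h + - h' \<in> Tensors"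
    using assms by (intro Tensors_add Tensors_uminus)
  have "tensor_op (h + - h') f = (\<lambda>x. 0)" if "f \<in> C" for f
    using tensor_op_add[OF that d assms(2)] assms(3)[OF that] by (simp add: fun_eq_iff)
  then have "h + - h' = 0"
    using tensor_op_faithful[OF d] by blast
  then show ?thesis
    by simp
qed

text \<open>The chosen tensor is unique by faithfulness. The value \<open>undefined\<close> outside
  the carrier is what the extensionality condition on the product demands.\<close>

definition hecke_mult ::
  "(('v \<Rightarrow> 'v) \<Rightarrow>\<^sub>0 'v sym_algebra) \<Rightarrow> (('v \<Rightarrow> 'v) \<Rightarrow>\<^sub>0 'v sym_algebra) \<Rightarrow> ('v \<Rightarrow> 'v) \<Rightarrow>\<^sub>0 'v sym_algebra" where
  "hecke_mult x y = (if x \<in> Tensors \<and> y \<in> Tensors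
     then SOME z. z \<in> Tensors \<and> (\<forall>f\<in>C. tensor_op x (tensor_op y f) = tensor_op z f) else undefined)"

lemma hecke_mult:
  assumes "x \<in> Tensors" "y \<in> Tensors"
  shows "hecke_mult x y \<in> Tensors"
    and "f \<in> C \<Longrightarrow> tensor_op (hecke_mult x y) f = tensor_op x (tensor_op y f)"
proof -
  have "realized (\<lambda>f. tensor_op x (tensor_op y f))"
    using assms by (intro realized_tensor_op realizedI[of y]) (auto intro: tensor_op_in)
  then have "\<exists>z. z \<in> Tensors \<and> (\<forall>f\<in>C. tensor_op x (tensor_op y f) = tensor_op z f)"
    unfolding realized_def by blast
  from someI_ex[OF this] show "hecke_mult x y \<in> Tensors"
    and "f \<in> C \<Longrightarrow> tensor_op (hecke_mult x y) f = tensor_op x (tensor_op y f)"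
    using assms unfolding hecke_mult_def by auto
qed

definition Hecke :: "(complex, ('v \<Rightarrow> 'v) \<Rightarrow>\<^sub>0 'v sym_algebra) module" where
  "Hecke = \<lparr>carrier = Tensors, mult = hecke_mult, one = Poly_Mapping.single id 1, zero = 0, add = (+),
     smult = tensor_scale\<rparr>"

lemma Hecke_simps:
  "carrier Hecke = Tensors" "mult Hecke = hecke_mult" "\<one>\<^bsub>Hecke\<^esub> = Poly_Mapping.single id 1"
  "\<zero>\<^bsub>Hecke\<^esub> = 0" "add Hecke = (+)" "smult Hecke = tensor_scale"
  by (simp_all add: Hecke_def)

lemma tensor_scale_simps:
  "tensor_scale (c + d) h = tensor_scale c h + tensor_scale d h"
  "tensor_scale c (h + h') = tensor_scale c h + tensor_scale c h'"
  "tensor_scale (c * d) h = tensor_scale c (tensor_scale d h)"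
  "tensor_scale 1 h = h"
  by (rule poly_mapping_eqI, simp add: lookup_tensor_scale lookup_add sym_scale_add_left sym_scale_add_right
      sym_scale_scale)+

lemma tensor_op_one: "f \<in> C \<Longrightarrow> tensor_op (Poly_Mapping.single id 1) f = f"
  by (simp only: tensor_op_single Weyl_id fun_action_id sym_op_1)

lemma abelian_group_Hecke: "abelian_group Hecke"
proof (rule abelian_groupI)
  show "\<exists>y\<in>carrier Hecke. y \<oplus>\<^bsub>Hecke\<^esub> x = \<zero>\<^bsub>Hecke\<^esub>" if "x \<in> carrier Hecke" for x
    using that by (intro bexI[of _ "- x"]) (simp_all add: Hecke_simps Tensors_uminus)
qed (simp_all add: Hecke_simps Tensors_add Tensors_0 add_ac)

text \<open>Associativity and distributivity are inherited from composition of linear operators by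
  \<open>tensor_eqI\<close>.\<close>

lemma ring_Hecke: "Ring.ring Hecke"
proof (rule ringI[OF abelian_group_Hecke])
  have one: "Poly_Mapping.single id 1 \<in> Tensors"
    by (simp only: Tensors_single Weyl_id)
  show "monoid Hecke"
    by (rule monoidI; unfold Hecke_simps)
      (auto intro!: tensor_eqI simp: one hecke_mult tensor_op_in tensor_op_one)
qed (unfold Hecke_simps, auto intro!: tensor_eqI
    simp: hecke_mult Tensors_add tensor_op_in tensor_op_add tensor_op_linear)

lemma complex_algebra_Hecke: "complex_algebra Hecke"
  unfolding complex_algebra_def
proof (intro conjI ring_Hecke allI ballI)
  show "Module.module complex_ring Hecke"
    by (rule moduleI[OF cring_from_type_algebra abelian_group_Hecke])
      (simp_all add: Hecke_simps complex_ring_simps tensor_scale_simps Tensors_scale)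
qed (unfold Hecke_simps, auto intro!: tensor_eqI
    simp: hecke_mult Tensors_scale tensor_op_in tensor_op_scale tensor_op_linear(2)[of _ "\<lambda>x. 0"] zero_in)

text \<open>\<open>on_tensor_space\<close> prescribes addition and zero; additive inverses, and with
  them subtraction, are then forced.\<close>

lemma tensor_space_minus:
  assumes H: "complex_algebra H" "on_tensor_space Weyl H" and x: "x \<in> Tensors" and y: "y \<in> Tensors"
  shows "x \<ominus>\<^bsub>H\<^esub> y = x - y"
proof -
  interpret ring H
    using H(1) by (simp add: complex_algebra_def)
  have H': "carrier H = Tensors" "\<zero>\<^bsub>H\<^esub> = 0" "add H = (+)"
    using H(2) by (simp_all add: on_tensor_space_def)
  have "\<ominus>\<^bsub>H\<^esub> y = - y"
    using y by (intro minus_equality) (simp_all add: H' Tensors_uminus)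
  then show ?thesis
    by (simp add: a_minus_def H')
qed

text \<open>Both sides expand to the same double sum over the two supports, because the action turns
  products of group elements into composites.\<close>

lemma group_op_mult:
  assumes c: "c \<in> carrier (group_algebra Weyl)" and d: "d \<in> carrier (group_algebra Weyl)" and f: "f \<in> C"
  shows "c \<otimes>\<^bsub>group_algebra Weyl\<^esub> d \<in> carrier (group_algebra Weyl)"
    and "tensor_op (tensor 1 (c \<otimes>\<^bsub>group_algebra Weyl\<^esub> d)) f = tensor_op (tensor 1 c) (tensor_op (tensor 1 d) f)"
proof -
  let ?c = "Poly_Mapping.keys c" and ?d = "Poly_Mapping.keys d"
  let ?s = "\<lambda>u w. Poly_Mapping.single (u \<circ> w) (Poly_Mapping.lookup c u * Poly_Mapping.lookup d w)"
  have W: "u \<in> carrier Weyl" if "u \<in> ?c \<union> ?d" for u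
    using that c d by (auto simp: group_algebra_simps)
  have prod: "c \<otimes>\<^bsub>group_algebra Weyl\<^esub> d = (\<Sum>u\<in>?c. \<Sum>w\<in>?d. ?s u w)"
    by (simp add: group_algebra_def Weyl_mult W del: comp_apply)
  have T: "tensor 1 (sum g A) = (\<Sum>i\<in>A. tensor 1 (g i))" for g :: "('v \<Rightarrow> 'v) \<Rightarrow> ('v \<Rightarrow> 'v) \<Rightarrow>\<^sub>0 complex" and A
    by (induction A rule: infinite_finite_induct) (simp_all add: tensor_add)
  have keys: "Poly_Mapping.keys (sum g A) \<subseteq> carrier Weyl" if "\<And>i. i \<in> A \<Longrightarrow> Poly_Mapping.keys (g i) \<subseteq> carrier Weyl"
    for g :: "('v \<Rightarrow> 'v) \<Rightarrow> ('v \<Rightarrow> 'v) \<Rightarrow>\<^sub>0 complex" and A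
    using that keys_sum[of g A] by blast
  show "c \<otimes>\<^bsub>group_algebra Weyl\<^esub> d \<in> carrier (group_algebra Weyl)"
    unfolding prod group_algebra_simps mem_Collect_eq
    by (intro keys) (auto simp: Weyl_comp W split: if_splits)
  have in_T: "tensor 1 (?s u w) \<in> Tensors" if "u \<in> ?c" "w \<in> ?d" for u w
    unfolding tensor_single by (intro Tensors_single Weyl_comp W) (use that in auto)
  have inner_T: "(\<Sum>w\<in>?d. tensor 1 (?s u w)) \<in> Tensors" if "u \<in> ?c" for u
    using tensor_op_sum[OF f, of ?d "\<lambda>w. tensor 1 (?s u w)"] in_T[OF that] by blast
  have single: "tensor_op (tensor 1 (?s u w)) f x =
      Poly_Mapping.lookup c u * (Poly_Mapping.lookup d w * fun_action u (fun_action w f) x)"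
    if "u \<in> ?c" "w \<in> ?d" for u w x
  proof -
    have "u \<in> carrier Weyl" "w \<in> carrier Weyl"
      using that W by auto
    then show ?thesis
      unfolding tensor_single
      using f by (simp only: tensor_op_single Weyl_comp sym_op_scale C_fun_action sym_op_1 fun_action_mult mult.assoc)
  qed
  have "tensor_op (tensor 1 (c \<otimes>\<^bsub>group_algebra Weyl\<^esub> d)) f x =
      (\<Sum>u\<in>?c. Poly_Mapping.lookup c u * (\<Sum>w\<in>?d. Poly_Mapping.lookup d w * fun_action u (fun_action w f) x))" for x
  proof -
    have "tensor_op (tensor 1 (c \<otimes>\<^bsub>group_algebra Weyl\<^esub> d)) f x =
        (\<Sum>u\<in>?c. tensor_op (\<Sum>w\<in>?d. tensor 1 (?s u w)) f x)"
      unfolding prod T using tensor_op_sum[OF f, of ?c "\<lambda>u. \<Sum>w\<in>?d. tensor 1 (?s u w)"] inner_T by simp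
    also have "\<dots> = (\<Sum>u\<in>?c. \<Sum>w\<in>?d. tensor_op (tensor 1 (?s u w)) f x)"
    proof (intro sum.cong refl)
      fix u
      assume "u \<in> ?c"
      then show "tensor_op (\<Sum>w\<in>?d. tensor 1 (?s u w)) f x = (\<Sum>w\<in>?d. tensor_op (tensor 1 (?s u w)) f x)"
        using tensor_op_sum[OF f, of ?d "\<lambda>w. tensor 1 (?s u w)"] in_T by simp
    qed
    finally show ?thesis
      by (simp add: single sum_distrib_left)
  qed
  moreover have "tensor_op (tensor 1 c) (tensor_op (tensor 1 d) f) x =
      (\<Sum>u\<in>?c. Poly_Mapping.lookup c u * (\<Sum>w\<in>?d. Poly_Mapping.lookup d w * fun_action u (fun_action w f) x))" for x
  proof -
    have g: "tensor_op (tensor 1 d) f \<in> C"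
      using f d by (intro tensor_op_in tensor_in)
    have "tensor_op (tensor 1 d) f = (\<lambda>x. \<Sum>w\<in>?d. Poly_Mapping.lookup d w * fun_action w f x)"
      using tensor_op_tensor[OF f d, of 1] f W by (simp add: C_fun_action)
    then have "fun_action u (tensor_op (tensor 1 d) f) x = (\<Sum>w\<in>?d. Poly_Mapping.lookup d w * fun_action u (fun_action w f) x)" for u
      by (simp add: fun_action_def)
    then show ?thesis
      using tensor_op_tensor[OF g c, of 1] g W by (simp add: C_fun_action)
  qed
  ultimately show "tensor_op (tensor 1 (c \<otimes>\<^bsub>group_algebra Weyl\<^esub> d)) f = tensor_op (tensor 1 c) (tensor_op (tensor 1 d) f)"
    by (intro ext) simp
qed

lemma of_sym_eq: "tensor p \<one>\<^bsub>group_algebra Weyl\<^esub> = Poly_Mapping.single id p"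
  unfolding group_algebra_simps Weyl_one tensor_single by simp

text \<open>The conditions on products are tested on functions by \<open>tensor_eqI\<close>; in
  particular the cross relation becomes \<open>Dunkl_cross\<close>.\<close>

lemma Hecke_algebra_Hecke: "Hecke_algebra \<Sigma>0 I0 \<phi> k Hecke"
  unfolding Hecke_algebra_def Let_def of_sym_eq tensor_single sym_scale_one
proof (intro conjI allI ballI)
  have id_in: "Poly_Mapping.single id p \<in> Tensors" for p
    by (simp only: Tensors_single Weyl_id)
  have id_op: "tensor_op (Poly_Mapping.single id p) f = sym_op p f" if "f \<in> C" for p f
    using that by (simp only: tensor_op_single Weyl_id fun_action_id)
  show "complex_algebra Hecke"
    by (rule complex_algebra_Hecke)
  show "case_prod (mult Hecke) \<in> extensional (carrier Hecke \<times> carrier Hecke)"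
    by (auto simp: extensional_def Hecke_simps hecke_mult_def)
  show ts: "on_tensor_space Weyl Hecke"
    by (simp add: on_tensor_space_def Hecke_simps)
  show "(\<lambda>p. Poly_Mapping.single id p) \<in> algebra_hom Sym Hecke"
  proof (rule algebra_homI)
    show "Poly_Mapping.single id (p \<otimes>\<^bsub>Sym\<^esub> q) = Poly_Mapping.single id p \<otimes>\<^bsub>Hecke\<^esub> Poly_Mapping.single id q" for p q
      unfolding Hecke_simps Sym_simps
      by (rule tensor_eqI) (simp_all only: id_in hecke_mult id_op sym_op_mult sym_op_in)
  qed (simp_all only: Hecke_simps Sym_simps id_in single_add tensor_scale_single)
  show "inj_on (\<lambda>p. Poly_Mapping.single id p :: ('v \<Rightarrow> 'v) \<Rightarrow>\<^sub>0 'v sym_algebra) (carrier Sym)"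
    by (rule inj_onI) (metis lookup_single_eq)
  show "tensor 1 \<in> algebra_hom (group_algebra Weyl) Hecke"
  proof (rule algebra_homI; unfold Hecke_simps)
    fix c d :: "('v \<Rightarrow> 'v) \<Rightarrow>\<^sub>0 complex" and r
    assume c: "c \<in> carrier (group_algebra Weyl)"
    show "tensor 1 c \<in> Tensors"
      using c by (rule tensor_in)
    show "tensor 1 (r \<odot>\<^bsub>group_algebra Weyl\<^esub> c) = tensor_scale r (tensor 1 c)"
      by (rule poly_mapping_eqI)
        (simp add: group_algebra_simps lookup_tensor lookup_tensor_scale Poly_Mapping.map.rep_eq when_def sym_scale_scale)
    assume d: "d \<in> carrier (group_algebra Weyl)"
    show "tensor 1 (c \<oplus>\<^bsub>group_algebra Weyl\<^esub> d) = tensor 1 c + tensor 1 d"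
      by (simp add: group_algebra_simps tensor_add)
    show "tensor 1 (c \<otimes>\<^bsub>group_algebra Weyl\<^esub> d) = hecke_mult (tensor 1 c) (tensor 1 d)"
      using c d group_op_mult[OF c d] zero_in
      by (intro tensor_eqI) (simp_all add: tensor_in hecke_mult)
  qed (rule of_sym_eq)
  show "inj_on (tensor 1) (carrier (group_algebra Weyl))"
    by (rule inj_onI) (simp add: tensor_one_eq_iff)
  show "Poly_Mapping.single id p \<otimes>\<^bsub>Hecke\<^esub> tensor 1 c = tensor p c"
    if c: "c \<in> carrier (group_algebra Weyl)" for p c
    unfolding Hecke_simps
  proof (rule tensor_eqI)
    show "hecke_mult (Poly_Mapping.single id p) (tensor 1 c) \<in> Tensors"
      by (intro hecke_mult id_in tensor_in c)
    show "tensor p c \<in> Tensors"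
      by (rule tensor_in[OF c])
    fix f
    assume f: "f \<in> C"
    have w: "fun_action w f \<in> C" if "w \<in> Poly_Mapping.keys c" for w
      using that c f C_fun_action by (auto simp: group_algebra_simps)
    have "tensor_op (hecke_mult (Poly_Mapping.single id p) (tensor 1 c)) f = sym_op p (tensor_op (tensor 1 c) f)"
      using hecke_mult(2)[OF id_in tensor_in[OF c] f] id_op[OF tensor_op_in[OF f tensor_in[OF c]]] by simp
    also have "tensor_op (tensor 1 c) f = (\<lambda>x. \<Sum>w\<in>Poly_Mapping.keys c. Poly_Mapping.lookup c w * fun_action w f x)"
      using w by (simp add: tensor_op_tensor[OF f c])
    also have "sym_op p \<dots> = (\<lambda>x. \<Sum>w\<in>Poly_Mapping.keys c. Poly_Mapping.lookup c w * sym_op p (fun_action w f) x)"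
      using w by (simp add: sym_op_sum scale_in sym_op_linear(2)[of _ "\<lambda>x. 0"] zero_in)
    also have "\<dots> = tensor_op (tensor p c) f"
      by (simp add: tensor_op_tensor[OF f c])
    finally show "tensor_op (hecke_mult (Poly_Mapping.single id p) (tensor 1 c)) f = tensor_op (tensor p c) f" .
  qed
  fix a v
  assume a: "a \<in> Simple"
  let ?s = "Poly_Mapping.single (aff_reflection a) 1 :: ('v \<Rightarrow> 'v) \<Rightarrow>\<^sub>0 'v sym_algebra"
  let ?k = "complex_of_real (k a * blinfun_apply (fst a) v)"
  let ?v = "Poly_Mapping.single id (sym_embed v)" and ?l = "Poly_Mapping.single id (sym_embed (lin_reflection (fst a) v))"
  have s: "aff_reflection a \<in> carrier Weyl" "?s \<in> Tensors"
    using a by (simp_all add: Weyl_reflection Simple_in_Roots Tensors_single)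
  have "hecke_mult ?s ?v = hecke_mult ?l ?s + tensor_scale ?k (Poly_Mapping.single id 1)"
  proof (rule tensor_eqI)
    fix f
    assume f: "f \<in> C"
    have "tensor_op (hecke_mult ?s ?v) f = fun_action (aff_reflection a) (Dunkl v f)"
      using f s by (simp only: hecke_mult id_in id_op sym_op_embed tensor_op_single Dunkl_in C_fun_action sym_op_1)
    moreover have "tensor_op (hecke_mult ?l ?s) f = Dunkl (lin_reflection (fst a) v) (fun_action (aff_reflection a) f)"
      using f s by (simp only: hecke_mult id_in id_op sym_op_embed tensor_op_single C_fun_action sym_op_1)
    moreover have "tensor_op (tensor_scale ?k (Poly_Mapping.single id 1)) f = (\<lambda>x. ?k * f x)"
      using f by (simp only: tensor_op_scale id_in id_op sym_op_1)
    ultimately show "tensor_op (hecke_mult ?s ?v) f = tensor_op (hecke_mult ?l ?s + tensor_scale ?k (Poly_Mapping.single id 1)) f"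
      using f s by (simp only: tensor_op_add hecke_mult id_in Tensors_scale Dunkl_cross[OF f a])
  qed (intro hecke_mult Tensors_add Tensors_scale id_in s)+
  then have "hecke_mult ?s ?v - hecke_mult ?l ?s = tensor_scale ?k (Poly_Mapping.single id 1)"
    by (simp only: add_diff_cancel_left')
  then show "?s \<otimes>\<^bsub>Hecke\<^esub> ?v \<ominus>\<^bsub>Hecke\<^esub> ?l \<otimes>\<^bsub>Hecke\<^esub> ?s = ?k \<odot>\<^bsub>Hecke\<^esub> \<one>\<^bsub>Hecke\<^esub>"
    unfolding Hecke_simps
    using tensor_space_minus[OF complex_algebra_Hecke ts hecke_mult(1)[OF s(2) id_in] hecke_mult(1)[OF id_in s(2)]]
    by metis
qed

section \<open>The Dunkl representation\<close>

abbreviation "End \<equiv> End_algebra Smooth"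

lemma Smooth_simps: "f \<oplus>\<^bsub>Smooth\<^esub> g = (\<lambda>x. f x + g x)" "c \<odot>\<^bsub>Smooth\<^esub> f = (\<lambda>x. c * f x)"
  by (simp_all add: smooth_functions_def)

lemma End_simps:
  "S \<otimes>\<^bsub>End\<^esub> T = compose C S T" "\<one>\<^bsub>End\<^esub> = (\<lambda>f\<in>C. f)"
  "S \<oplus>\<^bsub>End\<^esub> T = (\<lambda>f\<in>C. \<lambda>x. S f x + T f x)" "c \<odot>\<^bsub>End\<^esub> T = (\<lambda>f\<in>C. \<lambda>x. c * T f x)"
  by (simp_all add: End_algebra_def Smooth_simps)

lemma End_carrier:
  "T \<in> carrier End \<longleftrightarrow> T \<in> C \<rightarrow>\<^sub>E C \<and> (\<forall>f\<in>C. \<forall>g\<in>C. T (\<lambda>x. f x + g x) = (\<lambda>x. T f x + T g x)) \<and>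
    (\<forall>c. \<forall>f\<in>C. T (\<lambda>x. c * f x) = (\<lambda>x. c * T f x))"
  by (simp add: End_algebra_def Smooth_simps)

lemma Dunkl_extensional: "Dunkl v \<in> extensional C"
  by (simp add: Dunkl_operator_def)

lemma sym_op_algebra_hom: "(\<lambda>p. restrict (sym_op p) C) \<in> algebra_hom Sym End"
proof (rule algebra_homI; unfold Sym_simps End_simps End_carrier)
  show "restrict (sym_op (p * q)) C = compose C (restrict (sym_op p) C) (restrict (sym_op q) C)" for p q
    by (rule extensionalityI[of _ C]) (auto simp: compose_def sym_op_mult sym_op_in)
qed (auto simp: sym_op_in sym_op_linear sym_op_linear(2)[of _ "\<lambda>x. 0"] zero_in add_in scale_in sym_op_add sym_op_scale
    intro!: restrict_ext)

lemma restrict_sym_op_embed: "restrict (sym_op (sym_embed v)) C = Dunkl v"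
  by (rule extensionalityI[of _ C]) (auto simp: sym_op_embed Dunkl_extensional)

text \<open>Resolves the definite description: evaluation at the commuting operators is such a
  morphism, and any other agrees with it on vectors, hence on the algebra that they
  generate.\<close>

lemma Dunkl_hom_eq: "Dunkl_hom \<Sigma>0 I0 \<phi> k = (\<lambda>p. restrict (sym_op p) C)"
  unfolding Dunkl_hom_def
proof (rule the_equality)
  show "(\<lambda>p. restrict (sym_op p) C) \<in> algebra_hom Sym End \<and>
      (\<forall>v. restrict (sym_op (sym_embed v)) C = Dunkl v)"
    using sym_op_algebra_hom restrict_sym_op_embed by blast
  fix \<Phi>
  assume \<Phi>: "\<Phi> \<in> algebra_hom Sym End \<and> (\<forall>v. \<Phi> (sym_embed v) = Dunkl v)"
  note hom = algebra_homD[OF conjunct1[OF \<Phi>], unfolded Sym_simps]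
    and hom' = algebra_homD[OF sym_op_algebra_hom, unfolded Sym_simps]
  show "\<Phi> = (\<lambda>p. restrict (sym_op p) C)"
  proof
    fix p
    show "\<Phi> p = restrict (sym_op p) C"
    proof (induction p rule: sym_algebra_induct)
      case one
      show ?case
        unfolding hom(4) hom'(4) ..
    next
      case (add p q)
      then show ?case
        using hom(3)[of p q] hom'(3)[of p q] by (metis UNIV_I)
    next
      case (scale c p)
      then show ?case
        using hom(5)[of p c] hom'(5)[of p c] by (metis UNIV_I)
    next
      case (embed v p)
      then show ?case
        using hom(2)[of "sym_embed v" p] hom'(2)[of "sym_embed v" p] \<Phi> restrict_sym_op_embed by (metis UNIV_I)
    qed
  qed
qed

definition sym_elt :: "'v sym_algebra \<Rightarrow> ('v \<Rightarrow> 'v) \<Rightarrow>\<^sub>0 'v sym_algebra" where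
  "sym_elt p = Poly_Mapping.single id p"

lemma of_sym_eq_sym_elt: "tensor p \<one>\<^bsub>group_algebra Weyl\<^esub> = sym_elt p"
  unfolding sym_elt_def by (rule of_sym_eq)

lemma sym_elt_in: "sym_elt p \<in> Tensors"
  by (simp only: sym_elt_def Tensors_single Weyl_id)

lemma sym_elt_op: "f \<in> C \<Longrightarrow> tensor_op (sym_elt p) f = sym_op p f"
  by (simp only: sym_elt_def tensor_op_single Weyl_id fun_action_id)

lemma sym_elt_linear:
  "sym_elt (p + q) = sym_elt p + sym_elt q" "sym_elt (sym_scale c p) = tensor_scale c (sym_elt p)" "sym_elt 0 = 0"
  by (simp_all only: sym_elt_def single_add tensor_scale_single single_zero)

definition Dunkl_rep where
  "Dunkl_rep = (\<lambda>h\<in>Tensors. restrict (tensor_op h) C)"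

lemma Dunkl_rep_inj: "inj_on Dunkl_rep Tensors"
proof (rule inj_onI)
  fix h h'
  assume h: "h \<in> Tensors" "h' \<in> Tensors" and eq: "Dunkl_rep h = Dunkl_rep h'"
  show "h = h'"
  proof (rule tensor_eqI[OF h])
    show "tensor_op h f = tensor_op h' f" if "f \<in> C" for f
      using fun_cong[OF eq, of f] that h by (simp add: Dunkl_rep_def)
  qed
qed

end

text \<open>
  Any product satisfying the defining conditions is the composition of the associated operators: the cross
  relations allow one to move reflections past \<open>S(V)\<close> one linear factor at a time.
\<close>

locale hecke_algebra = affine_setting +
  fixes H
  assumes H: "Hecke_algebra \<Sigma>0 I0 \<phi> k H"
begin

abbreviation "grp_elt w \<equiv> Poly_Mapping.single w 1 :: ('a \<Rightarrow> 'a) \<Rightarrow>\<^sub>0 'a sym_algebra"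

lemma hecke_conditions:
  shows alg: "complex_algebra H"
    and ext: "case_prod (mult H) \<in> extensional (carrier H \<times> carrier H)"
    and space: "on_tensor_space Weyl H"
    and of_sym: "(\<lambda>p. sym_elt p) \<in> algebra_hom Sym H"
    and of_grp: "(\<lambda>c. tensor 1 c) \<in> algebra_hom (group_algebra Weyl) H"
    and of_tensor: "c \<in> carrier (group_algebra Weyl) \<Longrightarrow> sym_elt p \<otimes>\<^bsub>H\<^esub> tensor 1 c = tensor p c"
    and cross: "a \<in> Simple \<Longrightarrow> grp_elt (aff_reflection a) \<otimes>\<^bsub>H\<^esub> sym_elt (sym_embed v) \<ominus>\<^bsub>H\<^esub>
      sym_elt (sym_embed (lin_reflection (fst a) v)) \<otimes>\<^bsub>H\<^esub> grp_elt (aff_reflection a) =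
      complex_of_real (k a * blinfun_apply (fst a) v) \<odot>\<^bsub>H\<^esub> \<one>\<^bsub>H\<^esub>"
  using H unfolding Hecke_algebra_def Let_def of_sym_eq_sym_elt tensor_single sym_scale_one by blast+

sublocale ring H
  using alg by (simp add: complex_algebra_def)

lemma H_simps: "carrier H = Tensors" "\<zero>\<^bsub>H\<^esub> = 0" "add H = (+)" "smult H = tensor_scale"
  using space by (simp_all add: on_tensor_space_def)

lemma H_one: "\<one>\<^bsub>H\<^esub> = sym_elt 1"
  using algebra_homD(4)[OF of_sym] by (simp add: Sym_simps)

lemma mult_in: "x \<in> Tensors \<Longrightarrow> y \<in> Tensors \<Longrightarrow> x \<otimes>\<^bsub>H\<^esub> y \<in> Tensors"
  using m_closed by (simp add: H_simps)

lemma mult_assoc: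
  "x \<in> Tensors \<Longrightarrow> y \<in> Tensors \<Longrightarrow> z \<in> Tensors \<Longrightarrow> x \<otimes>\<^bsub>H\<^esub> y \<otimes>\<^bsub>H\<^esub> z = x \<otimes>\<^bsub>H\<^esub> (y \<otimes>\<^bsub>H\<^esub> z)"
  using m_assoc by (simp add: H_simps)

lemma mult_add:
  assumes "x \<in> Tensors" "y \<in> Tensors" "z \<in> Tensors"
  shows "(x + y) \<otimes>\<^bsub>H\<^esub> z = x \<otimes>\<^bsub>H\<^esub> z + y \<otimes>\<^bsub>H\<^esub> z"
    and "x \<otimes>\<^bsub>H\<^esub> (y + z) = x \<otimes>\<^bsub>H\<^esub> y + x \<otimes>\<^bsub>H\<^esub> z"
  using l_distr[of x y z] r_distr[of y z x] assms by (simp_all add: H_simps)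

lemma mult_0: "x \<in> Tensors \<Longrightarrow> 0 \<otimes>\<^bsub>H\<^esub> x = 0" "x \<in> Tensors \<Longrightarrow> x \<otimes>\<^bsub>H\<^esub> 0 = 0"
  using l_null[of x] r_null[of x] by (simp_all add: H_simps)

lemma mult_scale:
  "x \<in> Tensors \<Longrightarrow> y \<in> Tensors \<Longrightarrow> tensor_scale c x \<otimes>\<^bsub>H\<^esub> y = tensor_scale c (x \<otimes>\<^bsub>H\<^esub> y)"
  "x \<in> Tensors \<Longrightarrow> y \<in> Tensors \<Longrightarrow> x \<otimes>\<^bsub>H\<^esub> tensor_scale c y = tensor_scale c (x \<otimes>\<^bsub>H\<^esub> y)"
  using alg by (simp_all add: complex_algebra_def H_simps)

lemma one_mult: "x \<in> Tensors \<Longrightarrow> sym_elt 1 \<otimes>\<^bsub>H\<^esub> x = x" "x \<in> Tensors \<Longrightarrow> x \<otimes>\<^bsub>H\<^esub> sym_elt 1 = x"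
  using l_one[of x] r_one[of x] by (simp_all only: H_simps H_one)

lemma sym_elt_mult: "sym_elt p \<otimes>\<^bsub>H\<^esub> sym_elt q = sym_elt (p * q)"
  using algebra_homD(2)[OF of_sym, of p q] by (simp add: Sym_simps)

lemma grp_elt_mult: "u \<in> carrier Weyl \<Longrightarrow> w \<in> carrier Weyl \<Longrightarrow> grp_elt u \<otimes>\<^bsub>H\<^esub> grp_elt w = grp_elt (u \<circ> w)"
  using algebra_homD(2)[OF of_grp, of "Poly_Mapping.single u 1" "Poly_Mapping.single w 1"]
  by (simp add: group_algebra_simps group_algebra_mult_single tensor_single Weyl_mult del: comp_apply)

lemma sym_grp_elt_mult: "w \<in> carrier Weyl \<Longrightarrow> sym_elt p \<otimes>\<^bsub>H\<^esub> grp_elt w = Poly_Mapping.single w p"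
  using of_tensor[of "Poly_Mapping.single w 1" p] by (simp add: group_algebra_simps tensor_single)

lemma cross':
  assumes a: "a \<in> Simple"
  shows "grp_elt (aff_reflection a) \<otimes>\<^bsub>H\<^esub> sym_elt (sym_embed v) =
    sym_elt (sym_embed (lin_reflection (fst a) v)) \<otimes>\<^bsub>H\<^esub> grp_elt (aff_reflection a) +
    tensor_scale (complex_of_real (k a * blinfun_apply (fst a) v)) (sym_elt 1)"
proof -
  have s: "grp_elt (aff_reflection a) \<in> Tensors"
    using a by (simp add: Tensors_single Weyl_reflection Simple_in_Roots)
  show ?thesis
    using cross[OF a, of v] tensor_space_minus[OF alg space mult_in[OF s sym_elt_in] mult_in[OF sym_elt_in s]]
    by (simp only: H_simps H_one diff_eq_eq) (simp add: add.commute)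
qed

text \<open>This property of a left factor is stable under products and sums, so it has to be
  established only for the generators, which are the elements of \<open>S(V)\<close> and the simple
  reflections.\<close>

definition multiplicative where
  "multiplicative x \<longleftrightarrow> x \<in> Tensors \<and> (\<forall>y\<in>Tensors. \<forall>f\<in>C. tensor_op (x \<otimes>\<^bsub>H\<^esub> y) f = tensor_op x (tensor_op y f))"

lemma multiplicative_mult:
  assumes "multiplicative x" "multiplicative y"
  shows "multiplicative (x \<otimes>\<^bsub>H\<^esub> y)"
  using assms by (simp add: multiplicative_def mult_in mult_assoc tensor_op_in)

lemma multiplicative_add:
  assumes "multiplicative x" "multiplicative y"
  shows "multiplicative (x + y)"
  using assms by (simp add: multiplicative_def mult_in mult_add tensor_op_in Tensors_add tensor_op_add)

lemma multiplicative_sym: "multiplicative (sym_elt p)"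
  unfolding multiplicative_def
proof (intro conjI ballI sym_elt_in)
  fix y f
  assume y: "y \<in> Tensors" and f: "f \<in> C"
  from y show "tensor_op (sym_elt p \<otimes>\<^bsub>H\<^esub> y) f = tensor_op (sym_elt p) (tensor_op y f)"
  proof (induction rule: Tensors_induct)
    case zero
    then show ?case
      using sym_op_linear(2)[OF zero_in zero_in, of p 0] by (simp add: mult_0 sym_elt_in sym_elt_op zero_in)
  next
    case (single w q)
    have w: "grp_elt w \<in> Tensors"
      using single by (rule Tensors_single)
    have "sym_elt p \<otimes>\<^bsub>H\<^esub> Poly_Mapping.single w q = Poly_Mapping.single w (p * q)"
      using mult_assoc[OF sym_elt_in sym_elt_in w, of p q] single by (simp add: sym_elt_mult sym_grp_elt_mult)
    then show ?case
      using f single by (simp add: tensor_op_single sym_elt_op sym_op_mult C_fun_action sym_op_in)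
  next
    case (add h h')
    then show ?case
      using f tensor_op_linear(1)[OF _ _ sym_elt_in]
      by (simp add: mult_add sym_elt_in tensor_op_add mult_in tensor_op_in)
  qed
qed

text \<open>Right multiplication by a group element only shifts the group part of each summand. This
  lets a right factor \<open>Poly_Mapping.single w q\<close> be reduced to
  \<open>sym_elt q\<close>.\<close>

lemma tensor_op_mult_grp:
  assumes z: "z \<in> Tensors" and w: "w \<in> carrier Weyl" and f: "f \<in> C"
  shows "tensor_op (z \<otimes>\<^bsub>H\<^esub> grp_elt w) f = tensor_op z (fun_action w f)"
  using z
proof (induction rule: Tensors_induct)
  case zero
  then show ?case
    using w by (simp add: mult_0 Tensors_single)
next
  case (single u p)
  have "Poly_Mapping.single u p \<otimes>\<^bsub>H\<^esub> grp_elt w = Poly_Mapping.single (u \<circ> w) p"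
    using mult_assoc[OF sym_elt_in Tensors_single Tensors_single, of u w p 1 1] single w
    by (simp only: sym_grp_elt_mult grp_elt_mult Weyl_comp)
  then show ?case
    using f w single by (simp only: tensor_op_single Weyl_comp fun_action_mult C_fun_action)
next
  case (add h h')
  then show ?case
    using f w by (simp add: mult_add Tensors_single tensor_op_add mult_in C_fun_action)
qed

text \<open>The place where the cross relations of \<open>H\<close> enter. They peel one vector from
  \<open>q\<close> on the left-hand side, \<open>Dunkl_cross\<close> does the same on the right-hand
  side, and both recursions start from the same value at 1.\<close>

lemma tensor_op_reflection_sym:
  assumes a: "a \<in> Simple" and f: "f \<in> C"
  shows "tensor_op (grp_elt (aff_reflection a) \<otimes>\<^bsub>H\<^esub> sym_elt q) f = fun_action (aff_reflection a) (sym_op q f)"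
proof (induction q rule: sym_algebra_induct)
  let ?s = "grp_elt (aff_reflection a)"
  have s: "aff_reflection a \<in> carrier Weyl" "?s \<in> Tensors"
    using a by (simp_all add: Weyl_reflection Simple_in_Roots Tensors_single)
  {
    case one
    show ?case
      using f s by (simp add: one_mult tensor_op_single C_fun_action)
  next
    case (add p q)
    then show ?case
      using f s by (simp add: sym_elt_linear mult_add sym_elt_in tensor_op_add mult_in sym_op_add fun_action_linear)
  next
    case (scale c p)
    then show ?case
      using f s by (simp add: sym_elt_linear mult_scale sym_elt_in tensor_op_scale mult_in sym_op_scale fun_action_linear)
  next
    case (embed v q)
    let ?l = "sym_elt (sym_embed (lin_reflection (fst a) v))"
      and ?k = "complex_of_real (k a * blinfun_apply (fst a) v)"
    have "?s \<otimes>\<^bsub>H\<^esub> sym_elt (sym_embed v * q) = ?s \<otimes>\<^bsub>H\<^esub> sym_elt (sym_embed v) \<otimes>\<^bsub>H\<^esub> sym_elt q"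
      using s(2) by (simp only: mult_assoc sym_elt_in sym_elt_mult)
    also have "\<dots> = ?l \<otimes>\<^bsub>H\<^esub> (?s \<otimes>\<^bsub>H\<^esub> sym_elt q) + tensor_scale ?k (sym_elt q)"
      using s(2) by (simp only: cross'[OF a] mult_add mult_in mult_assoc sym_elt_in Tensors_scale mult_scale one_mult)
    finally have "tensor_op (?s \<otimes>\<^bsub>H\<^esub> sym_elt (sym_embed v * q)) f =
        (\<lambda>x. tensor_op (?l \<otimes>\<^bsub>H\<^esub> (?s \<otimes>\<^bsub>H\<^esub> sym_elt q)) f x + ?k * sym_op q f x)"
      using f s(2) by (simp only: tensor_op_add mult_in sym_elt_in Tensors_scale tensor_op_scale sym_elt_op)
    also have "tensor_op (?l \<otimes>\<^bsub>H\<^esub> (?s \<otimes>\<^bsub>H\<^esub> sym_elt q)) f =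
        Dunkl (lin_reflection (fst a) v) (fun_action (aff_reflection a) (sym_op q f))"
      using multiplicative_sym[of "sym_embed (lin_reflection (fst a) v)"] f s embed
      by (simp add: multiplicative_def mult_in sym_elt_in sym_elt_op C_fun_action sym_op_in sym_op_embed)
    finally show ?case
      using f by (simp only: sym_op_mult sym_op_embed sym_op_in Dunkl_cross[OF _ a])
  }
qed

lemma multiplicative_reflection:
  assumes a: "a \<in> Simple"
  shows "multiplicative (grp_elt (aff_reflection a))"
  unfolding multiplicative_def
proof (intro conjI ballI)
  let ?s = "grp_elt (aff_reflection a)"
  show s: "?s \<in> Tensors"
    using a by (simp add: Weyl_reflection Simple_in_Roots Tensors_single)
  fix y f
  assume y: "y \<in> Tensors" and f: "f \<in> C"
  have op_s: "tensor_op ?s g = fun_action (aff_reflection a) g" if "g \<in> C" for g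
    using that a by (simp add: tensor_op_single Weyl_reflection Simple_in_Roots C_fun_action)
  from y show "tensor_op (?s \<otimes>\<^bsub>H\<^esub> y) f = tensor_op ?s (tensor_op y f)"
  proof (induction rule: Tensors_induct)
    case zero
    then show ?case
      using s by (simp add: mult_0 op_s zero_in) (simp add: fun_action_def)
  next
    case (single w q)
    have w: "grp_elt w \<in> Tensors"
      using single by (rule Tensors_single)
    \<comment> \<open>Splitting off the group element leaves the product of a reflection with an
      element of \<open>S(V)\<close>.\<close>
    have "?s \<otimes>\<^bsub>H\<^esub> Poly_Mapping.single w q = ?s \<otimes>\<^bsub>H\<^esub> sym_elt q \<otimes>\<^bsub>H\<^esub> grp_elt w"
      using mult_assoc[OF s sym_elt_in w, of q] single by (simp add: sym_grp_elt_mult)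
    then have "tensor_op (?s \<otimes>\<^bsub>H\<^esub> Poly_Mapping.single w q) f = tensor_op (?s \<otimes>\<^bsub>H\<^esub> sym_elt q) (fun_action w f)"
      using tensor_op_mult_grp[OF mult_in[OF s sym_elt_in] single f] by simp
    also have "\<dots> = fun_action (aff_reflection a) (sym_op q (fun_action w f))"
      using f single by (intro tensor_op_reflection_sym[OF a] C_fun_action)
    finally show ?case
      using f single by (simp add: tensor_op_single op_s sym_op_in C_fun_action)
  next
    case (add h h')
    then show ?case
      using f s tensor_op_linear(1)[OF _ _ s] by (simp add: mult_add tensor_op_add mult_in tensor_op_in)
  qed
qed

lemma multiplicative_all: "x \<in> Tensors \<Longrightarrow> multiplicative x"
proof (induction rule: Tensors_induct)
  case zero
  then show ?case
    by (simp add: multiplicative_def Tensors_0 mult_0)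
next
  case (single w p)
  have "multiplicative (grp_elt w)"
    using single
  proof (induction rule: Weyl_induct)
    case id
    \<comment> \<open>The unit of \<open>S(V)\<close> and the unit of the group give the same
      tensor.\<close>
    show ?case
      using multiplicative_sym[of 1] unfolding sym_elt_def .
  next
    case (reflection a w)
    have "grp_elt (aff_reflection a \<circ> w) = grp_elt (aff_reflection a) \<otimes>\<^bsub>H\<^esub> grp_elt w"
      using reflection(1,2) by (simp only: grp_elt_mult Weyl_reflection Simple_in_Roots)
    then show ?case
      using multiplicative_mult[OF multiplicative_reflection[OF reflection(1)] reflection(3)] by metis
  qed
  then show ?case
    using multiplicative_mult[OF multiplicative_sym] sym_grp_elt_mult[OF single] by metis
next
  case (add h h')
  then show ?case
    using multiplicative_add by blast
qed

lemma tensor_op_mult: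
  "x \<in> Tensors \<Longrightarrow> y \<in> Tensors \<Longrightarrow> f \<in> C \<Longrightarrow> tensor_op (x \<otimes>\<^bsub>H\<^esub> y) f = tensor_op x (tensor_op y f)"
  using multiplicative_all by (simp add: multiplicative_def)

text \<open>On the carrier two products with the same operators coincide by faithfulness; outside it
  extensionality makes both \<open>undefined\<close>.\<close>

lemma H_eq_Hecke: "H = Hecke"
proof -
  have "mult H x y = hecke_mult x y" for x y
  proof (cases "x \<in> Tensors \<and> y \<in> Tensors")
    case True
    then show ?thesis
      by (intro tensor_eqI) (simp_all add: mult_in hecke_mult tensor_op_mult)
  next
    case False
    then have "mult H x y = undefined"
      using ext extensional_arb[of "case_prod (mult H)" _ "(x, y)"] by (auto simp: H_simps)
    with False show ?thesis
      unfolding hecke_mult_def by metis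
  qed
  then have "mult H = hecke_mult"
    by blast
  then show ?thesis
    using H_simps H_one[unfolded sym_elt_def] by (intro module.equality) (simp_all add: Hecke_simps)
qed

lemma Dunkl_rep_algebra_hom: "Dunkl_rep \<in> algebra_hom H End"
proof (rule algebra_homI; unfold H_simps End_simps End_carrier)
  show "Dunkl_rep (x \<otimes>\<^bsub>H\<^esub> y) = compose C (Dunkl_rep x) (Dunkl_rep y)" if "x \<in> Tensors" "y \<in> Tensors" for x y
    using that
    by (intro extensionalityI[of _ C]) (auto simp: Dunkl_rep_def compose_def mult_in tensor_op_mult tensor_op_in)
  show "Dunkl_rep \<one>\<^bsub>H\<^esub> = (\<lambda>f\<in>C. f)"
    by (rule extensionalityI[of _ C]) (auto simp only: Dunkl_rep_def H_one sym_elt_in restrict_apply sym_elt_op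
        sym_op_1 restrict_extensional if_True)
qed (auto simp: Dunkl_rep_def tensor_op_in tensor_op_linear tensor_op_linear(2)[of _ "\<lambda>x. 0"] zero_in add_in scale_in
    tensor_op_add tensor_op_scale Tensors_add Tensors_scale intro!: restrict_ext)

lemma Dunkl_representation_Dunkl_rep: "Dunkl_representation \<Sigma>0 I0 \<phi> k H Dunkl_rep"
  unfolding Dunkl_representation_def Let_def Dunkl_hom_eq of_sym_eq_sym_elt tensor_single sym_scale_one H_simps
proof (intro conjI allI ballI Dunkl_rep_algebra_hom)
  show "Dunkl_rep \<in> extensional Tensors"
    by (simp add: Dunkl_rep_def)
  show "Dunkl_rep (sym_elt p) = restrict (sym_op p) C" for p
    using sym_elt_in by (simp add: Dunkl_rep_def sym_elt_op cong: restrict_cong)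
  show "Dunkl_rep (grp_elt w) = restrict (fun_action w) C" if "w \<in> carrier Weyl" for w
    using that by (simp add: Dunkl_rep_def Tensors_single tensor_op_single C_fun_action cong: restrict_cong)
qed

text \<open>A tensor with a single group element is the product of an element of \<open>S(V)\<close>
  and a group element, whose images are both prescribed.\<close>

lemma Dunkl_representation_unique:
  assumes \<pi>: "Dunkl_representation \<Sigma>0 I0 \<phi> k H \<pi>"
  shows "\<pi> = Dunkl_rep"
proof (rule extensionalityI)
  have rep: "\<rho> \<in> algebra_hom H End" "\<rho> \<in> extensional Tensors"
    "\<rho> (sym_elt p) = restrict (sym_op p) C"
    "w \<in> carrier Weyl \<Longrightarrow> \<rho> (grp_elt w) = restrict (fun_action w) C"
    if "Dunkl_representation \<Sigma>0 I0 \<phi> k H \<rho>" for \<rho> p w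
    using that
    unfolding Dunkl_representation_def Let_def Dunkl_hom_eq of_sym_eq_sym_elt tensor_single sym_scale_one H_simps by blast+
  note rep1 = rep[OF \<pi>] and rep2 = rep[OF Dunkl_representation_Dunkl_rep]
  note hom1 = algebra_homD[OF rep1(1), unfolded H_simps] and hom2 = algebra_homD[OF rep2(1), unfolded H_simps]
  show "\<pi> \<in> extensional Tensors" "Dunkl_rep \<in> extensional Tensors"
    by (rule rep1(2), rule rep2(2))
  fix h
  assume "h \<in> Tensors"
  then show "\<pi> h = Dunkl_rep h"
  proof (induction rule: Tensors_induct)
    case zero
    show ?case
      using rep1(3)[of 0] rep2(3)[of 0] by (simp only: sym_elt_linear)
  next
    case (single w p)
    then have "grp_elt w \<in> Tensors"
      by (rule Tensors_single)
    then show ?case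
      using hom1(2)[OF sym_elt_in, of "grp_elt w" p] hom2(2)[OF sym_elt_in, of "grp_elt w" p]
        rep1(3,4) rep2(3,4) single sym_grp_elt_mult[OF single] by metis
  next
    case (add h h')
    then show ?case
      using hom1(3) hom2(3) by simp
  qed
qed

end

theorem theorem4p2:
  fixes \<Sigma>0 I0 :: "('v::euclidean_space \<Rightarrow>\<^sub>L real) set"
    and \<phi> :: "'v \<Rightarrow>\<^sub>L real"
    and k :: "'v affine_functional \<Rightarrow> real"
  assumes "root_system \<Sigma>0" and "crystallographic \<Sigma>0" and "reduced_roots \<Sigma>0" and "irreducible_roots \<Sigma>0"
    and "root_basis \<Sigma>0 I0"
    and "highest_root \<Sigma>0 I0 \<phi>"
    and "multiplicity_function \<Sigma>0 k"
  shows "(\<exists>!H. Hecke_algebra \<Sigma>0 I0 \<phi> k H) \<and>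
    (\<forall>H. Hecke_algebra \<Sigma>0 I0 \<phi> k H \<longrightarrow>
       (\<exists>!\<pi>. Dunkl_representation \<Sigma>0 I0 \<phi> k H \<pi>) \<and>
       (\<forall>\<pi>. Dunkl_representation \<Sigma>0 I0 \<phi> k H \<pi> \<longrightarrow> inj_on \<pi> (carrier H)))"
proof -
  interpret affine_setting \<Sigma>0 I0 \<phi> k
    using assms by unfold_locales
  have H: "hecke_algebra \<Sigma>0 I0 \<phi> k H" if "Hecke_algebra \<Sigma>0 I0 \<phi> k H" for H
    using that by unfold_locales
  show ?thesis
  proof (intro conjI allI impI)
    show "\<exists>!H. Hecke_algebra \<Sigma>0 I0 \<phi> k H"
      using Hecke_algebra_Hecke hecke_algebra.H_eq_Hecke[OF H] by blast
    fix H
    assume "Hecke_algebra \<Sigma>0 I0 \<phi> k H"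
    then interpret hecke_algebra \<Sigma>0 I0 \<phi> k H
      by (rule H)
    show "\<exists>!\<pi>. Dunkl_representation \<Sigma>0 I0 \<phi> k H \<pi>"
      using Dunkl_representation_Dunkl_rep Dunkl_representation_unique by blast
    \<comment> \<open>By uniqueness it is enough that the constructed representation is
      injective.\<close>
    show "inj_on \<pi> (carrier H)" if "Dunkl_representation \<Sigma>0 I0 \<phi> k H \<pi>" for \<pi>
      using Dunkl_representation_unique[OF that] Dunkl_rep_inj H_simps(1) by simp
  qed
qed

end
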